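(* Let $\mathcal{M}$, $\mathcal{X}$, $D$, $K_{\min},K_{\max}$, $C_1,C_2,C_3,C_4$, $W=[w_{ij}]\in\mathbb{R}^{n\times n}$, $f_1,\dots,f_n$, $\delta$, $\sigma$, $G$ satisfy the network, manifold, bounded-gradient and unbiased-estimator assumptions stated in the context. Assume each $f_i$ is geodesically convex on $\mathcal{X}$, and let $x_\ast\in\arg\min_{x\in\mathcal{X}}\frac1n\sum_{i=1}^n f_i(x)$ (assumed to exist). Let $\eta_0:=\min\{1,D/G\}$, $\eta_t:=\eta_0/\sqrt{t}$ for $t\in\{1,\dots,T\}$, and $s:=C_2/(2C_1)$. Let the iterates be generated, for $i=1,\dots,n$ and $t=1,\dots,T$, by $$y_i^{t+1}=\exp_{x_i^t}\bigl(-\eta_t\,\widehat{\mathrm{grad}} f_i(x_i^t)\bigr),\qquad x_i^{t+1}=\exp_{y_i^{t+1}}\Bigl(s\sum_{j=1}^n w_{ij}\log_{y_i^{t+1}}(y_j^{t+1})\Bigr),$$ with common initialization $x_i^1=x^1\in\mathcal{X}$ for all $i$. Assume that all iterates $x_i^t$ and $y_i^t$ lie in $\mathcal{X}$. Let $\bar{x}^t$ be the Fréchet mean of $x_1^t,\dots,x_n^t$, and put $\bar{\mathbf{x}}^t=(\bar{x}^t,\dots,\bar{x}^t)\in\mathcal{X}^n$, $\mathbf{x}_\ast=(x_\ast,\dots,x_\ast)\in\mathcal{X}^n$, and $f(\mathbf{x})=\frac1n\sum_{i=1}^n f_i(x_i)$ for $\mathbf{x}=(x_1,\dots,x_n)\in\mathcal{X}^n$.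 Define $$\xi=\frac{C_2^3(1-\sigma_2(W))}{4C_1(1+C_4D^2)^2},\qquad C(\xi)=\frac{1+\xi^2}{\xi^4},\qquad B=(1-\xi)\bigl(2C_1(\sigma^2+\delta^2)+\xi^{-1}\delta^2\bigr).$$ Then for every horizon $T\ge 1$, $$\frac{\sum_{t=1}^T\eta_t\,\mathbb{E}[f(\bar{\mathbf{x}}^t)-f(\mathbf{x}_\ast)]}{\sum_{t=1}^T\eta_t}\le\frac{1}{2n\eta_0\sqrt{T}}\sum_{i=1}^n\mathbb{E}[d^2(x_i^1,x_\ast)]+\eta_0\Bigl(\delta\sqrt{C(\xi)B}+C_1(\sigma^2+\delta^2)\Bigr)\frac{1+\log T}{\sqrt{T}}.$$
   Context: Setting and notation. $\mathcal{M}$ is a finite-dimensional Riemannian manifold with Riemannian distance $d$; $\exp_x$ is the exponential map at $x$, $\log_x$ its inverse (logarithmic map), so that $\|\log_x(y)\|=d(x,y)$ where it is defined; $\mathrm{grad}$ is the Riemannian gradient; $\mathrm{inj}_{\mathcal{M}}(x)$ is the injectivity radius at $x$, and $\mathrm{inj}(\mathcal{X})=\inf_{x\in\mathcal{X}}\mathrm{inj}_{\mathcal{M}}(x)$. There are $n$ agents; agent $i$ has a local objective $f_i:\mathcal{X}\to\mathbb{R}$ of the form $f_i(x)=\mathbb{E}_{\xi_i\sim D_i}[F_i(x,\xi_i)]$. In $\log T$, $\log$ is the natural logarithm. Geodesic convexity of a function. $F:\mathcal{X}\to\mathbb{R}$ is geodesically convex if $F(y)\ge F(x)+\langle\mathrm{grad}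 F(x),\log_x(y)\rangle$ for all $x,y\in\mathcal{X}$. Network assumption. The network (a graph on the $n$ agents) is connected, and $W=[w_{ij}]\in\mathbb{R}^{n\times n}$ is symmetric, doubly stochastic, entrywise nonnegative, has positive diagonal entries, and $w_{ij}=0$ whenever agents $i\neq j$ are not connected. $\sigma_2(W)$ is the second largest singular value of $W$; under these conditions $\sigma_2(W)\in[0,1)$ (in particular the graph is that for which $W$ mixes, as is understood in this assumption). Manifold assumption. $\mathcal{X}\subset\mathcal{M}$ is geodesically convex (the minimizing geodesic between any two of its points lies in $\mathcal{X}$). The sectional curvature $K$ inside $\mathcal{X}$ satisfies $K_{\min}\le K\le K_{\max}$. The diameter of $\mathcal{X}$ is bounded by $D>0$ with $D<\mathrm{inj}(\mathcal{X})$; if $K_{\max}>0$, also $D<\pi/(2\sqrt{K_{\max}})$. Thus $\log_x(y)$ exists uniquely for all $x,y\in\mathcal{X}$. The geometric constants $C_1\ge 1$, $0<C_2\le 1$, $C_3\ge 0$, $C_4\ge 0$, depending only on the curvature bounds and $D$, are fixed constants for which the following comparison inequalities hold: for all $a,b,c\in\mathcal{X}$, $$C_2d^2(b,c)+d^2(a,b)-2\langle\log_b(a),\log_b(c)\rangle\le d^2(a,c)\le C_1d^2(b,c)+d^2(a,b)-2\langle\log_b(a),\log_b(c)\rangle,$$ and for all $x,y,z\in\mathcal{X}$, $$(1+C_3D^2)^{-1}d(y,z)\le\|\log_x(y)-\log_x(z)\|\le(1+C_4D^2)d(y,z).$$ Bounded-gradient assumption. Each $f_i$ is continuously differentiable on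 $\mathcal{X}$ and there is $\delta>0$ with $\|\mathrm{grad} f_i(x)\|\le\delta$ for all $x\in\mathcal{X}$ and all $i$ (consequently each $f_i$ is $\delta$-Lipschitz on $\mathcal{X}$). Unbiased-estimator assumption. $\widehat{\mathrm{grad}} f_i(x_i^t)\in T_{x_i^t}\mathcal{M}$ is a random (stochastic gradient) tangent vector. With $\mathcal{F}_t$ the filtration generated by the iterates $\{(x_1^k,\dots,x_n^k)\}_{k=1}^t$, for each $i,t$: (i) $\mathbb{E}[\widehat{\mathrm{grad}} f_i(x_i^t)\mid\mathcal{F}_t]=\mathrm{grad} f_i(x_i^t)$; (ii) $\mathbb{E}[\|\widehat{\mathrm{grad}} f_i(x_i^t)-\mathrm{grad} f_i(x_i^t)\|^2\mid\mathcal{F}_t]\le\sigma^2$; (iii) there is $G>0$ with $\|\widehat{\mathrm{grad}} f_i(x_i^t)\|\le G$ almost surely. Fréchet mean. For $\{x_i\}_{i=1}^n\subset\mathcal{X}$, the Fréchet mean is $\bar{x}\in\arg\min_{x\in\mathcal{X}}\frac1n\sum_{i=1}^n d^2(x_i,x)$. Under the manifold assumption it exists uniquely and lies in $\mathcal{X}$ (a known fact the paper relies on). *)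

theory Defs
  imports "HOL-Probability.Probability"
begin

section \<open>Smooth maps between open subsets of normed spaces\<close>

primrec Ck_on :: "nat \<Rightarrow> 'a::real_normed_vector set \<Rightarrow> ('a \<Rightarrow> 'b::real_normed_vector) \<Rightarrow> bool" where
  "Ck_on 0 S f \<longleftrightarrow> continuous_on S f"
| "Ck_on (Suc k) S f \<longleftrightarrow>
     (\<exists>f'. (\<forall>x\<in>S. (f has_derivative f' x) (at x)) \<and> (\<forall>v. Ck_on k S (\<lambda>x. f' x v)))"

definition smooth_on :: "'a::real_normed_vector set \<Rightarrow> ('a \<Rightarrow> 'b::real_normed_vector) \<Rightarrow> bool" where
  "smooth_on S f \<longleftrightarrow> open S \<and> (\<forall>k. Ck_on k S f)"


section \<open>Riemannian manifolds\<close>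

text \<open>
  The manifold is the whole type \<open>'m\<close>; charts take values in a Euclidean space \<open>'e\<close>. A chart is a
  pair of its domain and its coordinate map; outside the domain the coordinate map is irrelevant.

  As there is no type depending on a point, every tangent space is modelled on \<open>'e\<close>: a vector \<open>v :: 'e\<close>
  tangent at \<open>p\<close> is given by its coordinates in one chart \<open>chart_at M p\<close> around \<open>p\<close>, fixed once
  and for all. The choice need not depend on \<open>p\<close> in any regular way, so regularity of
  vector fields is always expressed after passing to a fixed chart (\<open>to_chart\<close>).
  \<open>metric M p\<close> is the inner product of tangent vectors at \<open>p\<close>, in the same coordinates.
\<close>

type_synonym ('m, 'e) chart = "'m set \<times> ('m \<Rightarrow> 'e)"

record ('m, 'e) riemannian =
  atlas :: "('m, 'e) chart set"
  metric :: "'m \<Rightarrow> 'e \<Rightarrow> 'e \<Rightarrow> real"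

definition chart_inv :: "('m, 'e) chart \<Rightarrow> 'e \<Rightarrow> 'm" where
  "chart_inv c = inv_into (fst c) (snd c)"

definition is_chart :: "('m::topological_space, 'e::euclidean_space) chart \<Rightarrow> bool" where
  "is_chart c \<longleftrightarrow> open (fst c) \<and> open (snd c ` fst c) \<and>
     homeomorphism (fst c) (snd c ` fst c) (snd c) (chart_inv c)"

definition smooth_atlas :: "('m::topological_space, 'e::euclidean_space) chart set \<Rightarrow> bool" where
  "smooth_atlas A \<longleftrightarrow> (\<forall>c\<in>A. is_chart c) \<and> (\<Union>c\<in>A. fst c) = UNIV \<and>
     (\<forall>c\<in>A. \<forall>c'\<in>A. smooth_on (snd c ` (fst c \<inter> fst c')) (snd c' \<circ> chart_inv c))"

definition chart_at :: "('m, 'e) riemannian \<Rightarrow> 'm \<Rightarrow> ('m, 'e) chart" where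
  "chart_at M p = (SOME c. c \<in> atlas M \<and> p \<in> fst c)"

definition change_coords ::
  "('m, 'e::euclidean_space) chart \<Rightarrow> ('m, 'e) chart \<Rightarrow> 'm \<Rightarrow> 'e \<Rightarrow> 'e" where
  "change_coords c c' p v = frechet_derivative (snd c' \<circ> chart_inv c) (at (snd c p)) v"

definition to_chart ::
  "('m, 'e::euclidean_space) riemannian \<Rightarrow> ('m, 'e) chart \<Rightarrow> 'm \<Rightarrow> 'e \<Rightarrow> 'e" where
  "to_chart M c p v = change_coords (chart_at M p) c p v"

definition from_chart ::
  "('m, 'e::euclidean_space) riemannian \<Rightarrow> ('m, 'e) chart \<Rightarrow> 'm \<Rightarrow> 'e \<Rightarrow> 'e" where
  "from_chart M c p v = change_coords c (chart_at M p) p v"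

definition chart_metric ::
  "('m, 'e::euclidean_space) riemannian \<Rightarrow> ('m, 'e) chart \<Rightarrow> 'e \<Rightarrow> 'e \<Rightarrow> 'e \<Rightarrow> real" where
  "chart_metric M c x u v =
     metric M (chart_inv c x) (from_chart M c (chart_inv c x) u) (from_chart M c (chart_inv c x) v)"

definition riemannian_manifold ::
  "('m::{t2_space,second_countable_topology}, 'e::euclidean_space) riemannian \<Rightarrow> bool" where
  "riemannian_manifold M \<longleftrightarrow> smooth_atlas (atlas M) \<and>
     (\<forall>p. bilinear (metric M p) \<and> (\<forall>u v. metric M p u v = metric M p v u) \<and>
          (\<forall>u. u \<noteq> 0 \<longrightarrow> metric M p u u > 0)) \<and>
     (\<forall>c\<in>atlas M. \<forall>u v. smooth_on (snd c ` fst c) (\<lambda>x. chart_metric M c x u v))"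

definition norm_at :: "('m, 'e) riemannian \<Rightarrow> 'm \<Rightarrow> 'e \<Rightarrow> real" where
  "norm_at M p v = sqrt (metric M p v v)"


subsection \<open>Levi-Civita connection and sectional curvature\<close>

text \<open>
  \<open>christoffel M c x u v\<close> is \<open>\<nabla>\<close> of the constant coordinate field \<open>v\<close> in direction \<open>u\<close>, determined by
  the Koszul formula for (commuting) constant coordinate fields.
\<close>

definition christoffel ::
  "('m, 'e::euclidean_space) riemannian \<Rightarrow> ('m, 'e) chart \<Rightarrow> 'e \<Rightarrow> 'e \<Rightarrow> 'e \<Rightarrow> 'e" where
  "christoffel M c x u v = (THE w. \<forall>z. 2 * chart_metric M c x w z =
       frechet_derivative (\<lambda>x. chart_metric M c x v z) (at x) u
     + frechet_derivative (\<lambda>x. chart_metric M c x u z) (at x) v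
     - frechet_derivative (\<lambda>x. chart_metric M c x u v) (at x) z)"

text \<open>\<open>R(u, v) w = \<nabla>\<^sub>u \<nabla>\<^sub>v w - \<nabla>\<^sub>v \<nabla>\<^sub>u w\<close> for constant coordinate fields.\<close>

definition riemann_tensor ::
  "('m, 'e::euclidean_space) riemannian \<Rightarrow> ('m, 'e) chart \<Rightarrow> 'e \<Rightarrow> 'e \<Rightarrow> 'e \<Rightarrow> 'e \<Rightarrow> 'e" where
  "riemann_tensor M c x u v w =
     (frechet_derivative (\<lambda>x. christoffel M c x v w) (at x) u
        + christoffel M c x u (christoffel M c x v w))
   - (frechet_derivative (\<lambda>x. christoffel M c x u w) (at x) v
        + christoffel M c x v (christoffel M c x u w))"

definition sectional_curvature ::
  "('m, 'e::euclidean_space) riemannian \<Rightarrow> 'm \<Rightarrow> 'e \<Rightarrow> 'e \<Rightarrow> real" where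
  "sectional_curvature M p u v =
     metric M p (riemann_tensor M (chart_at M p) (snd (chart_at M p) p) u v v) u /
     (metric M p u u * metric M p v v - (metric M p u v)\<^sup>2)"


subsection \<open>Curves, Riemannian distance and geodesics\<close>

definition has_velocity ::
  "('m, 'e::euclidean_space) riemannian \<Rightarrow> (real \<Rightarrow> 'm) \<Rightarrow> 'e \<Rightarrow> real \<Rightarrow> real set \<Rightarrow> bool" where
  "has_velocity M \<gamma> v t S \<longleftrightarrow> ((snd (chart_at M (\<gamma> t)) \<circ> \<gamma>) has_vector_derivative v) (at t within S)"

definition C1_curve_on ::
  "('m::topological_space, 'e::euclidean_space) riemannian \<Rightarrow> real set \<Rightarrow> (real \<Rightarrow> 'm) \<Rightarrow> bool" where
  "C1_curve_on M S \<gamma> \<longleftrightarrow> continuous_on S \<gamma> \<and>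
     (\<forall>c\<in>atlas M. \<exists>v. continuous_on (S \<inter> \<gamma> -` fst c) v \<and>
        (\<forall>t \<in> S \<inter> \<gamma> -` fst c. ((snd c \<circ> \<gamma>) has_vector_derivative v t) (at t within S)))"

definition piecewise_C1_curve ::
  "('m::topological_space, 'e::euclidean_space) riemannian \<Rightarrow> (real \<Rightarrow> 'm) \<Rightarrow> bool" where
  "piecewise_C1_curve M \<gamma> \<longleftrightarrow> continuous_on {0..1} \<gamma> \<and>
     (\<exists>B. finite B \<and> (\<forall>a b. 0 \<le> a \<and> a < b \<and> b \<le> 1 \<and> {a<..<b} \<inter> B = {} \<longrightarrow> C1_curve_on M {a..b} \<gamma>))"

text \<open>Break points and end points, where the derivative may fail to exist, form a null set.\<close>

definition curve_length :: "('m, 'e::euclidean_space) riemannian \<Rightarrow> (real \<Rightarrow> 'm) \<Rightarrow> real" where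
  "curve_length M \<gamma> = integral {0..1}
     (\<lambda>t. norm_at M (\<gamma> t) (vector_derivative (snd (chart_at M (\<gamma> t)) \<circ> \<gamma>) (at t)))"

text \<open>Meaningful for points in the same connected component.\<close>

definition rdist ::
  "('m::topological_space, 'e::euclidean_space) riemannian \<Rightarrow> 'm \<Rightarrow> 'm \<Rightarrow> real" where
  "rdist M p q = Inf {curve_length M \<gamma> | \<gamma>. piecewise_C1_curve M \<gamma> \<and> \<gamma> 0 = p \<and> \<gamma> 1 = q}"

definition geodesic_on ::
  "('m::topological_space, 'e::euclidean_space) riemannian \<Rightarrow> real set \<Rightarrow> (real \<Rightarrow> 'm) \<Rightarrow> bool" where
  "geodesic_on M S \<gamma> \<longleftrightarrow> continuous_on S \<gamma> \<and>
     (\<forall>c\<in>atlas M. \<exists>v. \<forall>t \<in> S \<inter> \<gamma> -` fst c.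
        ((snd c \<circ> \<gamma>) has_vector_derivative v t) (at t within S) \<and>
        (v has_vector_derivative - christoffel M c (snd c (\<gamma> t)) (v t) (v t)) (at t within S))"

definition minimizing_geodesic ::
  "('m::topological_space, 'e::euclidean_space) riemannian \<Rightarrow> (real \<Rightarrow> 'm) \<Rightarrow> 'm \<Rightarrow> 'm \<Rightarrow> bool" where
  "minimizing_geodesic M \<gamma> p q \<longleftrightarrow>
     geodesic_on M {0..1} \<gamma> \<and> \<gamma> 0 = p \<and> \<gamma> 1 = q \<and> curve_length M \<gamma> = rdist M p q"

definition geodesically_convex ::
  "('m::topological_space, 'e::euclidean_space) riemannian \<Rightarrow> 'm set \<Rightarrow> bool" where
  "geodesically_convex M X \<longleftrightarrow>
     (\<forall>p\<in>X. \<forall>q\<in>X. \<exists>\<gamma>. minimizing_geodesic M \<gamma> p q \<and> \<gamma> ` {0..1} \<subseteq> X)"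


subsection \<open>Exponential map, injectivity radius, logarithm\<close>

definition geodesic_from ::
  "('m::topological_space, 'e::euclidean_space) riemannian \<Rightarrow> 'm \<Rightarrow> 'e \<Rightarrow> (real \<Rightarrow> 'm) \<Rightarrow> bool" where
  "geodesic_from M p v \<gamma> \<longleftrightarrow> geodesic_on M {0..1} \<gamma> \<and> \<gamma> 0 = p \<and> has_velocity M \<gamma> v 0 {0..1}"

definition exp_domain ::
  "('m::topological_space, 'e::euclidean_space) riemannian \<Rightarrow> 'm \<Rightarrow> 'e set" where
  "exp_domain M p = {v. \<exists>\<gamma>. geodesic_from M p v \<gamma>}"

definition rexp ::
  "('m::topological_space, 'e::euclidean_space) riemannian \<Rightarrow> 'm \<Rightarrow> 'e \<Rightarrow> 'm" where
  "rexp M p v = (THE q. \<exists>\<gamma>. geodesic_from M p v \<gamma> \<and> \<gamma> 1 = q)"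

definition exp_diffeo_on ::
  "('m::topological_space, 'e::euclidean_space) riemannian \<Rightarrow> 'm \<Rightarrow> 'e set \<Rightarrow> bool" where
  "exp_diffeo_on M p B \<longleftrightarrow> B \<subseteq> exp_domain M p \<and> inj_on (rexp M p) B \<and>
     continuous_on B (rexp M p) \<and> open (rexp M p ` B) \<and>
     (\<forall>c\<in>atlas M. smooth_on (B \<inter> rexp M p -` fst c) (snd c \<circ> rexp M p) \<and>
        smooth_on (snd c ` (fst c \<inter> rexp M p ` B)) (inv_into B (rexp M p) \<circ> chart_inv c))"

definition inj_radius ::
  "('m::topological_space, 'e::euclidean_space) riemannian \<Rightarrow> 'm \<Rightarrow> ereal" where
  "inj_radius M p = Sup {ereal r | r. 0 < r \<and> exp_diffeo_on M p {v. norm_at M p v < r}}"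

text \<open>The inverse of the exponential map on the ball whose radius is the injectivity radius.\<close>

definition rlog ::
  "('m::topological_space, 'e::euclidean_space) riemannian \<Rightarrow> 'm \<Rightarrow> 'm \<Rightarrow> 'e" where
  "rlog M p q = (THE v. ereal (norm_at M p v) < inj_radius M p \<and> rexp M p v = q)"


subsection \<open>Gradients and geodesically convex functions\<close>

definition continuous_field_on ::
  "('m::topological_space, 'e::euclidean_space) riemannian \<Rightarrow> 'm set \<Rightarrow> ('m \<Rightarrow> 'e) \<Rightarrow> bool" where
  "continuous_field_on M X V \<longleftrightarrow>
     (\<forall>c\<in>atlas M. continuous_on (X \<inter> fst c) (\<lambda>p. to_chart M c p (V p)))"

text \<open>
  The differential of \<open>F\<close> at \<open>p\<close> is \<open>\<langle>v, _\<rangle>\<close>. The set \<open>X\<close> need not be open, so the derivative is taken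
  within \<open>X\<close>, as in \<open>has_derivative\<close>; at interior points of \<open>X\<close> this determines \<open>v\<close>.
\<close>

definition has_gradient_within ::
  "('m::topological_space, 'e::euclidean_space) riemannian \<Rightarrow> 'm set \<Rightarrow> ('m \<Rightarrow> real) \<Rightarrow> 'e \<Rightarrow> 'm \<Rightarrow> bool" where
  "has_gradient_within M X F v p \<longleftrightarrow>
     ((F \<circ> chart_inv (chart_at M p)) has_derivative metric M p v)
       (at (snd (chart_at M p) p) within snd (chart_at M p) ` (fst (chart_at M p) \<inter> X))"

definition C1_with_gradient ::
  "('m::topological_space, 'e::euclidean_space) riemannian \<Rightarrow> 'm set \<Rightarrow> ('m \<Rightarrow> real) \<Rightarrow> ('m \<Rightarrow> 'e) \<Rightarrow> bool" where
  "C1_with_gradient M X F grad \<longleftrightarrow>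
     (\<forall>p\<in>X. has_gradient_within M X F (grad p) p) \<and> continuous_field_on M X grad"

definition geodesically_convex_fun ::
  "('m::topological_space, 'e::euclidean_space) riemannian \<Rightarrow> 'm set \<Rightarrow> ('m \<Rightarrow> real) \<Rightarrow> ('m \<Rightarrow> 'e) \<Rightarrow> bool" where
  "geodesically_convex_fun M X F grad \<longleftrightarrow>
     (\<forall>p\<in>X. \<forall>q\<in>X. F q \<ge> F p + metric M p (grad p) (rlog M p q))"

definition is_frechet_mean ::
  "('m::topological_space, 'e::euclidean_space) riemannian \<Rightarrow> 'm set \<Rightarrow> ('n::finite \<Rightarrow> 'm) \<Rightarrow> 'm \<Rightarrow> bool" where
  "is_frechet_mean M X z =
     is_arg_min (\<lambda>p. (1 / real CARD('n)) * (\<Sum>i\<in>UNIV. (rdist M (z i) p)\<^sup>2)) (\<lambda>p. p \<in> X)"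


section \<open>Second largest singular value\<close>

text \<open>
  Singular values are the square roots of the eigenvalues of \<open>A\<^sup>T A\<close>, counted with multiplicity. This
  matrix is symmetric, so the multiplicity of an eigenvalue is the dimension of its eigenspace.
  A \<open>1 \<times> 1\<close> matrix has no second singular value; by convention it is taken to be \<open>0\<close>.
\<close>

definition singular_space :: "real^'n^'n \<Rightarrow> real \<Rightarrow> (real^'n) set" where
  "singular_space A s = {v. (transpose A ** A) *v v = s\<^sup>2 *\<^sub>R v}"

definition singular_values :: "real^'n^'n \<Rightarrow> real multiset" where
  "singular_values A =
     (\<Sum>s\<in>{s. 0 \<le> s \<and> singular_space A s \<noteq> {0}}. replicate_mset (dim (singular_space A s)) s)"

definition sigma2 :: "real^'n^'n \<Rightarrow> real" where
  "sigma2 A = (let l = rev (sorted_list_of_multiset (singular_values A))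
     in if length l \<ge> 2 then l ! 1 else 0)"


section \<open>Random tangent vectors\<close>

text \<open>
  \<open>V \<omega>\<close> is a vector tangent at \<open>b \<omega>\<close>; measurability with respect to \<open>N\<close> as a random element of the
  tangent bundle, expressed in charts.
\<close>

definition tangent_measurable ::
  "('m::topological_space, 'e::euclidean_space) riemannian \<Rightarrow> 'w measure \<Rightarrow> ('w \<Rightarrow> 'm) \<Rightarrow> ('w \<Rightarrow> 'e) \<Rightarrow> bool" where
  "tangent_measurable M N b V \<longleftrightarrow> b \<in> borel_measurable N \<and>
     (\<forall>c\<in>atlas M.
        (\<lambda>\<omega>. if b \<omega> \<in> fst c then to_chart M c (b \<omega>) (V \<omega>) else 0) \<in> borel_measurable N)"

text \<open>
  \<open>E[V | F] = Z\<close> for random tangent vectors along an \<open>F\<close>-measurable base point \<open>b\<close>: \<open>Z\<close> is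
  \<open>F\<close>-measurable, and \<open>E[\<langle>V, U\<rangle> | F] = \<langle>Z, U\<rangle>\<close> for all bounded \<open>F\<close>-measurable tangent vectors \<open>U\<close>
  along \<open>b\<close>. With \<open>U\<close> ranging over \<open>F\<close>-measurable frames this says that the
  conditional expectation is taken componentwise.
\<close>

definition tangent_cond_exp ::
  "('m::topological_space, 'e::euclidean_space) riemannian \<Rightarrow> 'w measure \<Rightarrow> 'w measure \<Rightarrow>
     ('w \<Rightarrow> 'm) \<Rightarrow> ('w \<Rightarrow> 'e) \<Rightarrow> ('w \<Rightarrow> 'e) \<Rightarrow> bool" where
  "tangent_cond_exp M P F b V Z \<longleftrightarrow>
     tangent_measurable M P b V \<and> integrable P (\<lambda>\<omega>. norm_at M (b \<omega>) (V \<omega>)) \<and>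
     tangent_measurable M F b Z \<and> integrable P (\<lambda>\<omega>. norm_at M (b \<omega>) (Z \<omega>)) \<and>
     (\<forall>U. tangent_measurable M F b U \<and> (\<exists>K. \<forall>\<omega>\<in>space P. norm_at M (b \<omega>) (U \<omega>) \<le> K) \<longrightarrow>
        (AE \<omega> in P. real_cond_exp P F (\<lambda>\<omega>. metric M (b \<omega>) (V \<omega>) (U \<omega>)) \<omega>
                      = metric M (b \<omega>) (Z \<omega>) (U \<omega>)))"

definition iterate_filtration ::
  "'w measure \<Rightarrow> (nat \<Rightarrow> 'n \<Rightarrow> 'w \<Rightarrow> 'm::topological_space) \<Rightarrow> nat \<Rightarrow> 'w measure" where
  "iterate_filtration P x t =
     sigma (space P) {x k i -` A \<inter> space P | k i A. k \<in> {1..t} \<and> A \<in> sets borel}"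

end

theory Submission
  imports Defs
begin

text \<open>
  Two quantities are followed in expectation along the rounds of the algorithm: the sum of the squared
  distances of the iterates to the optimum, and their dispersion, the infimum over \<open>X\<close> of the sum of
  the squared distances to one point.

  A gradient step is controlled by the upper comparison inequality (\<open>gradient_step\<close>). A consensus step
  does not increase the sum of the squared distances to any point of \<open>X\<close>, and it gains a multiple of the
  Dirichlet form \<open>\<Sum> w\<^sub>i\<^sub>j d\<^sup>2(y\<^sub>i, y\<^sub>j)\<close> (\<open>consensus_step_decreases\<close>). Seen through the logarithm at a near-mean of
  the \<open>y\<^sub>i\<close>, this form is bounded below by the spectral gap times the dispersion, because the logarithms
  of the \<open>y\<^sub>i\<close> nearly sum to zero. Thus the consensus step contracts the dispersion
  (\<open>dispersion_contraction\<close>). With Young's inequality for the drift of the gradient step the expected dispersion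
  satisfies \<open>V\<^sub>t\<^sub>+\<^sub>1 \<le> (1 - \<xi>\<^sup>2) V\<^sub>t + n B \<eta>\<^sub>t\<^sup>2\<close> and starts at \<open>0\<close>, so \<open>V\<^sub>t \<le> n C(\<xi>) B \<eta>\<^sub>t\<^sup>2\<close>
  (\<open>contraction_with_decaying_noise\<close>).

  Convexity turns the recursion for the distances to the optimum into a bound on the objective gap at the
  iterates. Passing from the iterates to their mean costs \<open>\<delta>\<close> times the root of the dispersion, which is
  \<open>O(\<eta>\<^sub>t)\<close>. The weighted sum telescopes, and the errors add up to a multiple of
  \<open>\<Sum> \<eta>\<^sub>t\<^sup>2 \<le> \<eta>\<^sub>0\<^sup>2 (1 + ln T)\<close>.

  The geometric input is that \<open>log\<close> inverts \<open>exp\<close>, that \<open>\<bar>log\<^sub>p q\<bar> = d(p, q)\<close> on \<open>X\<close>, that points may be moved within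
  \<open>X\<close> along geodesics, and that \<open>p \<mapsto> log\<^sub>p q\<close> is continuous. All of this rests on
  two facts about geodesics: they are determined by their initial velocity (\<open>geodesic_unique\<close>), and they have
  constant speed (\<open>geodesic_constant_speed\<close>).

  For the expectations, the Frechet mean is replaced by a measurable near-mean with countably many
  values (\<open>measurable_near_mean\<close>). In the objective gap the mean itself occurs only below a nonnegative
  measurable majorant (\<open>expected_gap\<close>).
\<close>

section \<open>Local Lipschitz continuity and uniqueness for differential equations\<close>

definition lip_near :: "('a::real_normed_vector \<Rightarrow> 'b::real_normed_vector) \<Rightarrow> 'a \<Rightarrow> bool" where
  "lip_near f z \<longleftrightarrow> (\<exists>r>0. \<exists>L\<ge>0. \<forall>x\<in>ball z r. \<forall>y\<in>ball z r. norm (f x - f y) \<le> L * norm (x - y))"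

lemma lip_nearE:
  assumes "lip_near f z"
  obtains r L where "r > 0" "L \<ge> 0"
    "\<And>x y. x \<in> ball z r \<Longrightarrow> y \<in> ball z r \<Longrightarrow> norm (f x - f y) \<le> L * norm (x - y)"
  using assms unfolding lip_near_def by blast

lemma lip_nearI:
  assumes "r > 0"
    "\<And>x y. x \<in> ball z r \<Longrightarrow> y \<in> ball z r \<Longrightarrow> norm (f x - f y) \<le> L * norm (x - y)"
  shows "lip_near f z"
proof -
  have "norm (f x - f y) \<le> max L 0 * norm (x - y)" if "x \<in> ball z r" "y \<in> ball z r" for x y
  proof -
    have "norm (f x - f y) \<le> L * norm (x - y)" using that by (rule assms(2))
    also have "\<dots> \<le> max L 0 * norm (x - y)" by (intro mult_right_mono) auto
    finally show ?thesis .
  qed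
  then show ?thesis using assms(1) unfolding lip_near_def by (metis max.cobounded2)
qed

lemma lip_near_cong:
  assumes "r > 0" "\<And>x. x \<in> ball z r \<Longrightarrow> f x = g x" "lip_near f z"
  shows "lip_near g z"
proof -
  obtain r' L where *: "r' > 0"
    "\<forall>x\<in>ball z r'. \<forall>y\<in>ball z r'. norm (f x - f y) \<le> L * norm (x - y)"
    using assms(3) unfolding lip_near_def by blast
  show ?thesis
  proof (rule lip_nearI[of "min r r'" _ _ L])
    fix x y assume "x \<in> ball z (min r r')" "y \<in> ball z (min r r')"
    then show "norm (g x - g y) \<le> L * norm (x - y)"
      using *(2)[rule_format, of x y] assms(2)[of x, symmetric] assms(2)[of y, symmetric] by simp
  qed (use * assms in auto)
qed

lemma lip_near_bounded_linear:
  assumes "bounded_linear f" shows "lip_near f z"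
proof -
  interpret bounded_linear f by fact
  obtain K where "\<And>x. norm (f x) \<le> norm x * K" using bounded by blast
  then have "norm (f x - f y) \<le> K * norm (x - y)" for x y
    by (metis diff mult.commute)
  then show ?thesis by (intro lip_nearI[of 1]) auto
qed

lemma lip_near_const: "lip_near (\<lambda>x. c) z"
  by (rule lip_nearI[of 1 _ _ 0]) auto

lemma lip_near_add:
  assumes "lip_near f z" "lip_near g z" shows "lip_near (\<lambda>x. f x + g x) z"
proof -
  from assms obtain r L r' L' where *: "r > 0" "r' > 0"
    "\<And>x y. x \<in> ball z r \<Longrightarrow> y \<in> ball z r \<Longrightarrow> norm (f x - f y) \<le> L * norm (x - y)"
    "\<And>x y. x \<in> ball z r' \<Longrightarrow> y \<in> ball z r' \<Longrightarrow> norm (g x - g y) \<le> L' * norm (x - y)"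
    by (metis lip_nearE)
  show ?thesis
  proof (rule lip_nearI[of "min r r'" _ _ "L + L'"])
    fix x y assume xy: "x \<in> ball z (min r r')" "y \<in> ball z (min r r')"
    have "norm ((f x + g x) - (f y + g y)) \<le> norm (f x - f y) + norm (g x - g y)"
      by (metis add_diff_add norm_triangle_ineq)
    also have "\<dots> \<le> L * norm (x - y) + L' * norm (x - y)"
      using xy by (intro add_mono *) auto
    finally show "norm ((f x + g x) - (f y + g y)) \<le> (L + L') * norm (x - y)"
      by (simp add: algebra_simps)
  qed (use * in auto)
qed

text \<open>A Lipschitz function is bounded on a ball, so the usual estimate for products applies.\<close>

lemma lip_near_scaleR:
  assumes "lip_near f z" "lip_near g z" shows "lip_near (\<lambda>x. f x *\<^sub>R g x) z"
proof -
  from assms obtain r L r' L' where *: "r > 0" "r' > 0" "L \<ge> 0" "L' \<ge> 0"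
    "\<And>x y. x \<in> ball z r \<Longrightarrow> y \<in> ball z r \<Longrightarrow> norm (f x - f y) \<le> L * norm (x - y)"
    "\<And>x y. x \<in> ball z r' \<Longrightarrow> y \<in> ball z r' \<Longrightarrow> norm (g x - g y) \<le> L' * norm (x - y)"
    by (metis lip_nearE)
  define F where "F = norm (f z) + L * r"
  define G where "G = norm (g z) + L' * r'"
  have F: "norm (f x) \<le> F" if "x \<in> ball z r" for x
  proof -
    have "norm (f x) \<le> norm (f z) + norm (f x - f z)" by (metis norm_triangle_sub)
    also have "norm (f x - f z) \<le> L * norm (x - z)" using *(1,5) that by auto
    also have "\<dots> \<le> L * r" using * that by (intro mult_left_mono) (auto simp: dist_norm norm_minus_commute)
    finally show ?thesis by (simp add: F_def)
  qed
  have G: "norm (g x) \<le> G" if "x \<in> ball z r'" for x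
  proof -
    have "norm (g x) \<le> norm (g z) + norm (g x - g z)" by (metis norm_triangle_sub)
    also have "norm (g x - g z) \<le> L' * norm (x - z)" using *(2,6) that by auto
    also have "\<dots> \<le> L' * r'" using * that by (intro mult_left_mono) (auto simp: dist_norm norm_minus_commute)
    finally show ?thesis by (simp add: G_def)
  qed
  have FG: "F \<ge> 0" "G \<ge> 0" using * by (auto simp: F_def G_def)
  show ?thesis
  proof (rule lip_nearI[of "min r r'" _ _ "L * G + F * L'"])
    fix x y assume xy: "x \<in> ball z (min r r')" "y \<in> ball z (min r r')"
    have "f x *\<^sub>R g x - f y *\<^sub>R g y = (f x - f y) *\<^sub>R g x + f y *\<^sub>R (g x - g y)"
      by (simp add: algebra_simps)
    then have "norm (f x *\<^sub>R g x - f y *\<^sub>R g y)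
        \<le> norm (f x - f y) * norm (g x) + norm (f y) * norm (g x - g y)"
      by (metis norm_scaleR norm_triangle_ineq real_norm_def)
    also have "\<dots> \<le> (L * norm (x - y)) * G + F * (L' * norm (x - y))"
      using xy F G FG * by (intro add_mono mult_mono) auto
    finally show "norm (f x *\<^sub>R g x - f y *\<^sub>R g y) \<le> (L * G + F * L') * norm (x - y)"
      by (simp add: algebra_simps)
  qed (use * in auto)
qed

lemma lip_near_sum:
  "(\<And>i. i \<in> I \<Longrightarrow> lip_near (f i) z) \<Longrightarrow> lip_near (\<lambda>x. \<Sum>i\<in>I. f i x) z"
  by (induction I rule: infinite_finite_induct) (auto intro: lip_near_const lip_near_add)

lemma lip_near_Pair:
  assumes "lip_near f z" "lip_near g z" shows "lip_near (\<lambda>x. (f x, g x)) z"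
proof -
  have "lip_near (\<lambda>x. (f x, 0) + (0, g x)) z"
  proof (rule lip_near_add)
    from assms(1) obtain r L where "r > 0" 
      "\<And>x y. x \<in> ball z r \<Longrightarrow> y \<in> ball z r \<Longrightarrow> norm (f x - f y) \<le> L * norm (x - y)"
      by (metis lip_nearE)
    then show "lip_near (\<lambda>x. (f x, 0)) z" by (intro lip_nearI[of r]) auto
    from assms(2) obtain r L where "r > 0" 
      "\<And>x y. x \<in> ball z r \<Longrightarrow> y \<in> ball z r \<Longrightarrow> norm (g x - g y) \<le> L * norm (x - y)"
      by (metis lip_nearE)
    then show "lip_near (\<lambda>x. (0, g x)) z" by (intro lip_nearI[of r]) auto
  qed
  then show ?thesis by simp
qed

lemma lip_near_fst:
  assumes "lip_near f (fst z)" shows "lip_near (\<lambda>x. f (fst x)) z"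
proof -
  from assms obtain r L where *: "r > 0" "L \<ge> 0"
    "\<And>x y. x \<in> ball (fst z) r \<Longrightarrow> y \<in> ball (fst z) r \<Longrightarrow> norm (f x - f y) \<le> L * norm (x - y)"
    by (metis lip_nearE)
  show ?thesis
  proof (rule lip_nearI)
    fix x y assume "x \<in> ball z r" "y \<in> ball z r"
    then have "fst x \<in> ball (fst z) r" "fst y \<in> ball (fst z) r"
      by (auto intro: le_less_trans[OF dist_fst_le])
    then have "norm (f (fst x) - f (fst y)) \<le> L * norm (fst x - fst y)" by (rule *)
    also have "\<dots> \<le> L * norm (x - y)"
      using * by (intro mult_left_mono) (metis dist_fst_le dist_norm)
    finally show "norm (f (fst x) - f (fst y)) \<le> L * norm (x - y)" .
  qed fact
qed

text \<open>The partial derivatives are bounded on a compact ball; this bounds the operator norm of the derivative,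
  and the mean value inequality applies.\<close>

lemma lip_near_C1:
  fixes f :: "'a::euclidean_space \<Rightarrow> 'b::real_normed_vector"
  assumes "open S" "z \<in> S" "Ck_on 1 S f"
  shows "lip_near f z"
proof -
  from assms(3) obtain f' where f': "\<And>x. x \<in> S \<Longrightarrow> (f has_derivative f' x) (at x)"
    and cont: "\<And>v. continuous_on S (\<lambda>x. f' x v)" by auto
  obtain r where r: "r > 0" "cball z r \<subseteq> S"
    using assms open_contains_cball by blast
  have "continuous_on (cball z r) (\<lambda>x. \<Sum>b\<in>Basis. norm (f' x b))"
    using cont r by (intro continuous_intros) (auto intro: continuous_on_subset)
  then have "bounded ((\<lambda>x. \<Sum>b\<in>Basis. norm (f' x b)) ` cball z r)"
    by (intro compact_imp_bounded compact_continuous_image) auto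
  then obtain K where K: "\<And>x. x \<in> cball z r \<Longrightarrow> norm (\<Sum>b\<in>Basis. norm (f' x b)) \<le> K"
    unfolding bounded_iff by blast
  have on: "onorm (f' x) \<le> K" if "x \<in> ball z r" for x
  proof (rule onorm_le)
    fix v
    have lin: "linear (f' x)" using f'[of x] r that has_derivative_linear
      by (meson ball_subset_cball subset_iff)
    have "f' x v = f' x (\<Sum>b\<in>Basis. (v \<bullet> b) *\<^sub>R b)" by (simp add: euclidean_representation)
    also have "\<dots> = (\<Sum>b\<in>Basis. (v \<bullet> b) *\<^sub>R f' x b)"
      using lin by (simp add: linear_sum linear_scale)
    finally have "norm (f' x v) \<le> (\<Sum>b\<in>Basis. norm ((v \<bullet> b) *\<^sub>R f' x b))"
      by (simp only: norm_sum)
    also have "\<dots> = (\<Sum>b\<in>Basis. \<bar>v \<bullet> b\<bar> * norm (f' x b))" by simp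
    also have "\<dots> \<le> (\<Sum>b\<in>Basis. norm v * norm (f' x b))"
      by (intro sum_mono mult_right_mono) (auto simp: Basis_le_norm)
    also have "\<dots> \<le> norm v * K"
      using K[of x] that by (simp add: sum_distrib_left[symmetric] mult_left_mono)
    finally show "norm (f' x v) \<le> K * norm v" by (simp add: mult.commute)
  qed
  show ?thesis
  proof (rule lip_nearI)
    fix x y assume xy: "x \<in> ball z r" "y \<in> ball z r"
    show "norm (f x - f y) \<le> K * norm (x - y)"
    proof (rule differentiable_bound[of "ball z r" f f' K])
      fix u assume "u \<in> ball z r"
      then have "u \<in> S" using r(2) ball_subset_cball by blast
      then show "(f has_derivative f' u) (at u within ball z r)"
        by (rule has_derivative_at_withinI[OF f'])
    qed (use on xy in auto)
  qed fact
qed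

text \<open>From \<open>A(x) (w(x) - w(y)) = k(x) - k(y) - (A(x) - A(y)) w(y)\<close>, since \<open>A(x)\<close> stays uniformly bounded
  below near a point where it is injective.\<close>

lemma lip_near_linear_solve:
  fixes A :: "'a::real_normed_vector \<Rightarrow> 'e::euclidean_space \<Rightarrow> 'e"
  assumes r0: "r0 > 0" and lin: "\<And>x. x \<in> ball z r0 \<Longrightarrow> linear (A x)"
    and A: "\<And>b. b \<in> Basis \<Longrightarrow> lip_near (\<lambda>x. A x b) z"
    and k: "lip_near k z" and inj: "inj (A z)"
    and sol: "\<And>x. x \<in> ball z r0 \<Longrightarrow> A x (w x) = k x"
  shows "lip_near w z"
proof -
  have "\<exists>r>0. \<exists>L\<ge>0. \<forall>x\<in>ball z r. \<forall>y\<in>ball z r. \<forall>v. norm (A x v - A y v) \<le> L * norm (x - y) * norm v"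
  proof -
    have "\<forall>b\<in>Basis. \<exists>r>0. \<exists>L\<ge>0. \<forall>x\<in>ball z r. \<forall>y\<in>ball z r. norm (A x b - A y b) \<le> L * norm (x - y)"
      using A unfolding lip_near_def by blast
    then obtain r L where rL: "\<And>b. b \<in> Basis \<Longrightarrow> r b > 0 \<and> L b \<ge> 0 \<and>
        (\<forall>x\<in>ball z (r b). \<forall>y\<in>ball z (r b). norm (A x b - A y b) \<le> L b * norm (x - y))"
      by (metis (no_types, lifting))
    define r' where "r' = Min (insert r0 (r ` Basis))"
    have r': "r' > 0" "r' \<le> r0" "\<And>b. b \<in> Basis \<Longrightarrow> r' \<le> r b"
      unfolding r'_def using rL r0 by (simp, simp, intro Min_le, simp_all)
    have "norm (A x v - A y v) \<le> (\<Sum>b\<in>Basis. L b) * norm (x - y) * norm v"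
      if xy: "x \<in> ball z r'" "y \<in> ball z r'" for x y v
    proof -
      have l: "linear (A x)" "linear (A y)" using lin xy r' by auto
      have "A x v - A y v = A x (\<Sum>b\<in>Basis. (v \<bullet> b) *\<^sub>R b) - A y (\<Sum>b\<in>Basis. (v \<bullet> b) *\<^sub>R b)"
        by (simp add: euclidean_representation)
      also have "\<dots> = (\<Sum>b\<in>Basis. (v \<bullet> b) *\<^sub>R (A x b - A y b))"
        using l by (simp add: linear_sum linear_scale sum_subtractf algebra_simps)
      finally have "norm (A x v - A y v) \<le> (\<Sum>b\<in>Basis. norm ((v \<bullet> b) *\<^sub>R (A x b - A y b)))"
        by (simp only: norm_sum)
      also have "\<dots> = (\<Sum>b\<in>Basis. \<bar>v \<bullet> b\<bar> * norm (A x b - A y b))" by simp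
      also have "\<dots> \<le> (\<Sum>b\<in>Basis. norm v * (L b * norm (x - y)))"
      proof (intro sum_mono mult_mono)
        fix b :: 'e assume b: "b \<in> Basis"
        then show "norm (A x b - A y b) \<le> L b * norm (x - y)"
          using rL[OF b] r'(3)[OF b] xy by auto
      qed (auto simp: Basis_le_norm)
      also have "\<dots> = (\<Sum>b\<in>Basis. L b) * norm (x - y) * norm v"
        by (simp add: sum_distrib_left sum_distrib_right algebra_simps)
      finally show ?thesis .
    qed
    moreover have "(\<Sum>b\<in>Basis. L b) \<ge> 0" using rL by (simp add: sum_nonneg)
    ultimately show ?thesis using r'(1)
      by (intro exI[of _ r'] conjI exI[of _ "\<Sum>b\<in>Basis. L b"]) auto
  qed
  then obtain r1 L where r1: "r1 > 0" "L \<ge> 0"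
    "\<And>x y v. x \<in> ball z r1 \<Longrightarrow> y \<in> ball z r1 \<Longrightarrow> norm (A x v - A y v) \<le> L * norm (x - y) * norm v"
    by blast
  obtain r2 Lk where r2: "r2 > 0" "Lk \<ge> 0"
    "\<And>x y. x \<in> ball z r2 \<Longrightarrow> y \<in> ball z r2 \<Longrightarrow> norm (k x - k y) \<le> Lk * norm (x - y)"
    using k by (metis lip_nearE)
  have "linear (A z)" using lin r0 by auto
  then obtain \<mu> where mu: "\<mu> > 0" "\<And>v. \<mu> * norm v \<le> norm (A z v)"
    using linear_inj_bounded_below_pos[of "A z"] inj by (metis mult.commute)
  define r where "r = min (min r0 r1) (min r2 (\<mu> / (2 * (L + 1))))"
  have r: "r > 0" "r \<le> r0" "r \<le> r1" "r \<le> r2" "L * r \<le> \<mu> / 2"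
  proof -
    show "r > 0" "r \<le> r0" "r \<le> r1" "r \<le> r2" using r0 r1 r2 mu by (auto simp: r_def)
    have "L * r \<le> (L + 1) * (\<mu> / (2 * (L + 1)))"
      using r1 mu \<open>r > 0\<close> by (intro mult_mono) (auto simp: r_def)
    also have "\<dots> = \<mu> / 2" using r1(2) by (simp add: field_simps)
    finally show "L * r \<le> \<mu> / 2" .
  qed
  have below: "\<mu> / 2 * norm v \<le> norm (A x v)" if "x \<in> ball z r" for x v
  proof -
    have "norm (A z v - A x v) \<le> L * norm (z - x) * norm v"
      using that r r1(3)[of z x v] r1(1) by auto
    also have "\<dots> \<le> \<mu> / 2 * norm v"
    proof (intro mult_right_mono)
      have "L * norm (z - x) \<le> L * r"
        using that r1 by (intro mult_left_mono) (auto simp: dist_norm)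
      with r show "L * norm (z - x) \<le> \<mu> / 2" by simp
    qed auto
    finally show ?thesis using mu(2)[of v] norm_triangle_ineq2[of "A z v" "A x v"] by simp
  qed
  define Q where "Q = (norm (k z) + Lk * r) * 2 / \<mu>"
  have w: "norm (w x) \<le> Q" if "x \<in> ball z r" for x
  proof -
    have "\<mu> / 2 * norm (w x) \<le> norm (k x)" using below[OF that, of "w x"] sol[of x] r that by auto
    also have "\<dots> \<le> norm (k z) + norm (k x - k z)" by (metis norm_triangle_sub)
    also have "norm (k x - k z) \<le> Lk * norm (x - z)" using r2 r that by auto
    also have "\<dots> \<le> Lk * r" using r2 that
      by (intro mult_left_mono) (auto simp: dist_norm norm_minus_commute)
    finally show ?thesis using mu by (simp add: Q_def field_simps)
  qed
  show ?thesis
  proof (rule lip_nearI[of r _ _ "(Lk + L * Q) * 2 / \<mu>"])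
    fix x y assume xy: "x \<in> ball z r" "y \<in> ball z r"
    have xy': "x \<in> ball z r0" "y \<in> ball z r0" "x \<in> ball z r1" "y \<in> ball z r1"
      "x \<in> ball z r2" "y \<in> ball z r2" using xy r by auto
    have "A x (w x - w y) = (k x - k y) - (A x (w y) - A y (w y))"
      using sol xy' lin[of x] by (simp add: linear_diff)
    then have "norm (A x (w x - w y)) \<le> norm (k x - k y) + norm (A x (w y) - A y (w y))"
      by (metis norm_triangle_ineq4)
    also have "\<dots> \<le> Lk * norm (x - y) + L * norm (x - y) * norm (w y)"
      using xy' r1 r2 by (intro add_mono) auto
    also have "\<dots> \<le> Lk * norm (x - y) + L * norm (x - y) * Q"
      using w[OF xy(2)] r1(2) by (intro add_mono mult_left_mono order_refl) simp_all
    finally have "\<mu> / 2 * norm (w x - w y) \<le> (Lk + L * Q) * norm (x - y)"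
      using below[OF xy(1), of "w x - w y"] by (simp add: algebra_simps)
    then show "norm (w x - w y) \<le> (Lk + L * Q) * 2 / \<mu> * norm (x - y)"
      using mu by (simp add: field_simps)
  qed (use r in auto)
qed

text \<open>On an interval of length at most \<open>1 / (2 L)\<close> the largest distance \<open>m\<close> between the solutions satisfies \<open>m \<le> m / 2\<close>
  by the mean value inequality.\<close>

lemma ode_unique_right:
  fixes z1 z2 :: "real \<Rightarrow> 'a::real_normed_vector"
  assumes "a < b" and H: "lip_near H (z1 a)" and init: "z1 a = z2 a"
    and d1: "\<And>t. t \<in> {a..b} \<Longrightarrow> (z1 has_vector_derivative H (z1 t)) (at t within {a..b})"
    and d2: "\<And>t. t \<in> {a..b} \<Longrightarrow> (z2 has_vector_derivative H (z2 t)) (at t within {a..b})"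
  shows "\<exists>\<epsilon>>0. \<forall>t\<in>{a..min b (a + \<epsilon>)}. z1 t = z2 t"
proof -
  obtain r L where rL: "r > 0" "L \<ge> 0"
    "\<And>x y. x \<in> ball (z1 a) r \<Longrightarrow> y \<in> ball (z1 a) r \<Longrightarrow> norm (H x - H y) \<le> L * norm (x - y)"
    using H by (metis lip_nearE)
  have c: "continuous_on {a..b} z1" "continuous_on {a..b} z2"
    by (rule continuous_on_vector_derivative[OF d1], assumption)
       (rule continuous_on_vector_derivative[OF d2], assumption)
  have near: "\<exists>d>0. \<forall>t\<in>{a..b}. dist t a < d \<longrightarrow> dist (z t) (z a) < r"
    if "continuous_on {a..b} z" for z :: "real \<Rightarrow> 'a"
    using that[unfolded continuous_on_iff, rule_format, of a r] \<open>a < b\<close> \<open>r > 0\<close> by simp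
  obtain d where d: "d > 0" "\<forall>t\<in>{a..b}. dist t a < d \<longrightarrow> dist (z1 t) (z1 a) < r"
    using near[OF c(1)] by blast
  obtain d' where d': "d' > 0" "\<forall>t\<in>{a..b}. dist t a < d' \<longrightarrow> dist (z2 t) (z2 a) < r"
    using near[OF c(2)] by blast
  define \<epsilon> where "\<epsilon> = min (min d d' / 2) (1 / (2 * (L + 1)))"
  have e: "\<epsilon> > 0" "L * \<epsilon> \<le> 1/2"
  proof -
    show "\<epsilon> > 0" using d d' rL by (auto simp: \<epsilon>_def)
    then have "L * \<epsilon> \<le> (L + 1) * (1 / (2 * (L + 1)))"
      using rL by (intro mult_mono) (auto simp: \<epsilon>_def)
    also have "\<dots> = 1/2" using rL(2) by simp
    finally show "L * \<epsilon> \<le> 1/2" .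
  qed
  define J where "J = {a..min b (a + \<epsilon>)}"
  have J: "J \<subseteq> {a..b}" "a \<in> J" "compact J" "convex J" using \<open>a < b\<close> e by (auto simp: J_def)
  have inball: "z1 t \<in> ball (z1 a) r" "z2 t \<in> ball (z1 a) r" if "t \<in> J" for t
  proof -
    have "t \<in> {a..b}" "dist t a \<le> \<epsilon>" using that by (auto simp: J_def dist_real_def)
    moreover have "\<epsilon> < d" "\<epsilon> < d'" using d(1) d'(1) by (auto simp: \<epsilon>_def)
    ultimately show "z1 t \<in> ball (z1 a) r" "z2 t \<in> ball (z1 a) r"
      using d(2)[rule_format, of t] d'(2)[rule_format, of t] init by (simp_all add: dist_commute)
  qed
  have cont: "continuous_on J (\<lambda>t. norm (z1 t - z2 t))"
    using c J(1) by (intro continuous_intros) (auto intro: continuous_on_subset)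
  have ne: "J \<noteq> {}" using J(2) by blast
  have "\<exists>\<tau>\<in>J. \<forall>t\<in>J. norm (z1 t - z2 t) \<le> norm (z1 \<tau> - z2 \<tau>)"
    by (rule continuous_attains_sup[OF J(3) ne cont])
  then obtain \<tau> where tau: "\<tau> \<in> J"
    "\<forall>t\<in>J. norm (z1 t - z2 t) \<le> norm (z1 \<tau> - z2 \<tau>)" by blast
  define m where "m = norm (z1 \<tau> - z2 \<tau>)"
  have "norm ((z1 \<tau> - z2 \<tau>) - (z1 a - z2 a)) \<le> L * m * norm (\<tau> - a)"
  proof (rule differentiable_bound[of J "\<lambda>t. z1 t - z2 t" "\<lambda>t h. h *\<^sub>R (H (z1 t) - H (z2 t))"])
    fix t assume t: "t \<in> J"
    have "((\<lambda>t. z1 t - z2 t) has_vector_derivative (H (z1 t) - H (z2 t))) (at t within J)"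
      using t J(1) by (intro has_vector_derivative_diff
          has_vector_derivative_within_subset[OF d1 J(1)] has_vector_derivative_within_subset[OF d2 J(1)]) auto
    then show "((\<lambda>t. z1 t - z2 t) has_derivative (\<lambda>h. h *\<^sub>R (H (z1 t) - H (z2 t)))) (at t within J)"
      by (simp add: has_vector_derivative_def)
    show "onorm (\<lambda>h. h *\<^sub>R (H (z1 t) - H (z2 t))) \<le> L * m"
    proof (rule onorm_le)
      fix h :: real
      have "norm (H (z1 t) - H (z2 t)) \<le> L * norm (z1 t - z2 t)" using inball t rL by auto
      also have "\<dots> \<le> L * m" using tau(2) t rL by (simp add: m_def mult_left_mono)
      finally show "norm (h *\<^sub>R (H (z1 t) - H (z2 t))) \<le> L * m * norm h"
        by (simp add: mult.commute mult_left_mono)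
    qed
  qed (use J tau in auto)
  then have "m \<le> L * m * norm (\<tau> - a)" using init by (simp add: m_def)
  also have "\<dots> \<le> L * m * \<epsilon>"
    using tau(1) rL by (intro mult_left_mono) (auto simp: J_def m_def)
  also have "\<dots> = (L * \<epsilon>) * m" by simp
  also have "\<dots> \<le> 1/2 * m" using e by (intro mult_right_mono) (auto simp: m_def)
  finally have "m = 0" using norm_ge_zero[of "z1 \<tau> - z2 \<tau>"] by (simp add: m_def)
  then have "\<forall>t\<in>J. z1 t = z2 t" using tau by (auto simp: m_def)
  then show ?thesis using e unfolding J_def by blast
qed

section \<open>Charts, the metric in coordinates, and Christoffel symbols\<close>

lemma bilinear_expand:
  fixes B :: "'a::euclidean_space \<Rightarrow> 'b::euclidean_space \<Rightarrow> real"
  assumes "bilinear B"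
  shows "B u v = (\<Sum>i\<in>Basis. \<Sum>j\<in>Basis. (u \<bullet> i) * (v \<bullet> j) * B i j)"
proof -
  have l: "linear (B x)" "linear (\<lambda>x. B x y)" for x y using assms by (auto simp: bilinear_def)
  have "B u v = B (\<Sum>i\<in>Basis. (u \<bullet> i) *\<^sub>R i) v" by (simp add: euclidean_representation)
  also have "\<dots> = (\<Sum>i\<in>Basis. (u \<bullet> i) * B i v)"
    by (subst linear_sum[OF l(2)]) (simp add: linear_scale[OF l(2)])
  also have "\<dots> = (\<Sum>i\<in>Basis. (u \<bullet> i) * B i (\<Sum>j\<in>Basis. (v \<bullet> j) *\<^sub>R j))"
    by (simp add: euclidean_representation)
  also have "\<dots> = (\<Sum>i\<in>Basis. \<Sum>j\<in>Basis. (u \<bullet> i) * (v \<bullet> j) * B i j)"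
    by (subst linear_sum[OF l(1)]) (simp add: linear_scale[OF l(1)] sum_distrib_left mult.assoc)
  finally show ?thesis .
qed

locale riemannian_mfd =
  fixes M :: "('m::{t2_space,second_countable_topology}, 'e::euclidean_space) riemannian"
  assumes manifold: "riemannian_manifold M"
begin

lemma atlas: "smooth_atlas (atlas M)"
  and metric_bilinear: "bilinear (metric M p)"
  and metric_sym: "metric M p u v = metric M p v u"
  and metric_pos: "u \<noteq> 0 \<Longrightarrow> metric M p u u > 0"
  and chart_metric_smooth: "c \<in> atlas M \<Longrightarrow> smooth_on (snd c ` fst c) (\<lambda>x. chart_metric M c x u v)"
  using manifold unfolding riemannian_manifold_def by blast+

lemma metric_linear: "linear (metric M p u)" "linear (\<lambda>u. metric M p u v)"
  using metric_bilinear[of p] by (auto simp: bilinear_def)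

lemmas metric_simps = linear_add[OF metric_linear(1)] linear_add[OF metric_linear(2)]
  linear_diff[OF metric_linear(1)] linear_diff[OF metric_linear(2)]
  linear_scale[OF metric_linear(1)] linear_scale[OF metric_linear(2)]
  linear_0[OF metric_linear(1)] linear_0[OF metric_linear(2)]
  linear_neg[OF metric_linear(1)] linear_neg[OF metric_linear(2)]
  linear_sum[OF metric_linear(1)] linear_sum[OF metric_linear(2)]

lemma norm_at_scaleR: "norm_at M p (a *\<^sub>R v) = \<bar>a\<bar> * norm_at M p v"
  by (simp add: norm_at_def metric_simps real_sqrt_mult flip: mult.assoc)

lemma norm_at_nonneg: "norm_at M p v \<ge> 0"
  using metric_pos[of v p] metric_simps(7)[of p] by (cases "v = 0") (auto simp: norm_at_def)

lemma metric_self: "metric M p u u = (norm_at M p u)\<^sup>2" "metric M p u u \<ge> 0"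
proof -
  show "metric M p u u \<ge> 0"
    using metric_pos[of u p] metric_simps(7)[of p u] by (cases "u = 0") auto
  then show "metric M p u u = (norm_at M p u)\<^sup>2" by (simp add: norm_at_def)
qed

lemma metric_Cauchy_Schwarz: "\<bar>metric M p u v\<bar> \<le> norm_at M p u * norm_at M p v"
proof (cases "v = 0")
  case False
  then have vv: "metric M p v v > 0" by (rule metric_pos)
  define t where "t = metric M p u v / metric M p v v"
  have "0 \<le> metric M p (u - t *\<^sub>R v) (u - t *\<^sub>R v)" by (rule metric_self)
  also have "\<dots> = metric M p u u - 2 * t * metric M p u v + t * (t * metric M p v v)"
    by (simp add: metric_simps metric_sym[of p v u] algebra_simps)
  also have "t * metric M p v v = metric M p u v" using vv by (simp add: t_def)
  finally have "t * metric M p u v \<le> metric M p u u" by simp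
  then have "(metric M p u v)\<^sup>2 \<le> metric M p u u * metric M p v v"
    using vv by (simp add: t_def power2_eq_square field_simps)
  then have "sqrt ((metric M p u v)\<^sup>2) \<le> sqrt (metric M p u u * metric M p v v)"
    by (rule real_sqrt_le_mono)
  then show ?thesis by (simp add: norm_at_def real_sqrt_mult)
qed (simp add: metric_simps norm_at_def)

lemma norm_at_convex_combination:
  assumes "\<And>j. j \<in> J \<Longrightarrow> w j \<ge> 0" "(\<Sum>j\<in>J. w j) = 1"
  shows "(norm_at M p (\<Sum>j\<in>J. w j *\<^sub>R u j))\<^sup>2 \<le> (\<Sum>j\<in>J. w j * (norm_at M p (u j))\<^sup>2)"
proof -
  define m where "m = (\<Sum>j\<in>J. w j *\<^sub>R u j)"
  have "0 \<le> (\<Sum>j\<in>J. w j * metric M p (u j - m) (u j - m))"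
    using assms(1) metric_self(2) by (intro sum_nonneg mult_nonneg_nonneg) auto
  also have "\<dots> = (\<Sum>j\<in>J. w j * metric M p (u j) (u j) - 2 * (w j * metric M p (u j) m) + w j * metric M p m m)"
  proof (rule sum.cong[OF refl])
    fix j
    have eq: "metric M p (u j - m) (u j - m) = metric M p (u j) (u j) - 2 * metric M p (u j) m + metric M p m m"
      using metric_sym[of p m "u j"] by (simp add: metric_simps(3,4))
    show "w j * metric M p (u j - m) (u j - m)
      = w j * metric M p (u j) (u j) - 2 * (w j * metric M p (u j) m) + w j * metric M p m m"
      unfolding eq by (simp add: algebra_simps)
  qed
  also have "\<dots> = (\<Sum>j\<in>J. w j * metric M p (u j) (u j)) - 2 * (\<Sum>j\<in>J. w j * metric M p (u j) m)
      + (\<Sum>j\<in>J. w j) * metric M p m m"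
    by (simp only: sum.distrib sum_subtractf sum_distrib_left sum_distrib_right)
  also have "(\<Sum>j\<in>J. w j * metric M p (u j) m) = metric M p (\<Sum>j\<in>J. w j *\<^sub>R u j) m"
    by (simp add: metric_simps(6,12))
  also have "\<dots> = metric M p m m" by (simp only: m_def)
  finally show ?thesis using assms(2) by (simp add: m_def metric_self(1))
qed

lemma metric_continuous: "continuous_on UNIV (\<lambda>v. metric M p v v)"
proof -
  have "bounded_bilinear (metric M p)" using metric_bilinear bilinear_conv_bounded_bilinear by blast
  from bounded_bilinear.continuous_on[OF this continuous_on_id continuous_on_id] show ?thesis .
qed

lemma chart_open:
  assumes "c \<in> atlas M"
  shows "open (fst c)" "open (snd c ` fst c)" "continuous_on (fst c) (snd c)"
    "p \<in> fst c \<Longrightarrow> chart_inv c (snd c p) = p"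
  using assms atlas unfolding smooth_atlas_def is_chart_def homeomorphism_def by blast+

lemma chart_at: "chart_at M p \<in> atlas M" "p \<in> fst (chart_at M p)"
proof -
  have "\<exists>c. c \<in> atlas M \<and> p \<in> fst c" using atlas unfolding smooth_atlas_def by blast
  from someI_ex[OF this] show "chart_at M p \<in> atlas M" "p \<in> fst (chart_at M p)"
    by (auto simp: chart_at_def)
qed

lemma overlap_open:
  assumes "c \<in> atlas M" "c' \<in> atlas M"
  shows "open (snd c ` (fst c \<inter> fst c'))"
  using assms atlas unfolding smooth_atlas_def smooth_on_def by blast

lemma transition_derivative:
  assumes "c \<in> atlas M" "c' \<in> atlas M" "p \<in> fst c" "p \<in> fst c'"
  shows "((snd c' \<circ> chart_inv c) has_derivative change_coords c c' p) (at (snd c p))"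
proof -
  have "smooth_on (snd c ` (fst c \<inter> fst c')) (snd c' \<circ> chart_inv c)"
    using assms atlas unfolding smooth_atlas_def by blast
  then have "Ck_on (Suc 0) (snd c ` (fst c \<inter> fst c')) (snd c' \<circ> chart_inv c)"
    unfolding smooth_on_def by blast
  then obtain f' where f': "((snd c' \<circ> chart_inv c) has_derivative f') (at (snd c p))"
    using assms by auto
  have "change_coords c c' p = f'"
    using frechet_derivative_at[OF f'] by (simp add: change_coords_def fun_eq_iff)
  with f' show ?thesis by simp
qed

lemma change_coords_linear:
  assumes "c \<in> atlas M" "c' \<in> atlas M" "p \<in> fst c" "p \<in> fst c'"
  shows "linear (change_coords c c' p)"
  by (rule has_derivative_linear[OF transition_derivative[OF assms]])

lemma change_coords_id:
  assumes "c \<in> atlas M" "p \<in> fst c"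
  shows "change_coords c c p v = v"
proof -
  have "((snd c \<circ> chart_inv c) has_derivative (\<lambda>v. v)) (at (snd c p))"
  proof (rule has_derivative_transform_within_open[of "\<lambda>x. x"])
    show "x = (snd c \<circ> chart_inv c) x" if "x \<in> snd c ` fst c" for x
      using that chart_open(4)[OF assms(1)] by auto
  qed (use assms chart_open in auto)
  from has_derivative_unique[OF this transition_derivative[OF assms(1,1,2,2)]]
  show ?thesis by metis
qed

lemma change_coords_trans:
  assumes "c \<in> atlas M" "c' \<in> atlas M" "c'' \<in> atlas M" "p \<in> fst c" "p \<in> fst c'" "p \<in> fst c''"
  shows "change_coords c' c'' p (change_coords c c' p v) = change_coords c c'' p v"
proof -
  have inv: "chart_inv c (snd c p) = p" using assms chart_open by auto
  have "((snd c'' \<circ> chart_inv c') \<circ> (snd c' \<circ> chart_inv c) has_derivative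
      change_coords c' c'' p \<circ> change_coords c c' p) (at (snd c p))"
    using transition_derivative[of c c' p] transition_derivative[of c' c'' p] assms inv
    by (intro diff_chain_at) auto
  then have "(snd c'' \<circ> chart_inv c has_derivative
      change_coords c' c'' p \<circ> change_coords c c' p) (at (snd c p))"
  proof (rule has_derivative_transform_within_open)
    show "open (snd c ` (fst c \<inter> fst c'))" using overlap_open assms by blast
    show "((snd c'' \<circ> chart_inv c') \<circ> (snd c' \<circ> chart_inv c)) x = (snd c'' \<circ> chart_inv c) x"
      if "x \<in> snd c ` (fst c \<inter> fst c')" for x
      using that chart_open(4)[OF assms(1)] chart_open(4)[OF assms(2)] by auto
  qed (use assms in auto)
  from has_derivative_unique[OF this transition_derivative[OF assms(1,3,4,6)]]
  show ?thesis by (metis comp_apply)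
qed

text \<open>Tangent vectors are given in a chart that varies irregularly with the base point. Along a curve
  everything is therefore computed in one fixed chart and transferred by this chain rule.\<close>

lemma velocity_change:
  assumes c: "c \<in> atlas M" "c' \<in> atlas M" "\<gamma> t \<in> fst c" "\<gamma> t \<in> fst c'"
    and \<gamma>: "continuous_on S \<gamma>" "t \<in> S"
    and v: "((snd c \<circ> \<gamma>) has_vector_derivative v) (at t within S)"
  shows "((snd c' \<circ> \<gamma>) has_vector_derivative change_coords c c' (\<gamma> t) v) (at t within S)"
proof -
  let ?D = "change_coords c c' (\<gamma> t)"
  have "((snd c' \<circ> chart_inv c) has_derivative ?D) (at ((snd c \<circ> \<gamma>) t) within (snd c \<circ> \<gamma>) ` S)"
    using transition_derivative[OF c] by (auto intro: has_derivative_at_withinI)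
  from diff_chain_within[OF v[unfolded has_vector_derivative_def] this]
  have "((snd c' \<circ> chart_inv c) \<circ> (snd c \<circ> \<gamma>) has_derivative ?D \<circ> (\<lambda>x. x *\<^sub>R v)) (at t within S)" .
  moreover have "?D \<circ> (\<lambda>x. x *\<^sub>R v) = (\<lambda>x. x *\<^sub>R ?D v)"
    using linear_scale[OF change_coords_linear[OF c]] by auto
  ultimately have D: "((snd c' \<circ> chart_inv c) \<circ> (snd c \<circ> \<gamma>) has_derivative (\<lambda>x. x *\<^sub>R ?D v)) (at t within S)"
    by simp
  have "(\<gamma> \<longlongrightarrow> \<gamma> t) (at t within S)" using \<gamma> by (simp add: continuous_on_def)
  then have "\<forall>\<^sub>F s in at t within S. \<gamma> s \<in> fst c"
    using c chart_open(1)[OF c(1)] by (simp add: tendsto_def)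
  then have ev: "\<forall>\<^sub>F s in at t within S. ((snd c' \<circ> chart_inv c) \<circ> (snd c \<circ> \<gamma>)) s = (snd c' \<circ> \<gamma>) s"
    by eventually_elim (simp add: chart_open(4)[OF c(1)])
  have "((snd c' \<circ> chart_inv c) \<circ> (snd c \<circ> \<gamma>)) t = (snd c' \<circ> \<gamma>) t"
    using c by (simp add: chart_open(4)[OF c(1)])
  from has_derivative_transform_eventually[OF D ev this \<gamma>(2)]
  show ?thesis unfolding has_vector_derivative_def .
qed

lemma metric_eq_chart_metric:
  assumes "c \<in> atlas M" "p \<in> fst c"
  shows "metric M p u v = chart_metric M c (snd c p) (to_chart M c p u) (to_chart M c p v)"
  using assms chart_at chart_open(4)[OF assms]
  by (simp add: chart_metric_def to_chart_def from_chart_def change_coords_trans change_coords_id)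

lemma chart_metric_eq_metric:
  assumes "c \<in> atlas M" "p \<in> fst c"
  shows "chart_metric M c (snd c p) u v = metric M p (from_chart M c p u) (from_chart M c p v)"
  using chart_open(4)[OF assms] by (simp add: chart_metric_def)

lemma from_chart_linear: "c \<in> atlas M \<Longrightarrow> p \<in> fst c \<Longrightarrow> linear (from_chart M c p)"
  using change_coords_linear[OF _ chart_at(1) _ chart_at(2)] by (simp add: from_chart_def[abs_def])

lemma to_chart_linear: "c \<in> atlas M \<Longrightarrow> p \<in> fst c \<Longrightarrow> linear (to_chart M c p)"
  using change_coords_linear[OF chart_at(1) _ chart_at(2)] by (simp add: to_chart_def[abs_def])

lemma to_from_chart:
  assumes "c \<in> atlas M" "p \<in> fst c"
  shows "to_chart M c p (from_chart M c p v) = v" "from_chart M c p (to_chart M c p v) = v"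
  using assms chart_at by (simp_all add: to_chart_def from_chart_def change_coords_trans change_coords_id)

lemma chart_metric_inner:
  assumes c: "c \<in> atlas M" and x: "x \<in> snd c ` fst c"
  shows "bilinear (chart_metric M c x)" "chart_metric M c x u v = chart_metric M c x v u"
    "u \<noteq> 0 \<Longrightarrow> chart_metric M c x u u > 0"
proof -
  from x obtain p where p: "p \<in> fst c" "x = snd c p" by auto
  note lin = from_chart_linear[OF c p(1)]
  show "bilinear (chart_metric M c x)"
    unfolding bilinear_def p chart_metric_eq_metric[OF c p(1), abs_def]
    using linear_compose[OF lin metric_linear(1)] linear_compose[OF lin metric_linear(2)]
    by (auto simp: o_def)
  show "chart_metric M c x u v = chart_metric M c x v u"
    by (simp add: p chart_metric_eq_metric[OF c p(1)] metric_sym)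
  assume "u \<noteq> 0"
  then have "from_chart M c p u \<noteq> 0"
    using to_from_chart(1)[OF c p(1), of u] linear_0[OF to_chart_linear[OF c p(1)]] by auto
  then show "chart_metric M c x u u > 0"
    by (simp add: p chart_metric_eq_metric[OF c p(1)] metric_pos)
qed

definition dmetric :: "('m, 'e) chart \<Rightarrow> 'e \<Rightarrow> 'e \<Rightarrow> 'e \<Rightarrow> 'e \<Rightarrow> real" where
  "dmetric c u v x = frechet_derivative (\<lambda>x. chart_metric M c x u v) (at x)"

lemma dmetric:
  assumes "c \<in> atlas M" "x \<in> snd c ` fst c"
  shows "((\<lambda>x. chart_metric M c x u v) has_derivative dmetric c u v x) (at x)"
proof -
  have "Ck_on (Suc 0) (snd c ` fst c) (\<lambda>x. chart_metric M c x u v)"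
    using chart_metric_smooth[OF assms(1)] unfolding smooth_on_def by blast
  then have "(\<lambda>x. chart_metric M c x u v) differentiable (at x)"
    using assms(2) unfolding differentiable_def by auto
  then show ?thesis unfolding dmetric_def using frechet_derivative_works by blast
qed

text \<open>The metric in coordinates is an inner product only for points in the range of the chart; as this range is open, an
  identity there suffices to identify derivatives.\<close>

lemma dmetric_eqI:
  assumes c: "c \<in> atlas M" "x \<in> snd c ` fst c" and f: "(f has_derivative D) (at x)"
    and eq: "\<And>y. y \<in> snd c ` fst c \<Longrightarrow> f y = chart_metric M c y u v"
  shows "dmetric c u v x = D"
proof -
  have "((\<lambda>x. chart_metric M c x u v) has_derivative D) (at x)"
    using has_derivative_transform_within_open[OF f chart_open(2)[OF c(1)] c(2) eq] by simp
  from has_derivative_unique[OF dmetric[OF c] this] show ?thesis .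
qed

lemma dmetric_expand:
  assumes c: "c \<in> atlas M" "x \<in> snd c ` fst c"
  shows "dmetric c u v x w =
    (\<Sum>i\<in>Basis. \<Sum>j\<in>Basis. (u \<bullet> i) * (v \<bullet> j) * dmetric c i j x w)"
proof -
  have "dmetric c u v x = (\<lambda>w. \<Sum>i\<in>Basis. \<Sum>j\<in>Basis. (u \<bullet> i) * (v \<bullet> j) * dmetric c i j x w)"
  proof (rule dmetric_eqI[OF c])
    show "((\<lambda>x. \<Sum>i\<in>Basis. \<Sum>j\<in>Basis. (u \<bullet> i) * (v \<bullet> j) * chart_metric M c x i j) has_derivative
      (\<lambda>w. \<Sum>i\<in>Basis. \<Sum>j\<in>Basis. (u \<bullet> i) * (v \<bullet> j) * dmetric c i j x w)) (at x)"
      by (intro has_derivative_sum has_derivative_mult_right dmetric c)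
    show "(\<Sum>i\<in>Basis. \<Sum>j\<in>Basis. (u \<bullet> i) * (v \<bullet> j) * chart_metric M c y i j) = chart_metric M c y u v"
      if "y \<in> snd c ` fst c" for y
      by (rule bilinear_expand[OF chart_metric_inner(1)[OF c(1) that], symmetric])
  qed
  then show ?thesis by simp
qed

lemma dmetric_bilinear:
  assumes c: "c \<in> atlas M" "x \<in> snd c ` fst c"
  shows "bilinear (\<lambda>u v. dmetric c u v x w)"
proof -
  define a where "a i j = dmetric c i j x w" for i j
  have "(\<lambda>u v. dmetric c u v x w) = (\<lambda>u v. \<Sum>i\<in>Basis. \<Sum>j\<in>Basis. (u \<bullet> i) * (v \<bullet> j) * a i j)"
    unfolding a_def by (intro ext dmetric_expand c)
  then show ?thesis
    by (auto simp: bilinear_def inner_simps sum.distrib sum_distrib_left algebra_simps intro!: linearI)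
qed

lemma dmetric_linear:
  assumes c: "c \<in> atlas M" "x \<in> snd c ` fst c"
  shows "linear (dmetric c u v x)" "linear (\<lambda>u. dmetric c u v x w)" "linear (\<lambda>v. dmetric c u v x w)"
  using has_derivative_linear[OF dmetric[OF c]] dmetric_bilinear[OF c] by (auto simp: bilinear_def)

text \<open>The right-hand side of the Koszul formula for constant coordinate fields.\<close>

definition koszul :: "('m, 'e) chart \<Rightarrow> 'e \<Rightarrow> 'e \<Rightarrow> 'e \<Rightarrow> 'e \<Rightarrow> real" where
  "koszul c x u v z = dmetric c v z x u + dmetric c u z x v - dmetric c u v x z"

lemma koszul_linear:
  assumes c: "c \<in> atlas M" "x \<in> snd c ` fst c"
  shows "linear (koszul c x u v)"
  unfolding koszul_def[abs_def]
  by (intro linear_compose_add linear_compose_sub dmetric_linear[OF c])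

text \<open>The Gram matrix of the metric, as an operator in coordinates.\<close>

lemma gram_inj:
  assumes c: "c \<in> atlas M" "x \<in> snd c ` fst c"
  shows "linear (\<lambda>w. \<Sum>b\<in>Basis. chart_metric M c x w b *\<^sub>R b)"
    "inj (\<lambda>w. \<Sum>b\<in>Basis. chart_metric M c x w b *\<^sub>R b)"
proof -
  let ?A = "\<lambda>w. \<Sum>b\<in>Basis. chart_metric M c x w b *\<^sub>R b"
  have lin: "linear (chart_metric M c x u)" "linear (\<lambda>u. chart_metric M c x u v)" for u v
    using chart_metric_inner(1)[OF c] by (auto simp: bilinear_def)
  show "linear ?A"
    by (auto intro!: linearI simp: linear_add[OF lin(2)] linear_scale[OF lin(2)] algebra_simps
        sum.distrib scaleR_sum_right)
  moreover have "w = 0" if "?A w = 0" for w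
  proof (rule ccontr)
    have "chart_metric M c x w b = 0" if "b \<in> Basis" for b
    proof -
      have "chart_metric M c x w b = ?A w \<bullet> b" using that by (simp add: inner_sum_left_Basis)
      then show ?thesis by (simp add: \<open>?A w = 0\<close>)
    qed
    then have "chart_metric M c x w w = 0"
      using linear_eq_stdbasis[of "chart_metric M c x w" "\<lambda>_. 0"] lin(1) linear_zero by metis
    moreover assume "w \<noteq> 0"
    ultimately show False using chart_metric_inner(3)[OF c] by force
  qed
  ultimately show "inj ?A" by (simp add: linear_injective_0)
qed

text \<open>An injective Gram operator is onto, so the Koszul formula determines exactly one vector.\<close>

lemma christoffel:
  assumes c: "c \<in> atlas M" "x \<in> snd c ` fst c"
  shows "2 * chart_metric M c x (christoffel M c x u v) z = koszul c x u v z"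
    and "(\<And>z. 2 * chart_metric M c x w' z = koszul c x u v z) \<Longrightarrow> christoffel M c x u v = w'"
proof -
  let ?A = "\<lambda>w. \<Sum>b\<in>Basis. chart_metric M c x w b *\<^sub>R b"
  have lin: "linear (chart_metric M c x u)" for u
    using chart_metric_inner(1)[OF c] by (auto simp: bilinear_def)
  have A: "?A w \<bullet> b = chart_metric M c x w b" if "b \<in> Basis" for w b
    using that by (simp add: inner_sum_left_Basis)
  have uniq: "w = w'" if "\<And>z. 2 * chart_metric M c x w z = koszul c x u v z"
    "\<And>z. 2 * chart_metric M c x w' z = koszul c x u v z" for w w'
  proof -
    have "chart_metric M c x w b = chart_metric M c x w' b" for b
      using that[of b] by simp
    then show ?thesis using gram_inj(2)[OF c] by (simp add: inj_def)
  qed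
  have "surj ?A" using gram_inj[OF c] by (rule linear_inj_imp_surj)
  from surjD[OF this, of "\<Sum>b\<in>Basis. (koszul c x u v b / 2) *\<^sub>R b"]
  obtain y where y': "(\<Sum>b\<in>Basis. (koszul c x u v b / 2) *\<^sub>R b) = ?A y" by blast
  note w = y'[symmetric]
  have "2 * chart_metric M c x y z = koszul c x u v z" for z
  proof (rule linear_eq_stdbasis[THEN fun_cong, of "\<lambda>z. 2 * chart_metric M c x y z"])
    show "linear (\<lambda>z. 2 * chart_metric M c x y z)"
      using linear_compose[OF lin, of "\<lambda>r. 2 * r"] by (simp add: o_def linearI algebra_simps)
    show "linear (koszul c x u v)" by (rule koszul_linear[OF c])
    show "2 * chart_metric M c x y b = koszul c x u v b" if "b \<in> Basis" for b
      using arg_cong[OF w, of "\<lambda>a. a \<bullet> b"] A[OF that] that by (simp add: inner_sum_left_Basis)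
  qed
  then have "\<exists>!w. \<forall>z. 2 * chart_metric M c x w z = koszul c x u v z" using uniq by blast
  moreover have "christoffel M c x u v = (THE w. \<forall>z. 2 * chart_metric M c x w z = koszul c x u v z)"
    by (simp add: christoffel_def koszul_def dmetric_def)
  ultimately have *: "\<forall>z. 2 * chart_metric M c x (christoffel M c x u v) z = koszul c x u v z"
    using theI'[of "\<lambda>w. \<forall>z. 2 * chart_metric M c x w z = koszul c x u v z"] by presburger
  then show "2 * chart_metric M c x (christoffel M c x u v) z = koszul c x u v z" by blast
  show "christoffel M c x u v = w'" if "\<And>z. 2 * chart_metric M c x w' z = koszul c x u v z"
    using uniq[of "christoffel M c x u v" w'] * that by blast
qed

text \<open>The degree \<open>2\<close> is what makes affine reparametrisations of geodesics geodesics.\<close>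

lemma christoffel_scale:
  assumes c: "c \<in> atlas M" "x \<in> snd c ` fst c"
  shows "christoffel M c x (a *\<^sub>R v) (a *\<^sub>R v) = a\<^sup>2 *\<^sub>R christoffel M c x v v"
proof (rule christoffel(2)[OF c])
  fix z
  have lin: "linear (\<lambda>u. chart_metric M c x u z)"
    using chart_metric_inner(1)[OF c] by (auto simp: bilinear_def)
  have "2 * chart_metric M c x (a\<^sup>2 *\<^sub>R christoffel M c x v v) z = a\<^sup>2 * koszul c x v v z"
    by (simp add: linear_scale[OF lin] christoffel(1)[OF c, symmetric])
  also have "\<dots> = koszul c x (a *\<^sub>R v) (a *\<^sub>R v) z"
    by (simp add: koszul_def linear_scale[OF dmetric_linear(1)[OF c]]
      linear_scale[OF dmetric_linear(2)[OF c]] linear_scale[OF dmetric_linear(3)[OF c]]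
      power2_eq_square algebra_simps)
  finally show "2 * chart_metric M c x (a\<^sup>2 *\<^sub>R christoffel M c x v v) z = koszul c x (a *\<^sub>R v) (a *\<^sub>R v) z" .
qed

lemma lip_near_dmetric:
  assumes c: "c \<in> atlas M" "x \<in> snd c ` fst c"
  shows "lip_near (\<lambda>x. dmetric c u v x w) x"
proof -
  have o: "open (snd c ` fst c)" using chart_open c by blast
  obtain r where r: "r > 0" "ball x r \<subseteq> snd c ` fst c" using o c(2) open_contains_ball by blast
  have "Ck_on (Suc 1) (snd c ` fst c) (\<lambda>x. chart_metric M c x u v)"
    using chart_metric_smooth[OF c(1)] unfolding smooth_on_def by blast
  then obtain f' where f': "\<forall>x\<in>snd c ` fst c. ((\<lambda>x. chart_metric M c x u v) has_derivative f' x) (at x)"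
    "\<forall>w. Ck_on 1 (snd c ` fst c) (\<lambda>x. f' x w)" using Ck_on.simps(2) by blast
  have lip: "lip_near (\<lambda>x. f' x w) x" using lip_near_C1[OF o c(2)] f'(2) by blast
  have eq: "f' y w = dmetric c u v y w" if "y \<in> ball x r" for y
  proof -
    have y: "y \<in> snd c ` fst c" using r that by auto
    show ?thesis using has_derivative_unique[OF dmetric[OF c(1) y]] f'(1) y by metis
  qed
  show ?thesis by (rule lip_near_cong[OF r(1) eq lip])
qed

lemma lip_near_chart_metric:
  assumes c: "c \<in> atlas M" "x \<in> snd c ` fst c"
  shows "lip_near (\<lambda>x. chart_metric M c x u v) x"
proof -
  have "Ck_on 1 (snd c ` fst c) (\<lambda>x. chart_metric M c x u v)"
    using chart_metric_smooth[OF c(1)] unfolding smooth_on_def by blast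
  then show ?thesis using lip_near_C1[OF chart_open(2)[OF c(1)] c(2)] by blast
qed

text \<open>The Christoffel symbols solve the Gram system with the Koszul expression as right-hand side. Its
  entries are built from the metric and its first derivatives, which are locally Lipschitz.\<close>

lemma lip_near_christoffel:
  assumes c: "c \<in> atlas M" "fst z0 \<in> snd c ` fst c"
  shows "lip_near (\<lambda>z. christoffel M c (fst z) (snd z) (snd z)) z0"
proof -
  define k where "k z = (\<Sum>b\<in>Basis. ((\<Sum>i\<in>Basis. \<Sum>j\<in>Basis. ((snd z \<bullet> i) *\<^sub>R ((snd z \<bullet> j) *\<^sub>R
      (dmetric c i b (fst z) j - (1/2) *\<^sub>R dmetric c i j (fst z) b))))) *\<^sub>R b)" for z :: "'e \<times> 'e"
  have k: "lip_near k z0"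
  proof -
    have *: "lip_near (\<lambda>z. dmetric c i b (fst z) j - (1/2) *\<^sub>R dmetric c i j (fst z) b) z0" for i j b
    proof -
      have "lip_near (\<lambda>z. dmetric c i b (fst z) j + (- 1/2) *\<^sub>R dmetric c i j (fst z) b) z0"
        by (intro lip_near_add lip_near_scaleR lip_near_const lip_near_fst lip_near_dmetric c)
      then show ?thesis by simp
    qed
    have **: "lip_near (\<lambda>z. snd z \<bullet> i) z0" for i :: 'e
      by (intro lip_near_bounded_linear bounded_linear_inner_left_comp bounded_linear_snd)
    show ?thesis unfolding k_def
      by (intro lip_near_sum lip_near_scaleR lip_near_const * **)
  qed
  have "open (snd c ` fst c \<times> (UNIV :: 'e set))" using chart_open(2)[OF c(1)] by (simp add: open_Times)
  moreover have "z0 \<in> snd c ` fst c \<times> UNIV" using c(2) by (simp add: mem_Times_iff)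
  ultimately obtain r where r: "r > 0" "ball z0 r \<subseteq> snd c ` fst c \<times> UNIV"
    using open_contains_ball by blast
  have inS: "fst z \<in> snd c ` fst c" if "z \<in> ball z0 r" for z
    using r(2) that by (auto simp: mem_Times_iff)
  show ?thesis
  proof (rule lip_near_linear_solve[where A = "\<lambda>z w. \<Sum>b\<in>Basis. chart_metric M c (fst z) w b *\<^sub>R b"
        and k = k, OF r(1)])
    show "lip_near (\<lambda>x. \<Sum>ba\<in>Basis. chart_metric M c (fst x) b ba *\<^sub>R ba) z0" for b
      by (intro lip_near_sum lip_near_scaleR lip_near_const lip_near_fst lip_near_chart_metric c)
    show "lip_near k z0" by (rule k)
    show "inj (\<lambda>w. \<Sum>b\<in>Basis. chart_metric M c (fst z0) w b *\<^sub>R b)"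
      by (rule gram_inj(2)[OF c])
    fix z assume "z \<in> ball z0 r"
    note z = c(1) inS[OF this]
    show "linear (\<lambda>w. \<Sum>b\<in>Basis. chart_metric M c (fst z) w b *\<^sub>R b)"
      by (rule gram_inj(1)[OF z])
    show "(\<Sum>b\<in>Basis. chart_metric M c (fst z) (christoffel M c (fst z) (snd z) (snd z)) b *\<^sub>R b) = k z"
      unfolding k_def
    proof (intro sum.cong refl arg_cong[where f = "\<lambda>r. r *\<^sub>R _"])
      fix b :: 'e assume b: "b \<in> Basis"
      let ?v = "snd z" and ?x = "fst z"
      have e1: "dmetric c ?v b ?x ?v = (\<Sum>i\<in>Basis. \<Sum>j\<in>Basis. (?v \<bullet> i) * (?v \<bullet> j) * dmetric c i b ?x j)"
      proof (rule bilinear_expand[where B = "\<lambda>u w. dmetric c u b ?x w"])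
        show "bilinear (\<lambda>u. dmetric c u b (fst z))"
          using dmetric_linear[OF z] by (auto simp: bilinear_def)
      qed
      have e2: "dmetric c ?v ?v ?x b = (\<Sum>i\<in>Basis. \<Sum>j\<in>Basis. (?v \<bullet> i) * (?v \<bullet> j) * dmetric c i j ?x b)"
        by (rule dmetric_expand[OF z])
      have "chart_metric M c ?x (christoffel M c ?x ?v ?v) b = koszul c ?x ?v ?v b / 2"
        using christoffel(1)[OF z, of ?v ?v b] by simp
      also have "\<dots> = dmetric c ?v b ?x ?v - dmetric c ?v ?v ?x b / 2"
        by (simp add: koszul_def)
      also have "\<dots> = (\<Sum>i\<in>Basis. \<Sum>j\<in>Basis. (?v \<bullet> i) *\<^sub>R (?v \<bullet> j) *\<^sub>R
         (dmetric c i b ?x j - (1/2) *\<^sub>R dmetric c i j ?x b))"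
        unfolding e1 e2 by (simp add: sum_divide_distrib sum_subtractf algebra_simps)
      finally show "chart_metric M c ?x (christoffel M c ?x ?v ?v) b = \<dots>" .
    qed
  qed
qed

end

section \<open>Geodesics\<close>

context riemannian_mfd
begin

lemma geodesic_chartE:
  assumes "geodesic_on M S \<gamma>" "c \<in> atlas M"
  obtains v where
    "\<forall>t\<in>S. \<gamma> t \<in> fst c \<longrightarrow> ((snd c \<circ> \<gamma>) has_vector_derivative v t) (at t within S)"
    "\<forall>t\<in>S. \<gamma> t \<in> fst c \<longrightarrow>
       (v has_vector_derivative - christoffel M c (snd c (\<gamma> t)) (v t) (v t)) (at t within S)"
proof -
  from assms obtain v where "\<forall>t \<in> S \<inter> \<gamma> -` fst c.
        ((snd c \<circ> \<gamma>) has_vector_derivative v t) (at t within S) \<and>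
        (v has_vector_derivative - christoffel M c (snd c (\<gamma> t)) (v t) (v t)) (at t within S)"
    unfolding geodesic_on_def by blast
  then show ?thesis by (intro that[of v]) blast+
qed

lemma geodesic_continuous: "geodesic_on M S \<gamma> \<Longrightarrow> continuous_on S \<gamma>"
  by (simp add: geodesic_on_def)

lemma not_bot_interval: "t \<in> {a..b} \<Longrightarrow> a < b \<Longrightarrow> at t within {a..b::real} \<noteq> bot"
  by (simp add: trivial_limit_within islimpt_Icc)

lemma velocity_unique:
  assumes "((snd c \<circ> \<gamma>) has_vector_derivative v) (at t within {a..b})"
    "((snd c \<circ> \<gamma>) has_vector_derivative w) (at t within {a..b})" "t \<in> {a..b}" "a < b"
  shows "v = w"
  by (rule vector_derivative_unique_within[OF not_bot_interval[OF assms(3,4)] assms(1,2)])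

lemma geodesic_has_velocity:
  assumes "geodesic_on M S \<gamma>" "t \<in> S"
  shows "\<exists>v. has_velocity M \<gamma> v t S"
proof -
  obtain v where "\<forall>t'\<in>S. \<gamma> t' \<in> fst (chart_at M (\<gamma> t)) \<longrightarrow>
      ((snd (chart_at M (\<gamma> t)) \<circ> \<gamma>) has_vector_derivative v t') (at t' within S)"
    by (rule geodesic_chartE[OF assms(1) chart_at(1)])
  then show ?thesis unfolding has_velocity_def using assms(2) chart_at by blast
qed

lemma has_velocity_in_chart:
  assumes "continuous_on S \<gamma>" "t \<in> S" "c \<in> atlas M" "\<gamma> t \<in> fst c"
  shows "has_velocity M \<gamma> v t S \<Longrightarrow>
      ((snd c \<circ> \<gamma>) has_vector_derivative to_chart M c (\<gamma> t) v) (at t within S)"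
    and "((snd c \<circ> \<gamma>) has_vector_derivative w) (at t within S) \<Longrightarrow>
      has_velocity M \<gamma> (from_chart M c (\<gamma> t) w) t S"
  unfolding has_velocity_def to_chart_def from_chart_def
  using velocity_change[OF chart_at(1) assms(3) chart_at(2) assms(4) assms(1,2)]
    velocity_change[OF assms(3) chart_at(1) assms(4) chart_at(2) assms(1,2)] by blast+

lemma has_velocity_unique:
  assumes "has_velocity M \<gamma> v t {0..1}" "has_velocity M \<gamma> w t {0..1}" "t \<in> {0..1}"
  shows "v = w"
  using assms velocity_unique[of "chart_at M (\<gamma> t)" \<gamma> v t 0 1 w] unfolding has_velocity_def by simp

lemma stays_in_chart:
  fixes \<gamma> :: "real \<Rightarrow> 'm"
  assumes "continuous_on {0..1} \<gamma>" "t \<in> {0..1}" "c \<in> atlas M" "\<gamma> t \<in> fst c"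
  shows "\<exists>e>0. \<forall>s\<in>{0..1}. \<bar>s - t\<bar> < e \<longrightarrow> \<gamma> s \<in> fst c"
proof -
  have "(\<gamma> \<longlongrightarrow> \<gamma> t) (at t within {0..1})" using assms by (simp add: continuous_on_def)
  then have "\<forall>\<^sub>F s in at t within {0..1}. \<gamma> s \<in> fst c"
    using assms chart_open(1)[OF assms(3)] by (simp add: tendsto_def)
  then obtain e where "e > 0" "\<forall>s\<in>{0..1}. s \<noteq> t \<and> dist s t < e \<longrightarrow> \<gamma> s \<in> fst c"
    by (auto simp: eventually_at)
  then show ?thesis using assms(4) by (metis dist_real_def)
qed

text \<open>In a chart, position and velocity together solve a first-order equation with locally Lipschitz
  right-hand side.\<close>

lemma geodesic_continue_agreement:
  assumes g1: "geodesic_on M {0..1} \<gamma>1" and g2: "geodesic_on M {0..1} \<gamma>2"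
    and t: "0 \<le> t" "t < 1" and eq: "\<gamma>1 t = \<gamma>2 t"
    and vel: "has_velocity M \<gamma>1 v t {0..1}" "has_velocity M \<gamma>2 v t {0..1}"
  shows "\<exists>u\<in>{t<..1}. \<forall>s\<in>{t..u}. \<gamma>1 s = \<gamma>2 s"
proof -
  define c where "c = chart_at M (\<gamma>1 t)"
  have c: "c \<in> atlas M" "\<gamma>1 t \<in> fst c" "\<gamma>2 t \<in> fst c" using chart_at eq by (auto simp: c_def)
  have t01: "t \<in> {0..1}" using t by simp
  obtain e1 where e1: "e1 > 0" "\<forall>s\<in>{0..1}. \<bar>s - t\<bar> < e1 \<longrightarrow> \<gamma>1 s \<in> fst c"
    using stays_in_chart[OF geodesic_continuous[OF g1] t01 c(1,2)] by blast
  obtain e2 where e2: "e2 > 0" "\<forall>s\<in>{0..1}. \<bar>s - t\<bar> < e2 \<longrightarrow> \<gamma>2 s \<in> fst c"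
    using stays_in_chart[OF geodesic_continuous[OF g2] t01 c(1,3)] by blast
  define b where "b = min 1 (t + min e1 e2 / 2)"
  have b: "t < b" "b \<le> 1" using t e1 e2 by (auto simp: b_def)
  have inc: "\<gamma>1 s \<in> fst c" "\<gamma>2 s \<in> fst c" "s \<in> {0..1}" if "s \<in> {t..b}" for s
  proof -
    have *: "s \<in> {0..1}" "\<bar>s - t\<bar> < e1" "\<bar>s - t\<bar> < e2"
      using that t e1 e2 by (auto simp: b_def min_def split: if_splits)
    then show "\<gamma>1 s \<in> fst c" "\<gamma>2 s \<in> fst c" "s \<in> {0..1}" using e1(2) e2(2) by blast+
  qed
  have sub: "{t..b} \<subseteq> {0..1}" using t b by auto
  obtain v1 where v1: "\<forall>s\<in>{0..1}. \<gamma>1 s \<in> fst c \<longrightarrow>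
      ((snd c \<circ> \<gamma>1) has_vector_derivative v1 s) (at s within {0..1})"
    "\<forall>s\<in>{0..1}. \<gamma>1 s \<in> fst c \<longrightarrow> (v1 has_vector_derivative
      - christoffel M c (snd c (\<gamma>1 s)) (v1 s) (v1 s)) (at s within {0..1})"
    by (rule geodesic_chartE[OF g1 c(1)])
  obtain v2 where v2: "\<forall>s\<in>{0..1}. \<gamma>2 s \<in> fst c \<longrightarrow>
      ((snd c \<circ> \<gamma>2) has_vector_derivative v2 s) (at s within {0..1})"
    "\<forall>s\<in>{0..1}. \<gamma>2 s \<in> fst c \<longrightarrow> (v2 has_vector_derivative
      - christoffel M c (snd c (\<gamma>2 s)) (v2 s) (v2 s)) (at s within {0..1})"
    by (rule geodesic_chartE[OF g2 c(1)])
  define H where "H z = (snd z, - christoffel M c (fst z) (snd z) (snd z))" for z :: "'e \<times> 'e"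
  define z1 where "z1 s = (snd c (\<gamma>1 s), v1 s)" for s
  define z2 where "z2 s = (snd c (\<gamma>2 s), v2 s)" for s
  have "v1 t = v"
    using v1(1) vel(1) t01 c velocity_unique[of c \<gamma>1 "v1 t" t 0 1 v] eq
    by (simp add: has_velocity_def c_def)
  moreover have "v2 t = v"
    using v2(1) vel(2) t01 c velocity_unique[of c \<gamma>2 "v2 t" t 0 1 v] eq
    by (simp add: has_velocity_def c_def)
  ultimately have z: "z1 t = z2 t" using eq by (simp add: z1_def z2_def)
  have "\<exists>\<epsilon>>0. \<forall>s\<in>{t..min b (t + \<epsilon>)}. z1 s = z2 s"
  proof (rule ode_unique_right[where H = H and a = t and b = b and ?z1.0 = z1 and ?z2.0 = z2])
    show "t < b" "z1 t = z2 t" by fact+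
    have "lip_near (\<lambda>z. (snd z, (-1) *\<^sub>R christoffel M c (fst z) (snd z) (snd z))) (z1 t)"
      using c by (intro lip_near_Pair lip_near_scaleR lip_near_const lip_near_christoffel
          lip_near_bounded_linear[OF bounded_linear_snd]) (auto simp: z1_def)
    then show "lip_near H (z1 t)" by (simp add: H_def[abs_def])
    have pair: "((\<lambda>s. (snd c (\<gamma> s), v s)) has_vector_derivative H (snd c (\<gamma> s), v s)) (at s within {t..b})"
      if "((snd c \<circ> \<gamma>) has_vector_derivative v s) (at s within {0..1})"
        "(v has_vector_derivative - christoffel M c (snd c (\<gamma> s)) (v s) (v s)) (at s within {0..1})"
      for \<gamma> v s
      using has_vector_derivative_Pair[OF has_vector_derivative_within_subset[OF that(1) sub]
        has_vector_derivative_within_subset[OF that(2) sub]]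
      by (simp add: H_def o_def)
    show "(z1 has_vector_derivative H (z1 s)) (at s within {t..b})" if "s \<in> {t..b}" for s
      unfolding z1_def using v1 inc[OF that] by (intro pair) auto
    show "(z2 has_vector_derivative H (z2 s)) (at s within {t..b})" if "s \<in> {t..b}" for s
      unfolding z2_def using v2 inc[OF that] by (intro pair) auto
  qed
  then obtain \<epsilon> where \<epsilon>: "\<epsilon> > 0" "\<forall>s\<in>{t..min b (t + \<epsilon>)}. z1 s = z2 s" by blast
  have "\<gamma>1 s = \<gamma>2 s" if "s \<in> {t..min b (t + \<epsilon>)}" for s
  proof -
    have "snd c (\<gamma>1 s) = snd c (\<gamma>2 s)" using \<epsilon>(2) that by (auto simp: z1_def z2_def)
    moreover have "s \<in> {t..b}" using that by simp
    ultimately show ?thesis using inc[of s] chart_open(4)[OF c(1)] by metis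
  qed
  then show ?thesis using b \<epsilon>(1) by (intro bexI[of _ "min b (t + \<epsilon>)"]) auto
qed

text \<open>At the supremum \<open>\<tau>\<close> of the times up to which the curves agree, the positions agree by continuity. The velocities agree
  because for \<open>\<tau> > 0\<close> they are determined by the curve on \<open>{0..\<tau>}\<close>. So the agreement continues unless \<open>\<tau> = 1\<close>.
  Uniqueness is what gives the description that defines \<open>rexp\<close> its value.\<close>

theorem geodesic_unique:
  assumes "geodesic_from M p v \<gamma>1" "geodesic_from M p v \<gamma>2" "t \<in> {0..1}"
  shows "\<gamma>1 t = \<gamma>2 t"
proof -
  have g1: "geodesic_on M {0..1} \<gamma>1" "\<gamma>1 0 = p" "has_velocity M \<gamma>1 v 0 {0..1}"
    and g2: "geodesic_on M {0..1} \<gamma>2" "\<gamma>2 0 = p" "has_velocity M \<gamma>2 v 0 {0..1}"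
    using assms by (auto simp: geodesic_from_def)
  define A where "A = {t\<in>{0..1}. \<forall>s\<in>{0..t}. \<gamma>1 s = \<gamma>2 s}"
  have A0: "0 \<in> A" using g1 g2 by (auto simp: A_def)
  have bdd: "bdd_above A" by (auto simp: A_def bdd_above_def)
  define \<tau> where "\<tau> = Sup A"
  have tau: "0 \<le> \<tau>" "\<tau> \<le> 1"
  proof -
    show "0 \<le> \<tau>" unfolding \<tau>_def by (rule cSup_upper[OF A0 bdd])
    show "\<tau> \<le> 1" unfolding \<tau>_def
    proof (rule cSup_least)
      show "A \<noteq> {}" using A0 by blast
      show "a \<le> 1" if "a \<in> A" for a using that by (simp add: A_def)
    qed
  qed
  have before: "\<gamma>1 s = \<gamma>2 s" if s: "0 \<le> s" "s < \<tau>" for s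
  proof -
    have "A \<noteq> {}" using A0 by blast
    then obtain a where "a \<in> A" "s < a" using s(2) less_cSup_iff[OF _ bdd] unfolding \<tau>_def by blast
    then show ?thesis using s by (auto simp: A_def)
  qed
  have at: "\<gamma>1 \<tau> = \<gamma>2 \<tau>"
  proof (cases "\<tau> = 0")
    case False
    then have nb: "at \<tau> within {0..<\<tau>} \<noteq> bot" using tau by (simp add: trivial_limit_within islimpt_Ico)
    have "(\<gamma>1 \<longlongrightarrow> \<gamma>1 \<tau>) (at \<tau> within {0..1})" "(\<gamma>2 \<longlongrightarrow> \<gamma>2 \<tau>) (at \<tau> within {0..1})"
      using geodesic_continuous[OF g1(1)] geodesic_continuous[OF g2(1)] tau
      by (auto simp: continuous_on_def)
    then have lim: "(\<gamma>1 \<longlongrightarrow> \<gamma>1 \<tau>) (at \<tau> within {0..<\<tau>})" "(\<gamma>2 \<longlongrightarrow> \<gamma>2 \<tau>) (at \<tau> within {0..<\<tau>})"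
      using tau by (auto elim!: tendsto_within_subset)
    have "\<forall>\<^sub>F s in at \<tau> within {0..<\<tau>}. \<gamma>1 s = \<gamma>2 s"
      unfolding eventually_at_filter by (rule always_eventually) (use before in auto)
    then have "(\<gamma>2 \<longlongrightarrow> \<gamma>1 \<tau>) (at \<tau> within {0..<\<tau>})" using lim(1) tendsto_cong by blast
    then show ?thesis using tendsto_unique[OF nb _ lim(2)] by blast
  qed (use g1 g2 in auto)
  have agree: "\<gamma>1 s = \<gamma>2 s" if "s \<in> {0..\<tau>}" for s
    using before[of s] at that by (cases "s = \<tau>") auto
  have "\<not> \<tau> < 1"
  proof
    assume "\<tau> < 1"
    obtain w where w: "has_velocity M \<gamma>1 w \<tau> {0..1}"
      using geodesic_has_velocity[OF g1(1)] tau by auto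
    have "has_velocity M \<gamma>2 w \<tau> {0..1}"
    proof (cases "\<tau> = 0")
      case True
      then have "w = v" using has_velocity_unique[OF w[unfolded True] g1(3)] by simp
      then show ?thesis using True g2(3) by simp
    next
      case False
      obtain w' where w': "has_velocity M \<gamma>2 w' \<tau> {0..1}"
        using geodesic_has_velocity[OF g2(1)] tau by auto
      let ?c = "chart_at M (\<gamma>1 \<tau>)"
      have "((snd ?c \<circ> \<gamma>1) has_vector_derivative w) (at \<tau> within {0..\<tau>})"
        using w tau unfolding has_velocity_def by (auto elim!: has_vector_derivative_within_subset)
      moreover have "((snd ?c \<circ> \<gamma>2) has_vector_derivative w') (at \<tau> within {0..\<tau>})"
        using w' tau at unfolding has_velocity_def by (auto elim!: has_vector_derivative_within_subset)
      then have "((snd ?c \<circ> \<gamma>1) has_vector_derivative w') (at \<tau> within {0..\<tau>})"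
        by (rule has_vector_derivative_transform[rotated 2]) (use tau agree in auto)
      ultimately have "w = w'" by (rule velocity_unique) (use tau False in auto)
      then show ?thesis using w' by simp
    qed
    from geodesic_continue_agreement[OF g1(1) g2(1) tau(1) \<open>\<tau> < 1\<close> at w this]
    obtain u where u: "u \<in> {\<tau><..1}" "\<forall>s\<in>{\<tau>..u}. \<gamma>1 s = \<gamma>2 s" by blast
    then have "u \<in> A" using agree tau by (force simp: A_def)
    then show False using cSup_upper[OF _ bdd, of u] u by (simp add: \<tau>_def)
  qed
  then show ?thesis using agree tau assms(3) by auto
qed

lemma rexp_eq:
  assumes "geodesic_from M p v \<gamma>"
  shows "rexp M p v = \<gamma> 1"
  unfolding rexp_def
proof (rule the_equality)
  show "\<exists>\<gamma>'. geodesic_from M p v \<gamma>' \<and> \<gamma>' 1 = \<gamma> 1" using assms by blast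
  show "q = \<gamma> 1" if "\<exists>\<gamma>. geodesic_from M p v \<gamma> \<and> \<gamma> 1 = q" for q
    using that geodesic_unique[OF assms, of _ 1] by fastforce
qed

text \<open>With \<open>a = -1\<close>, \<open>b = 1\<close> this reverses a geodesic, with \<open>b = 0\<close> it shortens one.\<close>

lemma geodesic_affine:
  assumes g: "geodesic_on M {0..1} \<gamma>" and \<phi>: "\<And>t. t \<in> {0..1} \<Longrightarrow> a * t + b \<in> {0..1}"
  shows "geodesic_on M {0..1} (\<lambda>t. \<gamma> (a * t + b))"
    and "t \<in> {0..1} \<Longrightarrow> has_velocity M \<gamma> v (a * t + b) {0..1} \<Longrightarrow>
      has_velocity M (\<lambda>t. \<gamma> (a * t + b)) (a *\<^sub>R v) t {0..1}"
proof -
  let ?\<phi> = "\<lambda>t. a * t + b"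
  have sub: "?\<phi> ` {0..1} \<subseteq> {0..1}" using \<phi> by auto
  have chain: "((\<lambda>t. f (?\<phi> t)) has_vector_derivative (a *\<^sub>R f')) (at t within {0..1})"
    if "(f has_vector_derivative f') (at (?\<phi> t) within {0..1})" for f :: "real \<Rightarrow> 'e" and f' t
  proof -
    have "(?\<phi> has_vector_derivative a) (at t within {0..1})"
      by (auto intro!: derivative_eq_intros simp: has_real_derivative_iff_has_vector_derivative[symmetric])
    moreover have "(f has_vector_derivative f') (at (?\<phi> t) within ?\<phi> ` {0..1})"
      using has_vector_derivative_within_subset[OF that sub] .
    ultimately show ?thesis using vector_diff_chain_within[of ?\<phi> a t "{0..1}" f f'] by (simp add: o_def)
  qed
  show "has_velocity M (\<lambda>t. \<gamma> (a * t + b)) (a *\<^sub>R v) t {0..1}"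
    if "t \<in> {0..1}" "has_velocity M \<gamma> v (a * t + b) {0..1}"
    using that chain unfolding has_velocity_def o_def by blast
  show "geodesic_on M {0..1} (\<lambda>t. \<gamma> (a * t + b))"
    unfolding geodesic_on_def
  proof (intro conjI ballI)
    show "continuous_on {0..1} (\<lambda>t. \<gamma> (a * t + b))"
      using continuous_on_compose2[OF geodesic_continuous[OF g], of "{0..1}" ?\<phi>] sub
      by (simp add: continuous_intros)
    fix c assume c: "c \<in> atlas M"
    obtain v where v:
      "\<forall>t\<in>{0..1}. \<gamma> t \<in> fst c \<longrightarrow> ((snd c \<circ> \<gamma>) has_vector_derivative v t) (at t within {0..1})"
      "\<forall>t\<in>{0..1}. \<gamma> t \<in> fst c \<longrightarrow>
         (v has_vector_derivative - christoffel M c (snd c (\<gamma> t)) (v t) (v t)) (at t within {0..1})"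
      by (rule geodesic_chartE[OF g c])
    show "\<exists>v. \<forall>t\<in>{0..1} \<inter> (\<lambda>t. \<gamma> (a * t + b)) -` fst c.
        ((snd c \<circ> (\<lambda>t. \<gamma> (a * t + b))) has_vector_derivative v t) (at t within {0..1}) \<and>
        (v has_vector_derivative - christoffel M c (snd c (\<gamma> (a * t + b))) (v t) (v t)) (at t within {0..1})"
    proof (intro exI[of _ "\<lambda>t. a *\<^sub>R v (?\<phi> t)"] ballI conjI)
      fix t assume t: "t \<in> {0..1} \<inter> (\<lambda>t. \<gamma> (a * t + b)) -` fst c"
      then have in': "?\<phi> t \<in> {0..1}" "\<gamma> (?\<phi> t) \<in> fst c" using \<phi> by auto
      show "((snd c \<circ> (\<lambda>t. \<gamma> (a * t + b))) has_vector_derivative a *\<^sub>R v (?\<phi> t)) (at t within {0..1})"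
        using chain[of "snd c \<circ> \<gamma>"] v(1) in' by (simp add: o_def)
      have "((\<lambda>t. v (?\<phi> t)) has_vector_derivative
          a *\<^sub>R (- christoffel M c (snd c (\<gamma> (?\<phi> t))) (v (?\<phi> t)) (v (?\<phi> t)))) (at t within {0..1})"
        using chain[of v] v(2) in' by blast
      then have "((\<lambda>t. a *\<^sub>R v (?\<phi> t)) has_vector_derivative
          a *\<^sub>R (a *\<^sub>R (- christoffel M c (snd c (\<gamma> (?\<phi> t))) (v (?\<phi> t)) (v (?\<phi> t))))) (at t within {0..1})"
        by (rule bounded_linear.has_vector_derivative[OF bounded_linear_scaleR_right])
      moreover have "snd c (\<gamma> (?\<phi> t)) \<in> snd c ` fst c" using in' by blast
      ultimately show "((\<lambda>t. a *\<^sub>R v (?\<phi> t)) has_vector_derivative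
          - christoffel M c (snd c (\<gamma> (a * t + b))) (a *\<^sub>R v (?\<phi> t)) (a *\<^sub>R v (?\<phi> t))) (at t within {0..1})"
        using christoffel_scale[OF c] by (simp add: power2_eq_square)
    qed
  qed
qed

lemma geodesic_from_scaled:
  assumes "geodesic_from M p v \<gamma>" "h \<in> {0..1}"
  shows "geodesic_from M p (h *\<^sub>R v) (\<lambda>t. \<gamma> (h * t + 0))"
proof -
  have g: "geodesic_on M {0..1} \<gamma>" "\<gamma> 0 = p" "has_velocity M \<gamma> v 0 {0..1}"
    using assms(1) by (auto simp: geodesic_from_def)
  have *: "h * t + 0 \<in> {0..1}" if "t \<in> {0..1}" for t
    using that assms(2) by (auto intro: mult_le_one)
  show ?thesis
    using geodesic_affine(1)[OF g(1) *] geodesic_affine(2)[OF g(1) *, of 0 v] g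
    by (simp add: geodesic_from_def)
qed

lemma rexp_scaled:
  assumes "geodesic_from M p v \<gamma>" "h \<in> {0..1}"
  shows "rexp M p (h *\<^sub>R v) = \<gamma> h"
  using rexp_eq[OF geodesic_from_scaled[OF assms]] by simp

subsection \<open>Geodesics have constant speed\<close>

text \<open>In a chart with Gram matrix \<open>G\<close>, \<open>(d/dt) \<langle>v, v\<rangle> = (\<partial>\<^sub>v G)(v, v) - 2 \<langle>\<Gamma>(v, v), v\<rangle>\<close>, and the Koszul formula gives
  \<open>2 \<langle>\<Gamma>(v, v), v\<rangle> = (\<partial>\<^sub>v G)(v, v)\<close>.\<close>

lemma speed_has_derivative_zero:
  assumes g: "geodesic_on M {0..1} \<gamma>" and V: "\<And>t. t \<in> {0..1} \<Longrightarrow> has_velocity M \<gamma> (V t) t {0..1}"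
    and t: "t \<in> {0..1}"
  shows "((\<lambda>s. metric M (\<gamma> s) (V s) (V s)) has_derivative (\<lambda>h. 0)) (at t within {0..1})"
proof -
  define c where "c = chart_at M (\<gamma> t)"
  have c: "c \<in> atlas M" "\<gamma> t \<in> fst c" using chart_at by (auto simp: c_def)
  obtain v where v:
    "\<forall>t\<in>{0..1}. \<gamma> t \<in> fst c \<longrightarrow> ((snd c \<circ> \<gamma>) has_vector_derivative v t) (at t within {0..1})"
    "\<forall>t\<in>{0..1}. \<gamma> t \<in> fst c \<longrightarrow>
       (v has_vector_derivative - christoffel M c (snd c (\<gamma> t)) (v t) (v t)) (at t within {0..1})"
    by (rule geodesic_chartE[OF g c(1)])
  obtain e where e: "e > 0" "\<forall>s\<in>{0..1}. \<bar>s - t\<bar> < e \<longrightarrow> \<gamma> s \<in> fst c"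
    using stays_in_chart[OF geodesic_continuous[OF g] t c] by blast
  define x where "x = snd c (\<gamma> t)"
  have x: "x \<in> snd c ` fst c" using c by (auto simp: x_def)
  define a where "a = - christoffel M c x (v t) (v t)"
  define q where "q s = (\<Sum>i\<in>Basis. \<Sum>j\<in>Basis. ((v s \<bullet> i) * (v s \<bullet> j)) * chart_metric M c ((snd c \<circ> \<gamma>) s) i j)" for s
  have eq: "metric M (\<gamma> s) (V s) (V s) = q s" if s: "s \<in> {0..1}" "\<gamma> s \<in> fst c" for s
  proof -
    have "has_velocity M \<gamma> (from_chart M c (\<gamma> s) (v s)) s {0..1}"
      using has_velocity_in_chart(2)[OF geodesic_continuous[OF g] s(1) c(1) s(2)] v(1) s by blast
    then have "V s = from_chart M c (\<gamma> s) (v s)" using has_velocity_unique[OF V] s by blast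
    then have "metric M (\<gamma> s) (V s) (V s) = chart_metric M c (snd c (\<gamma> s)) (v s) (v s)"
      by (simp add: chart_metric_eq_metric[OF c(1) s(2)])
    also have "\<dots> = q s"
      unfolding q_def o_def
      by (rule bilinear_expand) (use chart_metric_inner(1)[OF c(1)] s in blast)
    finally show ?thesis .
  qed
  have dv: "(v has_derivative (\<lambda>h. h *\<^sub>R a)) (at t within {0..1})"
    and dx: "((snd c \<circ> \<gamma>) has_derivative (\<lambda>h. h *\<^sub>R v t)) (at t within {0..1})"
    using v c t by (auto simp: a_def x_def has_vector_derivative_def)
  have dG: "((\<lambda>s. chart_metric M c ((snd c \<circ> \<gamma>) s) i j) has_derivative
      (\<lambda>h. dmetric c i j x (h *\<^sub>R v t))) (at t within {0..1})" for i j
    using has_derivative_compose[OF dx, of "\<lambda>x. chart_metric M c x i j" "dmetric c i j x"]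
      dmetric[OF c(1) x, of i j] by (simp add: x_def)
  have dvi: "((\<lambda>s. v s \<bullet> i) has_derivative (\<lambda>h. h *\<^sub>R a \<bullet> i)) (at t within {0..1})" for i
    by (rule has_derivative_inner_left[OF dv])
  have "(q has_derivative (\<lambda>h. \<Sum>i\<in>Basis. \<Sum>j\<in>Basis.
      (v t \<bullet> i) * (v t \<bullet> j) * dmetric c i j x (h *\<^sub>R v t) +
      ((v t \<bullet> i) * (h *\<^sub>R a \<bullet> j) + (h *\<^sub>R a \<bullet> i) * (v t \<bullet> j)) * chart_metric M c ((snd c \<circ> \<gamma>) t) i j)) (at t within {0..1})"
    unfolding q_def[abs_def]
    by (intro has_derivative_sum has_derivative_mult dvi dG)
  moreover have "(\<Sum>i\<in>Basis. \<Sum>j\<in>Basis.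
      (v t \<bullet> i) * (v t \<bullet> j) * dmetric c i j x (h *\<^sub>R v t) +
      ((v t \<bullet> i) * (h *\<^sub>R a \<bullet> j) + (h *\<^sub>R a \<bullet> i) * (v t \<bullet> j)) * chart_metric M c ((snd c \<circ> \<gamma>) t) i j) = 0" for h
  proof -
    note bil = chart_metric_inner(1)[OF c(1) x]
    have lin: "linear (\<lambda>u. chart_metric M c x u z)" for z using bil by (auto simp: bilinear_def)
    have "(\<Sum>i\<in>Basis. \<Sum>j\<in>Basis.
      (v t \<bullet> i) * (v t \<bullet> j) * dmetric c i j x (h *\<^sub>R v t) +
      ((v t \<bullet> i) * (h *\<^sub>R a \<bullet> j) + (h *\<^sub>R a \<bullet> i) * (v t \<bullet> j)) * chart_metric M c ((snd c \<circ> \<gamma>) t) i j)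
      = (\<Sum>i\<in>Basis. \<Sum>j\<in>Basis. (v t \<bullet> i) * (v t \<bullet> j) * dmetric c i j x (h *\<^sub>R v t))
      + (\<Sum>i\<in>Basis. \<Sum>j\<in>Basis. (v t \<bullet> i) * (h *\<^sub>R a \<bullet> j) * chart_metric M c x i j)
      + (\<Sum>i\<in>Basis. \<Sum>j\<in>Basis. (h *\<^sub>R a \<bullet> i) * (v t \<bullet> j) * chart_metric M c x i j)"
      by (simp add: x_def sum.distrib distrib_right)
    also have "\<dots> = dmetric c (v t) (v t) x (h *\<^sub>R v t)
        + chart_metric M c x (v t) (h *\<^sub>R a) + chart_metric M c x (h *\<^sub>R a) (v t)"
      by (simp only: dmetric_expand[OF c(1) x, of "v t" "v t"] bilinear_expand[OF bil, of "v t" "h *\<^sub>R a"]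
        bilinear_expand[OF bil, of "h *\<^sub>R a" "v t"])
    also have "\<dots> = h * (dmetric c (v t) (v t) x (v t) + 2 * chart_metric M c x a (v t))"
      by (simp add: chart_metric_inner(2)[OF c(1) x, of "v t" "h *\<^sub>R a"] linear_scale[OF lin]
        linear_scale[OF dmetric_linear(1)[OF c(1) x]] algebra_simps)
    also have "2 * chart_metric M c x a (v t) = - koszul c x (v t) (v t) (v t)"
      using christoffel(1)[OF c(1) x, of "v t" "v t" "v t"]
      by (simp add: a_def linear_neg[OF lin])
    finally show ?thesis by (simp add: koszul_def)
  qed
  ultimately have dq: "(q has_derivative (\<lambda>h. 0)) (at t within {0..1})" by simp
  show ?thesis
  proof (rule has_derivative_transform_within[OF dq e(1) t])
    show "q s = metric M (\<gamma> s) (V s) (V s)" if "s \<in> {0..1}" "dist s t < e" for s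
      using eq[OF that(1)] e(2) that by (simp add: dist_real_def)
  qed
qed

lemma geodesic_constant_speed:
  assumes "geodesic_on M {0..1} \<gamma>" "has_velocity M \<gamma> v s {0..1}" "s \<in> {0..1}"
    "has_velocity M \<gamma> w t {0..1}" "t \<in> {0..1}"
  shows "norm_at M (\<gamma> s) v = norm_at M (\<gamma> t) w"
proof -
  obtain V where V: "\<forall>t\<in>{0..1}. has_velocity M \<gamma> (V t) t {0..1}"
    using geodesic_has_velocity[OF assms(1)] by metis
  have "metric M (\<gamma> s) (V s) (V s) = metric M (\<gamma> t) (V t) (V t)"
    using has_derivative_zero_unique[OF convex_real_interval(5), of 0 1 "\<lambda>s. metric M (\<gamma> s) (V s) (V s)" s t]
      speed_has_derivative_zero[OF assms(1)] V assms by blast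
  moreover have "V s = v" "V t = w" using has_velocity_unique V assms by blast+
  ultimately show ?thesis by (simp add: norm_at_def)
qed

lemma geodesic_length:
  assumes g: "geodesic_from M p v \<gamma>"
  shows "curve_length M \<gamma> = norm_at M p v"
proof -
  have g': "geodesic_on M {0..1} \<gamma>" "\<gamma> 0 = p" "has_velocity M \<gamma> v 0 {0..1}"
    using g by (auto simp: geodesic_from_def)
  have "norm_at M (\<gamma> t) (vector_derivative (snd (chart_at M (\<gamma> t)) \<circ> \<gamma>) (at t)) = norm_at M p v"
    if t: "t \<in> {0..1} - {0, 1}" for t
  proof -
    obtain w where w: "has_velocity M \<gamma> w t {0..1}"
      using geodesic_has_velocity[OF g'(1)] t by auto
    have "at t within {0..1} = at t" using t by (intro at_within_interior) auto
    then have "vector_derivative (snd (chart_at M (\<gamma> t)) \<circ> \<gamma>) (at t) = w"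
      using w vector_derivative_at unfolding has_velocity_def by metis
    then show ?thesis
      using geodesic_constant_speed[OF g'(1) g'(3) _ w] t g'(2) by auto
  qed
  then have "curve_length M \<gamma> = integral {0..1} (\<lambda>t::real. norm_at M p v)"
    unfolding curve_length_def by (intro integral_spike[of "{0, 1}"]) auto
  then show ?thesis by simp
qed

end

section \<open>The logarithm on a geodesically convex set of small diameter\<close>

context riemannian_mfd
begin

lemma exp_diffeo_ballE:
  assumes "ereal a < inj_radius M p"
  obtains r where "a < r" "0 < r" "exp_diffeo_on M p {v. norm_at M p v < r}"
proof -
  obtain e where "ereal a < e" "e \<in> {ereal r | r. 0 < r \<and> exp_diffeo_on M p {v. norm_at M p v < r}}"
    using assms unfolding inj_radius_def less_Sup_iff by blast
  then show ?thesis using that by auto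
qed

text \<open>Two vectors shorter than the injectivity radius lie in one ball on which \<open>exp\<^sub>p\<close> is injective.\<close>

lemma rlog_rexp:
  assumes "ereal (norm_at M p v) < inj_radius M p"
  shows "rlog M p (rexp M p v) = v"
  unfolding rlog_def
proof (rule the_equality)
  fix w assume w: "ereal (norm_at M p w) < inj_radius M p \<and> rexp M p w = rexp M p v"
  define a where "a = max (norm_at M p w) (norm_at M p v)"
  have "ereal a < inj_radius M p" using w assms by (auto simp: a_def max_def)
  then obtain r where r: "a < r" "0 < r" "exp_diffeo_on M p {v. norm_at M p v < r}"
    by (rule exp_diffeo_ballE)
  then have "inj_on (rexp M p) {v. norm_at M p v < r}" by (simp add: exp_diffeo_on_def)
  then show "w = v" using w r(1) unfolding inj_on_def a_def by auto
qed (use assms in simp)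

end

locale log_domain = riemannian_mfd M
  for M :: "('m::{t2_space,second_countable_topology}, 'e::euclidean_space) riemannian" +
  fixes X :: "'m set" and D :: real
  assumes X_convex: "geodesically_convex M X"
    and D_pos: "D > 0"
    and diameter: "p \<in> X \<Longrightarrow> q \<in> X \<Longrightarrow> rdist M p q \<le> D"
    and below_inj: "p \<in> X \<Longrightarrow> ereal D < inj_radius M p"
begin

lemma rlog_rexp_le: "p \<in> X \<Longrightarrow> norm_at M p v \<le> D \<Longrightarrow> rlog M p (rexp M p v) = v"
  using below_inj[of p] by (intro rlog_rexp) (meson ereal_less_eq(3) order.strict_trans1)

text \<open>The initial velocity of a minimising geodesic has norm \<open>d(p, q) \<le> D\<close>, which is below the injectivity radius, so it is
  the logarithm. Hence \<open>\<bar>log\<^sub>p q\<bar> = d(p, q)\<close>.\<close>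

lemma log_geodesicE:
  assumes "p \<in> X" "q \<in> X"
  obtains \<gamma> where "geodesic_from M p (rlog M p q) \<gamma>" "\<gamma> 1 = q" "\<gamma> ` {0..1} \<subseteq> X"
    "norm_at M p (rlog M p q) = rdist M p q"
proof -
  obtain \<gamma> where \<gamma>: "minimizing_geodesic M \<gamma> p q" "\<gamma> ` {0..1} \<subseteq> X"
    using X_convex assms unfolding geodesically_convex_def by blast
  then have g: "geodesic_on M {0..1} \<gamma>" "\<gamma> 0 = p" "\<gamma> 1 = q" "curve_length M \<gamma> = rdist M p q"
    by (auto simp: minimizing_geodesic_def)
  obtain v where "has_velocity M \<gamma> v 0 {0..1}"
    using geodesic_has_velocity[OF g(1), of 0] by auto
  then have gf: "geodesic_from M p v \<gamma>" using g by (simp add: geodesic_from_def)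
  have len: "norm_at M p v = rdist M p q" using geodesic_length[OF gf] g by simp
  have "rlog M p (rexp M p v) = v" using rlog_rexp_le assms diameter len by simp
  then have "rlog M p q = v" using rexp_eq[OF gf] g by simp
  then show ?thesis using that gf g \<gamma> len by blast
qed

lemma norm_rlog: "p \<in> X \<Longrightarrow> q \<in> X \<Longrightarrow> norm_at M p (rlog M p q) = rdist M p q"
  by (rule log_geodesicE)

lemma rexp_rlog: "p \<in> X \<Longrightarrow> q \<in> X \<Longrightarrow> rexp M p (rlog M p q) = q"
  by (metis log_geodesicE rexp_eq)

lemma rdist_nonneg: "p \<in> X \<Longrightarrow> q \<in> X \<Longrightarrow> rdist M p q \<ge> 0"
  using norm_rlog[of p q] norm_at_nonneg[of p "rlog M p q"] by simp

text \<open>The points at fraction \<open>h\<close> of the geodesics in \<open>X\<close>: the directions in which a point of \<open>X\<close> can be moved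
  even if it lies on the boundary.\<close>

lemma rexp_scaled_rlog:
  assumes "p \<in> X" "q \<in> X" "h \<in> {0..1}"
  shows "rexp M p (h *\<^sub>R rlog M p q) \<in> X"
    and "rlog M p (rexp M p (h *\<^sub>R rlog M p q)) = h *\<^sub>R rlog M p q"
proof -
  obtain \<gamma> where g: "geodesic_from M p (rlog M p q) \<gamma>" "\<gamma> ` {0..1} \<subseteq> X"
    using log_geodesicE[OF assms(1,2)] by metis
  show "rexp M p (h *\<^sub>R rlog M p q) \<in> X" using rexp_scaled[OF g(1) assms(3)] g(2) assms(3) by auto
  have "h * rdist M p q \<le> 1 * D"
    using assms diameter rdist_nonneg by (intro mult_mono) auto
  then show "rlog M p (rexp M p (h *\<^sub>R rlog M p q)) = h *\<^sub>R rlog M p q"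
    using assms by (intro rlog_rexp_le) (auto simp: norm_at_scaleR norm_rlog)
qed

lemma rdist_self:
  assumes p: "p \<in> X"
  shows "rdist M p p = 0"
proof -
  obtain \<gamma> where g: "geodesic_from M p (rlog M p p) \<gamma>" by (rule log_geodesicE[OF p p])
  have "rexp M p (0 *\<^sub>R rlog M p p) = p"
    using rexp_scaled[OF g, of 0] g by (simp add: geodesic_from_def)
  then have "rlog M p p = 0" using rexp_scaled_rlog(2)[OF p p, of 0] by simp
  then show ?thesis using norm_rlog[OF p p] by (simp add: norm_at_def metric_simps)
qed

text \<open>The reversed geodesic runs from \<open>q\<close> to \<open>p\<close> with the same constant speed.\<close>

lemma rlog_reversed:
  assumes "p \<in> X" "q \<in> X" "geodesic_from M p (rlog M p q) \<gamma>" "has_velocity M \<gamma> w 1 {0..1}"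
  shows "rlog M q p = - w" and "norm_at M q w = rdist M p q"
proof -
  have g: "geodesic_on M {0..1} \<gamma>" "\<gamma> 0 = p" "has_velocity M \<gamma> (rlog M p q) 0 {0..1}"
    using assms(3) by (auto simp: geodesic_from_def)
  have q: "\<gamma> 1 = q" using rexp_eq[OF assms(3)] rexp_rlog[OF assms(1,2)] by simp
  have *: "(-1) * t + 1 \<in> {0..1}" if "t \<in> {0..1::real}" for t using that by auto
  have rev: "geodesic_from M q ((-1) *\<^sub>R w) (\<lambda>t. \<gamma> ((-1) * t + 1))"
    using geodesic_affine(1)[OF g(1) *] geodesic_affine(2)[OF g(1) *, of 0 w] assms(4) q
    by (simp add: geodesic_from_def)
  show nw: "norm_at M q w = rdist M p q"
    using geodesic_constant_speed[OF g(1,3) _ assms(4)] g(2) q norm_rlog[OF assms(1,2)] by simp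
  have "rlog M q (rexp M q ((-1) *\<^sub>R w)) = (-1) *\<^sub>R w"
    using nw diameter assms by (intro rlog_rexp_le) (simp_all only: norm_at_scaleR, simp)
  then show "rlog M q p = - w" using rexp_eq[OF rev] g by simp
qed

lemma rdist_sym:
  assumes "p \<in> X" "q \<in> X"
  shows "rdist M p q = rdist M q p"
proof -
  obtain \<gamma> where g: "geodesic_from M p (rlog M p q) \<gamma>"
    using log_geodesicE[OF assms] by metis
  then obtain w where w: "has_velocity M \<gamma> w 1 {0..1}"
    using geodesic_has_velocity[of "{0..1}" \<gamma> 1] by (auto simp: geodesic_from_def)
  have "norm_at M q (rlog M q p) = norm_at M q w"
    using rlog_reversed(1)[OF assms g w] norm_at_scaleR[of q "-1" w] by simp
  then show ?thesis using rlog_reversed(2)[OF assms g w] norm_rlog assms by simp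
qed

text \<open>The open ball on which \<open>exp\<^sub>p\<close> inverts smoothly covers \<open>X\<close>, and there the inverse is \<open>log\<^sub>p\<close>.\<close>

lemma exp_ballE:
  assumes p: "p \<in> X"
  obtains B where "exp_diffeo_on M p B" "\<forall>q\<in>X. rlog M p q \<in> B"
    "continuous_on X (\<lambda>q. rlog M p q)"
proof -
  obtain r where r: "D < r" "exp_diffeo_on M p {v. norm_at M p v < r}"
    using exp_diffeo_ballE[OF below_inj[OF p]] by metis
  define B where "B = {v. norm_at M p v < r}"
  have dif: "exp_diffeo_on M p B" using r by (simp add: B_def)
  have B: "rlog M p q \<in> B" if "q \<in> X" for q
    using diameter[OF p that] r(1) norm_rlog[OF p that] by (simp add: B_def)
  define L where "L = inv_into B (rexp M p)"
  have L: "L q = rlog M p q" if "q \<in> X" for q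
    using inv_into_f_f[of "rexp M p" B "rlog M p q"] dif B[OF that] rexp_rlog[OF p that]
    by (simp add: L_def exp_diffeo_on_def)
  let ?O = "rexp M p ` B"
  have O: "open ?O" using dif by (simp add: exp_diffeo_on_def)
  have XO: "X \<subseteq> ?O"
  proof
    fix q assume "q \<in> X"
    then show "q \<in> ?O" using B rexp_rlog[OF p] by (metis imageI)
  qed
  have "isCont L q" if q: "q \<in> ?O" for q
  proof -
    define c where "c = chart_at M q"
    have c: "c \<in> atlas M" "q \<in> fst c" using chart_at by (auto simp: c_def)
    have op: "open (fst c \<inter> ?O)" using O chart_open(1)[OF c(1)] by auto
    have "Ck_on 0 (snd c ` (fst c \<inter> ?O)) (L \<circ> chart_inv c)"
      using dif c(1) unfolding exp_diffeo_on_def smooth_on_def L_def by blast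
    then have 1: "continuous_on (snd c ` (fst c \<inter> ?O)) (L \<circ> chart_inv c)" by simp
    have 2: "continuous_on (fst c \<inter> ?O) (snd c)"
      using chart_open(3)[OF c(1)] continuous_on_subset by blast
    have "continuous_on (fst c \<inter> ?O) ((L \<circ> chart_inv c) \<circ> snd c)"
      by (rule continuous_on_compose[OF 2 1])
    then have "continuous_on (fst c \<inter> ?O) L"
      by (rule continuous_on_eq) (simp add: chart_open(4)[OF c(1)])
    then show "isCont L q" using continuous_on_eq_continuous_at[OF op] c(2) q by blast
  qed
  then have "continuous_on X L" using XO by (intro continuous_at_imp_continuous_on) blast
  then have "continuous_on X (\<lambda>q. rlog M p q)" by (rule continuous_on_eq) (rule L)
  with dif B show ?thesis using that by blast
qed

lemma rdist_continuous:
  assumes "p \<in> X"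
  shows "continuous_on X (rdist M p)"
proof -
  have "continuous_on X (\<lambda>q. rlog M p q)" using exp_ballE[OF assms] by metis
  then have "continuous_on X (\<lambda>q. sqrt (metric M p (rlog M p q) (rlog M p q)))"
    using continuous_on_compose2[OF metric_continuous] by (intro continuous_on_real_sqrt) auto
  then show ?thesis
    by (rule continuous_on_eq) (use norm_rlog[OF assms] in \<open>simp add: norm_at_def\<close>)
qed

text \<open>By reversal, \<open>log\<^sub>p q = - d(exp\<^sub>q)\<^sub>u(u)\<close> with \<open>u = log\<^sub>q p\<close>. This reduces the dependence of the logarithm on its base
  point to the smoothness of the single map \<open>exp\<^sub>q\<close> and of its inverse.\<close>

lemma rlog_field_continuous:
  assumes q: "q \<in> X"
  shows "continuous_field_on M X (\<lambda>p. rlog M p q)"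
  unfolding continuous_field_on_def
proof
  fix c assume c: "c \<in> atlas M"
  obtain B where B: "exp_diffeo_on M q B" "\<forall>p\<in>X. rlog M q p \<in> B"
    and cont: "continuous_on X (\<lambda>p. rlog M q p)" using exp_ballE[OF q] by blast
  define N where "N = B \<inter> rexp M q -` fst c"
  have "Ck_on (Suc 0) N (snd c \<circ> rexp M q)"
    using B(1) c unfolding exp_diffeo_on_def smooth_on_def N_def by blast
  then obtain f' where f': "\<forall>u\<in>N. ((snd c \<circ> rexp M q) has_derivative f' u) (at u)"
    "\<forall>v. continuous_on N (\<lambda>u. f' u v)" by auto
  have inN: "rlog M q p \<in> N" if "p \<in> X \<inter> fst c" for p
    using that B(2) rexp_rlog[OF q] by (auto simp: N_def)
  have "continuous_on (X \<inter> fst c) (\<lambda>p. \<Sum>b\<in>Basis. (rlog M q p \<bullet> b) *\<^sub>R f' (rlog M q p) b)"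
  proof (intro continuous_on_sum continuous_on_scaleR continuous_on_inner continuous_on_const)
    show 1: "continuous_on (X \<inter> fst c) (\<lambda>p. rlog M q p)" using cont continuous_on_subset by blast
    show "continuous_on (X \<inter> fst c) (\<lambda>p. f' (rlog M q p) b)" for b
      by (rule continuous_on_compose2[OF _ 1]) (use f'(2) inN in auto)
  qed
  then have "continuous_on (X \<inter> fst c) (\<lambda>p. - (\<Sum>b\<in>Basis. (rlog M q p \<bullet> b) *\<^sub>R f' (rlog M q p) b))"
    by (rule continuous_on_minus)
  then show "continuous_on (X \<inter> fst c) (\<lambda>p. to_chart M c p (rlog M p q))"
  proof (rule continuous_on_eq)
    fix p assume p: "p \<in> X \<inter> fst c"
    define u where "u = rlog M q p"
    obtain \<gamma> where g: "geodesic_from M q u \<gamma>" "\<gamma> 1 = p"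
      using log_geodesicE[OF q, of p] p unfolding u_def by blast
    have go: "geodesic_on M {0..1} \<gamma>" using g by (simp add: geodesic_from_def)
    then obtain w where w: "has_velocity M \<gamma> w 1 {0..1}"
      using geodesic_has_velocity[of "{0..1}" \<gamma> 1] by auto
    have "((snd c \<circ> \<gamma>) has_vector_derivative to_chart M c p w) (at 1 within {0..1})"
      using has_velocity_in_chart(1)[OF geodesic_continuous[OF go] _ c _ w] g(2) p by simp
    moreover have "((snd c \<circ> \<gamma>) has_vector_derivative f' u u) (at 1 within {0..1})"
    proof -
      have uN: "u \<in> N" using inN p by (simp add: u_def)
      then have "((snd c \<circ> rexp M q) has_derivative f' u) (at ((\<lambda>t::real. t *\<^sub>R u) 1) within (\<lambda>t. t *\<^sub>R u) ` {0..1})"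
        using f'(1) by (auto intro: has_derivative_at_withinI)
      moreover have "((\<lambda>t::real. t *\<^sub>R u) has_derivative (\<lambda>t. t *\<^sub>R u)) (at 1 within {0..1})"
        by (auto intro!: derivative_eq_intros)
      ultimately have "((snd c \<circ> rexp M q) \<circ> (\<lambda>t. t *\<^sub>R u) has_derivative f' u \<circ> (\<lambda>t. t *\<^sub>R u)) (at 1 within {0..1})"
        by (rule diff_chain_within[rotated])
      moreover have "f' u \<circ> (\<lambda>t. t *\<^sub>R u) = (\<lambda>t. t *\<^sub>R f' u u)"
        using has_derivative_linear f'(1) uN linear_scale by fastforce
      ultimately have "((snd c \<circ> rexp M q) \<circ> (\<lambda>t. t *\<^sub>R u) has_vector_derivative f' u u) (at 1 within {0..1})"
        by (simp add: has_vector_derivative_def)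
      then show ?thesis
        by (rule has_vector_derivative_transform[rotated 2]) (use rexp_scaled[OF g(1)] in auto)
    qed
    ultimately have vel: "to_chart M c p w = f' u u" by (rule velocity_unique) auto
    have "u \<in> N" using inN[OF p] by (simp add: u_def)
    with f'(1) have linf: "linear (f' u)" using has_derivative_linear by blast
    have "f' u u = f' u (\<Sum>b\<in>Basis. (u \<bullet> b) *\<^sub>R b)" by (simp add: euclidean_representation)
    also have "\<dots> = (\<Sum>b\<in>Basis. (u \<bullet> b) *\<^sub>R f' u b)"
      by (simp add: linear_sum[OF linf] linear_scale[OF linf])
    finally have "- (\<Sum>b\<in>Basis. (u \<bullet> b) *\<^sub>R f' u b) = to_chart M c p (- w)"
      using vel p by (simp add: linear_neg[OF to_chart_linear[OF c]])
    also have "- w = rlog M p q"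
      using rlog_reversed(1)[OF q _ g(1)[unfolded u_def] w] p by simp
    finally show "- (\<Sum>b\<in>Basis. (rlog M q p \<bullet> b) *\<^sub>R f' (rlog M q p) b) = to_chart M c p (rlog M p q)"
      by (simp add: u_def)
  qed
qed

end

section \<open>The spectral gap of the mixing matrix\<close>

lemma inner_gram_matrix:
  fixes A :: "real^'n^'n"
  shows "((transpose A ** A) *v v) \<bullet> w = (A *v v) \<bullet> (A *v w)"
proof -
  have "(transpose A ** A) *v v = transpose A *v (A *v v)" by (simp add: matrix_vector_mul_assoc)
  also have "\<dots> = (A *v v) v* A" by (rule transpose_matrix_vector)
  finally show ?thesis by (simp add: dot_lmul_matrix)
qed

lemma subspace_singular_space: "subspace (singular_space A s)"
  by (auto simp: singular_space_def subspace_def matrix_vector_right_distrib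
      matrix_vector_mult_scaleR scaleR_add_right scaleR_left_commute)

text \<open>Eigenvectors for different eigenvalues of the symmetric matrix \<open>A\<^sup>T A\<close> are orthogonal. A sum over an infinite set would be
  \<open>0\<close>, so finiteness is what makes the multiset of singular values the intended one.\<close>

lemma finite_singular_values:
  fixes A :: "real^'n^'n"
  shows "finite {s. 0 \<le> s \<and> singular_space A s \<noteq> {0}}"
proof -
  let ?S = "{s. 0 \<le> s \<and> singular_space A s \<noteq> {0}}"
  have "\<exists>v. v \<in> singular_space A s \<and> v \<noteq> 0" if "s \<in> ?S" for s
    using that subspace_0[OF subspace_singular_space, of A s] by blast
  then obtain v where v: "\<And>s. s \<in> ?S \<Longrightarrow> v s \<in> singular_space A s \<and> v s \<noteq> 0" by metis
  have orth: "v s \<bullet> v t = 0" if "s \<in> ?S" "t \<in> ?S" "s \<noteq> t" for s t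
  proof -
    have s: "(transpose A ** A) *v v s = s\<^sup>2 *\<^sub>R v s" and t: "(transpose A ** A) *v v t = t\<^sup>2 *\<^sub>R v t"
      using v[OF that(1)] v[OF that(2)] by (auto simp: singular_space_def)
    have "s\<^sup>2 * (v s \<bullet> v t) = (A *v v s) \<bullet> (A *v v t)" using inner_gram_matrix[of A "v s" "v t"] s by simp
    also have "\<dots> = t\<^sup>2 * (v s \<bullet> v t)"
      using inner_gram_matrix[of A "v t" "v s"] t by (simp add: inner_commute)
    finally have "(s\<^sup>2 - t\<^sup>2) * (v s \<bullet> v t) = 0" by (simp add: algebra_simps)
    moreover have "s\<^sup>2 \<noteq> t\<^sup>2" using that by (auto simp: power2_eq_iff_nonneg)
    ultimately show ?thesis by simp
  qed
  have inj: "inj_on v ?S"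
  proof (rule inj_onI, rule ccontr)
    fix s t assume "s \<in> ?S" "t \<in> ?S" "v s = v t" "s \<noteq> t"
    then show False using orth[of s t] v[of s] by simp
  qed
  have "independent (v ` ?S)"
  proof (rule pairwise_orthogonal_independent)
    show "pairwise orthogonal (v ` ?S)"
      unfolding pairwise_def orthogonal_def using orth by blast
    show "0 \<notin> v ` ?S" using v by force
  qed
  then have "finite (v ` ?S)" by (rule independent_imp_finite)
  then show ?thesis using inj finite_imageD by blast
qed

lemma count_singular_values:
  fixes A :: "real^'n^'n"
  assumes "0 \<le> s" "singular_space A s \<noteq> {0}"
  shows "count (singular_values A) s = dim (singular_space A s)"
proof -
  have "count (singular_values A) s =
      (\<Sum>t\<in>{t. 0 \<le> t \<and> singular_space A t \<noteq> {0}}. if t = s then dim (singular_space A t) else 0)"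
    unfolding singular_values_def count_sum by (rule sum.cong) auto
  then show ?thesis using assms finite_singular_values[of A] by (simp add: sum.delta')
qed

lemma dim_ge_1:
  fixes S :: "(real^'n) set"
  assumes "v \<in> S" "v \<noteq> 0" shows "dim S \<ge> 1"
  using assms dim_eq_0[of S] by (metis One_nat_def Suc_leI gr0I singletonD subsetD)

text \<open>If the second entry were smaller, only the first could be as large as \<open>min a b\<close>; but \<open>a\<close> and \<open>b\<close> both are.\<close>

lemma second_largest_ge:
  fixes S :: "real multiset"
  assumes "{#a, b#} \<subseteq># S"
  shows "size S \<ge> 2" "rev (sorted_list_of_multiset S) ! 1 \<ge> min a b"
proof -
  show size: "size S \<ge> 2" using size_mset_mono[OF assms] by simp
  define l where "l = rev (sorted_list_of_multiset S)"
  have ml: "mset l = S" by (simp add: l_def)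
  have "length l \<ge> 2" using size ml by (metis size_mset)
  then obtain x y l' where l: "l = x # y # l'" by (metis Suc_le_length_iff numeral_2_eq_2)
  have "sorted (rev l)" by (simp add: l_def)
  then have le: "\<forall>z\<in>set l'. z \<le> y" by (auto simp: l sorted_append)
  have "y \<ge> min a b"
  proof (rule ccontr)
    assume "\<not> y \<ge> min a b"
    then have y: "y < min a b" by (simp only: not_le)
    have "filter (\<lambda>z. z \<ge> min a b) (y # l') = []"
      using le y by (fastforce simp: filter_empty_conv)
    then have "length (filter (\<lambda>z. z \<ge> min a b) l) \<le> 1" by (simp add: l)
    then have "size (filter_mset (\<lambda>z. z \<ge> min a b) S) \<le> 1" using ml by (metis mset_filter size_mset)
    moreover have "size (filter_mset (\<lambda>z. z \<ge> min a b) {#a, b#}) \<le> size (filter_mset (\<lambda>z. z \<ge> min a b) S)"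
      by (intro size_mset_mono multiset_filter_mono assms)
    ultimately show False by simp
  qed
  then show "rev (sorted_list_of_multiset S) ! 1 \<ge> min a b" unfolding l_def[symmetric] by (simp add: l)
qed

lemma sigma2_ge:
  assumes "{#a, b#} \<subseteq># singular_values A"
  shows "sigma2 A \<ge> min a b"
proof -
  have "length (rev (sorted_list_of_multiset (singular_values A))) = size (singular_values A)"
    by (metis length_rev mset_sorted_list_of_multiset size_mset)
  then show ?thesis using second_largest_ge[OF assms] by (simp add: sigma2_def Let_def)
qed

lemma sigma2_nonneg: "sigma2 A \<ge> 0"
proof -
  let ?l = "rev (sorted_list_of_multiset (singular_values A))"
  have "s \<ge> 0" if "s \<in># singular_values A" for s
  proof (cases "finite {s. 0 \<le> s \<and> singular_space A s \<noteq> {0}}")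
    case True
    then show ?thesis using that by (auto simp: singular_values_def set_mset_sum split: if_splits)
  qed (use that in \<open>simp add: singular_values_def\<close>)
  moreover have "set ?l = set_mset (singular_values A)" by simp
  ultimately have "?l ! 1 \<ge> 0" if "length ?l \<ge> 2" using that nth_mem[of 1 ?l] by auto
  then show ?thesis by (auto simp: sigma2_def Let_def)
qed

text \<open>On the hyperplane orthogonal to the constants, a unit vector \<open>v\<^sub>0\<close> maximising \<open>\<bar>W v\<bar>\<close> is an eigenvector of \<open>W\<^sup>T W\<close>: the
  form \<open>s\<^sup>2 \<langle>u, w\<rangle> - \<langle>W u, W w\<rangle>\<close> is positive semidefinite there and vanishes at \<open>v\<^sub>0\<close>. So \<open>s\<close> is a singular value besides the
  value \<open>1\<close> of the constants, counted twice if \<open>s = 1\<close>, and the second largest is at least \<open>min 1 s\<close>.\<close>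

lemma mixing_contraction:
  fixes W :: "real^'n^'n"
  assumes W1: "W *v 1 = 1" and W1': "transpose W *v 1 = 1"
    and gap: "sigma2 W < 1" and v: "v \<bullet> 1 = 0"
  shows "norm (W *v v) \<le> sigma2 W * norm v"
proof (cases "v = 0")
  case False
  define S where "S = {v :: real^'n. v \<bullet> 1 = 0}"
  have sub: "subspace S" by (auto simp: S_def subspace_def inner_simps)
  have closed: "closed S" using closed_hyperplane[of "1 :: real^'n" 0] by (simp add: S_def inner_commute)
  have inv: "W *v u \<in> S" if "u \<in> S" for u
  proof -
    have "(W *v u) \<bullet> 1 = u \<bullet> (transpose W *v 1)"
      by (metis dot_lmul_matrix inner_commute transpose_matrix_vector)
    then show ?thesis using that W1' by (simp add: S_def)
  qed
  have vS: "v \<in> S" using v by (simp add: S_def)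
  have "compact (sphere 0 1 \<inter> S)" using closed by (simp add: compact_Int_closed)
  moreover have "(1 / norm v) *\<^sub>R v \<in> sphere 0 1 \<inter> S"
    using False vS subspace_scale[OF sub] by simp
  moreover have "continuous_on (sphere 0 1 \<inter> S) (\<lambda>u. norm (W *v u))"
    by (intro continuous_intros linear_continuous_on matrix_vector_mul_bounded_linear)
  ultimately have "\<exists>v0\<in>sphere 0 1 \<inter> S. \<forall>u\<in>sphere 0 1 \<inter> S. norm (W *v u) \<le> norm (W *v v0)"
    by (intro continuous_attains_sup) blast+
  then obtain v0 where v0: "norm v0 = 1" "v0 \<in> S"
    and max: "\<forall>u\<in>sphere 0 1 \<inter> S. norm (W *v u) \<le> norm (W *v v0)" by auto
  define s where "s = norm (W *v v0)"
  have s: "s \<ge> 0" by (simp add: s_def)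
  have le: "norm (W *v u) \<le> s * norm u" if u: "u \<in> S" for u
  proof (cases "u = 0")
    case False
    then have "(1 / norm u) *\<^sub>R u \<in> sphere 0 1 \<inter> S" using u subspace_scale[OF sub] by simp
    then have "norm (W *v ((1 / norm u) *\<^sub>R u)) \<le> s" using max unfolding s_def by blast
    then show ?thesis using False by (simp add: matrix_vector_mult_scaleR field_simps)
  qed simp
  define b where "b u w = s\<^sup>2 * (u \<bullet> w) - (W *v u) \<bullet> (W *v w)" for u w
  have b0: "b v0 v0 = 0" using v0(1) by (simp add: b_def s_def power2_norm_eq_inner flip: norm_eq_1)
  have bw: "b v0 w = 0" if w: "w \<in> S" for w
  proof (rule ccontr)
    assume nz: "b v0 w \<noteq> 0"
    define t where "t = - (b w w + 1) / (2 * b v0 w)"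
    have "w + t *\<^sub>R v0 \<in> S" using w v0 sub by (simp add: subspace_add subspace_scale)
    from power_mono[OF le[OF this], of 2]
    have "0 \<le> b (w + t *\<^sub>R v0) (w + t *\<^sub>R v0)"
      by (simp add: b_def power_mult_distrib power2_norm_eq_inner)
    also have "\<dots> = b w w + 2 * t * b v0 w + t\<^sup>2 * b v0 v0"
      by (simp add: b_def inner_simps matrix_vector_right_distrib matrix_vector_mult_scaleR
        inner_commute power2_eq_square algebra_simps)
    also have "\<dots> = -1" using nz b0 by (simp add: t_def field_simps)
    finally show False by simp
  qed
  define r where "r = s\<^sup>2 *\<^sub>R v0 - (transpose W ** W) *v v0"
  have rb: "r \<bullet> w = b v0 w" for w by (simp add: r_def b_def inner_simps inner_gram_matrix)
  have "((transpose W ** W) *v v0) \<bullet> 1 = 0"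
    using inv[OF v0(2)] W1 by (simp add: inner_gram_matrix S_def)
  then have "r \<in> S" using v0(2) by (simp add: r_def S_def inner_simps)
  then have "r \<bullet> r = 0" using rb bw by simp
  then have v0s: "v0 \<in> singular_space W s" by (simp add: r_def singular_space_def)
  have one1: "1 \<in> singular_space W 1"
    using W1 W1' by (simp add: singular_space_def flip: matrix_vector_mul_assoc)
  have nz: "v0 \<noteq> 0" "(1 :: real^'n) \<noteq> 0" using v0 by auto
  have c1: "count (singular_values W) 1 = dim (singular_space W 1)"
    using one1 nz(2) by (intro count_singular_values[of 1 W]) (simp, metis singletonD)
  have cs: "count (singular_values W) s = dim (singular_space W s)"
    using v0s nz(1) s by (intro count_singular_values[of s W]) (simp, metis singletonD)
  have "{#1, s#} \<subseteq># singular_values W"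
  proof (cases "s = 1")
    case True
    have "independent {1, v0}"
      using v0(2) nz by (intro pairwise_orthogonal_independent)
        (auto simp: pairwise_def orthogonal_def S_def inner_commute)
    moreover have "{1, v0} \<subseteq> singular_space W 1" using v0s one1 True by simp
    ultimately have "card {1, v0} \<le> dim (singular_space W 1)"
      by (intro independent_card_le_dim)
    moreover have "(1 :: real^'n) \<noteq> v0" using v0 nz by (auto simp: S_def)
    ultimately have "2 \<le> count (singular_values W) 1" using c1 by simp
    then show ?thesis using True by (simp add: subseteq_mset_def)
  next
    case False
    have "1 \<le> count (singular_values W) 1" "1 \<le> count (singular_values W) s"
      using dim_ge_1[OF one1 nz(2)] dim_ge_1[OF v0s nz(1)] c1 cs by simp_all
    then show ?thesis using False by (auto simp: subseteq_mset_def)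
  qed
  then have "min 1 s \<le> sigma2 W" by (rule sigma2_ge)
  then have "s \<le> sigma2 W" using gap by simp
  then show ?thesis using le[OF vS] by (meson mult_right_mono norm_ge_zero order_trans)
qed simp

text \<open>With \<open>v\<close> the deviation of \<open>a\<close> from its mean, the right-hand side is \<open>2 (\<bar>v\<bar>\<^sup>2 - \<langle>v, W v\<rangle>)\<close>.\<close>

lemma dirichlet_form_ge_scalar:
  fixes W :: "real^'n^'n" and a :: "'n \<Rightarrow> real"
  assumes sym: "transpose W = W" and stoch: "\<And>i. (\<Sum>j\<in>UNIV. W $ i $ j) = 1" and gap: "sigma2 W < 1"
  shows "2 * (1 - sigma2 W) * ((\<Sum>i\<in>UNIV. (a i)\<^sup>2) - (\<Sum>i\<in>UNIV. a i)\<^sup>2 / real CARD('n))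
    \<le> (\<Sum>i\<in>UNIV. \<Sum>j\<in>UNIV. W $ i $ j * (a i - a j)\<^sup>2)"
proof -
  define m where "m = (\<Sum>i\<in>UNIV. a i) / real CARD('n)"
  define v :: "real^'n" where "v = (\<chi> i. a i - m)"
  have W1: "W *v 1 = 1" using stoch by (simp add: vec_eq_iff matrix_vector_mult_def)
  have wsym: "W $ i $ j = W $ j $ i" for i j
    using sym by (metis transpose_def vec_lambda_beta)
  have v1: "v \<bullet> 1 = 0" by (simp add: inner_vec_def v_def m_def sum_subtractf)
  have vv: "v \<bullet> v = (\<Sum>i\<in>UNIV. (a i)\<^sup>2) - (\<Sum>i\<in>UNIV. a i)\<^sup>2 / real CARD('n)"
  proof -
    have "v \<bullet> v = (\<Sum>i\<in>UNIV. (a i)\<^sup>2 - (2 * m) * a i + m\<^sup>2)"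
      by (simp add: inner_vec_def v_def power2_eq_square algebra_simps)
    also have "\<dots> = (\<Sum>i\<in>UNIV. (a i)\<^sup>2) - 2 * m * (\<Sum>i\<in>UNIV. a i) + real CARD('n) * m\<^sup>2"
      by (simp only: sum.distrib sum_subtractf sum_distrib_left[symmetric]) simp
    also have "\<dots> = (\<Sum>i\<in>UNIV. (a i)\<^sup>2) - (\<Sum>i\<in>UNIV. a i)\<^sup>2 / real CARD('n)"
      by (simp add: m_def power2_eq_square field_simps)
    finally show ?thesis .
  qed
  have "v \<bullet> (W *v v) \<le> norm v * norm (W *v v)" by (rule norm_cauchy_schwarz)
  also have "\<dots> \<le> norm v * (sigma2 W * norm v)"
    using mixing_contraction[OF W1 _ gap v1] W1 sym by (intro mult_left_mono) auto
  finally have 1: "v \<bullet> (W *v v) \<le> sigma2 W * (v \<bullet> v)"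
    by (simp add: power2_eq_square[symmetric] power2_norm_eq_inner mult.left_commute)
  have 2: "v \<bullet> (W *v v) = (\<Sum>i\<in>UNIV. \<Sum>j\<in>UNIV. W $ i $ j * (v $ i * v $ j))"
    by (simp add: inner_vec_def matrix_vector_mult_def sum_distrib_left algebra_simps)
  have "(\<Sum>i\<in>UNIV. \<Sum>j\<in>UNIV. W $ i $ j * (a i - a j)\<^sup>2) =
      (\<Sum>i\<in>UNIV. \<Sum>j\<in>UNIV. W $ i $ j * (v $ i)\<^sup>2 + W $ i $ j * (v $ j)\<^sup>2 - 2 * (W $ i $ j * (v $ i * v $ j)))"
    by (intro sum.cong refl) (simp add: v_def power2_eq_square algebra_simps)
  also have "\<dots> = (\<Sum>i\<in>UNIV. \<Sum>j\<in>UNIV. W $ i $ j * (v $ i)\<^sup>2) + (\<Sum>i\<in>UNIV. \<Sum>j\<in>UNIV. W $ i $ j * (v $ j)\<^sup>2)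
      - 2 * (v \<bullet> (W *v v))"
    by (simp add: 2 sum.distrib sum_subtractf sum_distrib_left)
  also have "(\<Sum>i\<in>UNIV. \<Sum>j\<in>UNIV. W $ i $ j * (v $ j)\<^sup>2) = (\<Sum>j\<in>UNIV. \<Sum>i\<in>UNIV. W $ j $ i * (v $ j)\<^sup>2)"
    by (subst sum.swap) (simp add: wsym)
  also have "(\<Sum>i\<in>UNIV. \<Sum>j\<in>UNIV. W $ i $ j * (v $ i)\<^sup>2) = v \<bullet> v"
    by (simp add: sum_distrib_right[symmetric] stoch inner_vec_def power2_eq_square)
  finally have "(\<Sum>i\<in>UNIV. \<Sum>j\<in>UNIV. W $ i $ j * (a i - a j)\<^sup>2) = 2 * (v \<bullet> v) - 2 * (v \<bullet> (W *v v))"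
    by simp
  then show ?thesis unfolding vv[symmetric] using 1 by (simp add: algebra_simps)
qed

text \<open>Gram-Schmidt orthonormalisation with respect to \<open>g\<close>.\<close>

lemma orthonormal_expansion:
  fixes g :: "'e::euclidean_space \<Rightarrow> 'e \<Rightarrow> real"
  assumes bil: "bilinear g" and sym: "\<And>u v. g u v = g v u" and pos: "\<And>u. u \<noteq> 0 \<Longrightarrow> g u u > 0"
  shows "\<exists>N. finite N \<and> (\<forall>u v. g u v = (\<Sum>n\<in>N. g u n * g n v))"
proof -
  have lin: "linear (g u)" "linear (\<lambda>u. g u v)" for u v using bil by (auto simp: bilinear_def)
  note g_simps = linear_add[OF lin(1)] linear_add[OF lin(2)] linear_diff[OF lin(1)] linear_diff[OF lin(2)]
    linear_scale[OF lin(1)] linear_scale[OF lin(2)] linear_sum[OF lin(1)] linear_sum[OF lin(2)]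
    linear_0[OF lin(1)] linear_0[OF lin(2)]
  have "\<exists>N. finite N \<and> (\<forall>n\<in>N. \<forall>m\<in>N. g n m = (if n = m then 1 else 0)) \<and>
      (\<forall>u\<in>span B. \<forall>v. g u v = (\<Sum>n\<in>N. g u n * g n v))" if "finite B" for B
    using that
  proof induction
    case empty
    show ?case by (intro exI[of _ "{}"]) (auto simp: g_simps)
  next
    case (insert b B)
    then obtain N where N: "finite N" "\<forall>n\<in>N. \<forall>m\<in>N. g n m = (if n = m then 1 else 0)"
      "\<forall>u\<in>span B. \<forall>v. g u v = (\<Sum>n\<in>N. g u n * g n v)" by blast
    define r where "r = b - (\<Sum>n\<in>N. g b n *\<^sub>R n)"
    have rm: "g r m = 0" if "m \<in> N" for m
    proof -
      have "(\<Sum>n\<in>N. g b n * g n m) = (\<Sum>n\<in>N. if n = m then g b n else 0)"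
        using N(2) that by (intro sum.cong) auto
      then show ?thesis using N(1) that by (simp add: r_def g_simps sum.delta)
    qed
    have gb: "g b v = g r v + (\<Sum>n\<in>N. g b n * g n v)" for v by (simp add: r_def g_simps)
    have ext: "\<forall>u\<in>span (insert b B). \<forall>v. g u v = (\<Sum>n\<in>N'. g u n * g n v)"
      if B: "\<forall>u\<in>span B. \<forall>v. g u v = (\<Sum>n\<in>N'. g u n * g n v)"
        and b: "\<forall>v. g b v = (\<Sum>n\<in>N'. g b n * g n v)" for N'
    proof (intro ballI allI)
      fix u v assume "u \<in> span (insert b B)"
      then obtain k where "u - k *\<^sub>R b \<in> span B" using span_breakdown_eq by blast
      then have "g (u - k *\<^sub>R b) v = (\<Sum>n\<in>N'. g (u - k *\<^sub>R b) n * g n v)" using B by blast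
      then have "g u v = (\<Sum>n\<in>N'. g (u - k *\<^sub>R b) n * g n v) + k * (\<Sum>n\<in>N'. g b n * g n v)"
        using b[rule_format, of v] by (simp add: g_simps)
      also have "\<dots> = (\<Sum>n\<in>N'. g u n * g n v)"
        by (simp add: g_simps sum_distrib_left sum.distrib[symmetric] algebra_simps)
      finally show "g u v = (\<Sum>n\<in>N'. g u n * g n v)" .
    qed
    show ?case
    proof (cases "r = 0")
      case True
      have "g b v = (\<Sum>n\<in>N. g b n * g n v)" for v
        using gb[of v] linear_0[OF lin(2), of v] unfolding True by linarith
      then have "\<forall>v. g b v = (\<Sum>n\<in>N. g b n * g n v)" by blast
      from ext[OF N(3) this] show ?thesis using N(1,2) by blast
    next
      case False
      define k where "k = sqrt (g r r)"
      have k: "k > 0" "k * k = g r r" using pos[OF False] by (auto simp: k_def)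
      define e where "e = (1 / k) *\<^sub>R r"
      have rv: "g r v = k * g e v" for v using k by (simp add: e_def g_simps)
      have em: "g e m = 0" "g m e = 0" if "m \<in> N" for m
        using rm[OF that] sym[of m e] by (simp_all add: e_def g_simps)
      have ee: "g e e = 1" using k pos[OF False] by (simp add: e_def g_simps)
      have "(\<Sum>n\<in>N. g b n * g n e) = 0" using em(1) sym by (intro sum.neutral) simp
      then have re: "g b e = k" using gb[of e] rv[of e] ee by simp
      have eN: "e \<notin> N" using em ee by force
      have "\<forall>u\<in>span B. \<forall>v. g u v = (\<Sum>n\<in>insert e N. g u n * g n v)"
      proof (intro ballI allI)
        fix u v assume u: "u \<in> span B"
        have "g u e = (\<Sum>n\<in>N. g u n * g n e)" using N(3) u by blast
        then have "g u e = 0" using em by simp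
        then show "g u v = (\<Sum>n\<in>insert e N. g u n * g n v)"
          using N(1) eN N(3)[rule_format, OF u, of v] by simp
      qed
      moreover have "g b v = (\<Sum>n\<in>insert e N. g b n * g n v)" for v
        unfolding sum.insert[OF N(1) eN] re using gb[of v] rv[of v] by linarith
      then have "\<forall>v. g b v = (\<Sum>n\<in>insert e N. g b n * g n v)" by blast
      ultimately have "\<forall>u\<in>span (insert b B). \<forall>v. g u v = (\<Sum>n\<in>insert e N. g u n * g n v)"
        by (rule ext)
      moreover have "\<forall>n\<in>insert e N. \<forall>m\<in>insert e N. g n m = (if n = m then 1 else 0)"
        using N(2) em ee eN by auto
      ultimately show ?thesis using N(1) by (intro exI[of _ "insert e N"]) auto
    qed
  qed
  from this[OF finite_Basis] show ?thesis by auto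
qed

text \<open>The scalar inequality, summed over the coordinates in a \<open>g\<close>-orthonormal basis.\<close>

lemma dirichlet_form_ge:
  fixes W :: "real^'n^'n" and g :: "'e::euclidean_space \<Rightarrow> 'e \<Rightarrow> real" and u :: "'n \<Rightarrow> 'e"
  assumes W: "transpose W = W" "\<And>i. (\<Sum>j\<in>UNIV. W $ i $ j) = 1" "sigma2 W < 1"
    and bil: "bilinear g" and sym: "\<And>u v. g u v = g v u" and pos: "\<And>u. u \<noteq> 0 \<Longrightarrow> g u u > 0"
  shows "2 * (1 - sigma2 W) * ((\<Sum>i\<in>UNIV. g (u i) (u i)) - g (\<Sum>i\<in>UNIV. u i) (\<Sum>i\<in>UNIV. u i) / real CARD('n))
    \<le> (\<Sum>i\<in>UNIV. \<Sum>j\<in>UNIV. W $ i $ j * g (u i - u j) (u i - u j))"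
proof -
  obtain N where N: "finite N" "\<forall>u v. g u v = (\<Sum>n\<in>N. g u n * g n v)"
    using orthonormal_expansion[OF bil sym pos] by blast
  have lin: "linear (\<lambda>u. g u v)" for v using bil by (auto simp: bilinear_def)
  have sq: "g v v = (\<Sum>n\<in>N. (g v n)\<^sup>2)" for v
  proof -
    have "g v v = (\<Sum>n\<in>N. g v n * g n v)" using N(2) by blast
    also have "\<dots> = (\<Sum>n\<in>N. (g v n)\<^sup>2)"
      by (intro sum.cong refl) (simp only: power2_eq_square sym[of _ v])
    finally show ?thesis .
  qed
  have "2 * (1 - sigma2 W) * ((\<Sum>i\<in>UNIV. g (u i) (u i)) - g (\<Sum>i\<in>UNIV. u i) (\<Sum>i\<in>UNIV. u i) / real CARD('n))
    = (\<Sum>n\<in>N. 2 * (1 - sigma2 W) * ((\<Sum>i\<in>UNIV. (g (u i) n)\<^sup>2) - (\<Sum>i\<in>UNIV. g (u i) n)\<^sup>2 / real CARD('n)))"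
  proof -
    have "(\<Sum>i\<in>UNIV. g (u i) (u i)) = (\<Sum>n\<in>N. \<Sum>i\<in>UNIV. (g (u i) n)\<^sup>2)"
      unfolding sq by (rule sum.swap)
    moreover have "g (\<Sum>i\<in>UNIV. u i) (\<Sum>i\<in>UNIV. u i) = (\<Sum>n\<in>N. (\<Sum>i\<in>UNIV. g (u i) n)\<^sup>2)"
      unfolding sq linear_sum[OF lin] ..
    ultimately show ?thesis by (simp only: sum_distrib_left sum_divide_distrib sum_subtractf[symmetric])
  qed
  also have "\<dots> \<le> (\<Sum>n\<in>N. \<Sum>i\<in>UNIV. \<Sum>j\<in>UNIV. W $ i $ j * (g (u i) n - g (u j) n)\<^sup>2)"
    by (intro sum_mono dirichlet_form_ge_scalar W)
  also have "\<dots> = (\<Sum>i\<in>UNIV. \<Sum>j\<in>UNIV. W $ i $ j * g (u i - u j) (u i - u j))"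
  proof -
    have "(\<Sum>i\<in>UNIV. \<Sum>j\<in>UNIV. W $ i $ j * g (u i - u j) (u i - u j))
      = (\<Sum>i\<in>UNIV. \<Sum>j\<in>UNIV. \<Sum>n\<in>N. W $ i $ j * (g (u i) n - g (u j) n)\<^sup>2)"
      unfolding sq linear_diff[OF lin] by (simp only: sum_distrib_left)
    also have "\<dots> = (\<Sum>i\<in>UNIV. \<Sum>n\<in>N. \<Sum>j\<in>UNIV. W $ i $ j * (g (u i) n - g (u j) n)\<^sup>2)"
      by (intro sum.cong refl sum.swap)
    also have "\<dots> = (\<Sum>n\<in>N. \<Sum>i\<in>UNIV. \<Sum>j\<in>UNIV. W $ i $ j * (g (u i) n - g (u j) n)\<^sup>2)"
      by (rule sum.swap)
    finally show ?thesis ..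
  qed
  finally show ?thesis .
qed

section \<open>One round of the algorithm along a fixed trajectory\<close>

lemma le_of_le_add_small:
  fixes a b :: real
  assumes "\<And>h. 0 < h \<Longrightarrow> h \<le> 1 \<Longrightarrow> a \<le> b + h * L"
  shows "a \<le> b"
proof (rule field_le_epsilon)
  fix e :: real assume e: "e > 0"
  define h where "h = min 1 (e / (\<bar>L\<bar> + 1))"
  have h: "0 < h" "h \<le> 1" using e by (auto simp: h_def)
  have "h * L \<le> h * (\<bar>L\<bar> + 1)" using h by (intro mult_left_mono) auto
  also have "\<dots> \<le> (e / (\<bar>L\<bar> + 1)) * (\<bar>L\<bar> + 1)" by (intro mult_right_mono) (auto simp: h_def)
  also have "\<dots> = e" by simp
  finally show "a \<le> b + e" using assms[OF h] by simp
qed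

locale mixing_domain = log_domain M X D
  for M :: "('m::{t2_space,second_countable_topology}, 'e::euclidean_space) riemannian" and X D +
  fixes C1 C2 C4 :: real and W :: "real^'n^'n"
  assumes C1: "C1 \<ge> 1" and C2: "0 < C2" "C2 \<le> 1" and C4: "C4 \<ge> 0"
    and comparison_lower: "a \<in> X \<Longrightarrow> b \<in> X \<Longrightarrow> c \<in> X \<Longrightarrow>
          C2 * (rdist M b c)\<^sup>2 + (rdist M a b)\<^sup>2 - 2 * metric M b (rlog M b a) (rlog M b c)
            \<le> (rdist M a c)\<^sup>2"
    and comparison_upper: "a \<in> X \<Longrightarrow> b \<in> X \<Longrightarrow> c \<in> X \<Longrightarrow>
          (rdist M a c)\<^sup>2
            \<le> C1 * (rdist M b c)\<^sup>2 + (rdist M a b)\<^sup>2 - 2 * metric M b (rlog M b a) (rlog M b c)"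
    and log_upper: "p \<in> X \<Longrightarrow> q \<in> X \<Longrightarrow> r \<in> X \<Longrightarrow>
          norm_at M p (rlog M p q - rlog M p r) \<le> (1 + C4 * D\<^sup>2) * rdist M q r"
    and W_sym: "transpose W = W"
    and W_stoch: "(\<Sum>j\<in>UNIV. W $ i $ j) = 1"
    and W_nonneg: "W $ i $ j \<ge> 0"
    and W_gap: "sigma2 W < 1"
begin

text \<open>The comparison inequality at the vertex \<open>p\<close>, from where the logarithm of the new point is the step itself.\<close>

lemma gradient_step:
  assumes "p \<in> X" "z \<in> X" "rexp M p (- \<eta> *\<^sub>R v) \<in> X" "\<eta> \<ge> 0" "\<eta> * norm_at M p v \<le> D"
  shows "(rdist M z (rexp M p (- \<eta> *\<^sub>R v)))\<^sup>2 \<le>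
     (rdist M z p)\<^sup>2 + C1 * \<eta>\<^sup>2 * (norm_at M p v)\<^sup>2 + 2 * \<eta> * metric M p v (rlog M p z)"
proof -
  let ?y = "rexp M p (- \<eta> *\<^sub>R v)"
  have "norm_at M p (- \<eta> *\<^sub>R v) \<le> D" using assms by (simp only: norm_at_scaleR) simp
  then have l: "rlog M p ?y = - \<eta> *\<^sub>R v" by (rule rlog_rexp_le[OF assms(1)])
  then have "rdist M p ?y = norm_at M p (- \<eta> *\<^sub>R v)" using norm_rlog assms by metis
  then have "(rdist M p ?y)\<^sup>2 = \<eta>\<^sup>2 * (norm_at M p v)\<^sup>2"
    by (simp only: norm_at_scaleR) (simp add: power_mult_distrib)
  moreover have "metric M p (rlog M p z) (- \<eta> *\<^sub>R v) = - (\<eta> * metric M p v (rlog M p z))"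
    by (simp add: metric_simps(5,9) metric_sym[of p v])
  ultimately show ?thesis using comparison_upper[OF assms(2,1,3)] unfolding l by simp
qed

definition consensus_step :: "('n \<Rightarrow> 'm) \<Rightarrow> 'n \<Rightarrow> 'm" where
  "consensus_step y i = rexp M (y i)
     ((C2 / (2 * C1)) *\<^sub>R (\<Sum>j\<in>UNIV. W $ i $ j *\<^sub>R rlog M (y i) (y j)))"

lemma W_stoch': "(\<Sum>i\<in>UNIV. W $ i $ j) = 1"
proof -
  have "W $ i $ j = W $ j $ i" for i using W_sym by (metis transpose_def vec_lambda_beta)
  then show ?thesis using W_stoch[of j] by simp
qed

text \<open>Convexity of the squared norm and the lower comparison inequality at \<open>y\<^sub>i\<close> leave the factor
  \<open>C1 s\<^sup>2 - C2 s\<close> in front of the Dirichlet form, which \<open>s = C2 / (2 C1)\<close> minimises. The terms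
  \<open>d\<^sup>2(z, y\<^sub>j) - d\<^sup>2(z, y\<^sub>i)\<close> cancel after summation because the mixing matrix is doubly stochastic.\<close>

lemma consensus_step_decreases:
  assumes y: "\<And>i. y i \<in> X" and x: "\<And>i. consensus_step y i \<in> X" and z: "z \<in> X"
  shows "(\<Sum>i\<in>UNIV. (rdist M z (consensus_step y i))\<^sup>2) \<le> (\<Sum>i\<in>UNIV. (rdist M z (y i))\<^sup>2)
    - C2\<^sup>2 / (4 * C1) * (\<Sum>i\<in>UNIV. \<Sum>j\<in>UNIV. W $ i $ j * (rdist M (y i) (y j))\<^sup>2)"
proof -
  define s where "s = C2 / (2 * C1)"
  have s: "0 < s" "s \<le> 1" using C1 C2 by (auto simp: s_def field_simps)
  define Q where "Q i = (\<Sum>j\<in>UNIV. W $ i $ j * (rdist M (y i) (y j))\<^sup>2)" for i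
  have one: "(rdist M z (consensus_step y i))\<^sup>2 \<le> (1 - s) * (rdist M z (y i))\<^sup>2
      + s * (\<Sum>j\<in>UNIV. W $ i $ j * (rdist M z (y j))\<^sup>2) + (C1 * s\<^sup>2 - s * C2) * Q i" for i
  proof -
    define v where "v = (\<Sum>j\<in>UNIV. W $ i $ j *\<^sub>R rlog M (y i) (y j))"
    have v: "(norm_at M (y i) v)\<^sup>2 \<le> Q i"
      using norm_at_convex_combination[of UNIV "\<lambda>j. W $ i $ j" "y i" "\<lambda>j. rlog M (y i) (y j)"]
      by (simp add: v_def Q_def W_nonneg W_stoch norm_rlog y)
    have "Q i \<le> (\<Sum>j\<in>UNIV. W $ i $ j * D\<^sup>2)"
      unfolding Q_def using y by (intro sum_mono mult_left_mono power_mono diameter rdist_nonneg W_nonneg)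
    also have "\<dots> = D\<^sup>2" by (simp add: sum_distrib_right[symmetric] W_stoch)
    finally have vD: "norm_at M (y i) v \<le> D" using v D_pos power2_le_imp_le[of _ D] by fastforce
    have x_eq: "consensus_step y i = rexp M (y i) (s *\<^sub>R v)" by (simp add: consensus_step_def s_def v_def)
    have "norm_at M (y i) (s *\<^sub>R v) \<le> D"
      using mult_mono[OF s(2) vD] s D_pos by (simp add: norm_at_scaleR norm_at_nonneg)
    then have l: "rlog M (y i) (consensus_step y i) = s *\<^sub>R v" unfolding x_eq by (rule rlog_rexp_le[OF y])
    then have "(rdist M (y i) (consensus_step y i))\<^sup>2 = s\<^sup>2 * (norm_at M (y i) v)\<^sup>2"
      using norm_rlog[OF y x, of i i] s by (simp add: norm_at_scaleR power_mult_distrib flip: \<open>norm_at M _ _ = rdist M _ _\<close>)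
    also have "\<dots> \<le> s\<^sup>2 * Q i" using v by (intro mult_left_mono) auto
    finally have d: "C1 * (rdist M (y i) (consensus_step y i))\<^sup>2 \<le> C1 * s\<^sup>2 * Q i"
      using C1 by (simp add: mult.assoc)
    have m1: "metric M (y i) (rlog M (y i) z) (s *\<^sub>R v)
        = s * (\<Sum>j\<in>UNIV. W $ i $ j * metric M (y i) (rlog M (y i) z) (rlog M (y i) (y j)))"
      by (simp add: v_def metric_simps)
    have m2: "- 2 * (\<Sum>j\<in>UNIV. W $ i $ j * metric M (y i) (rlog M (y i) z) (rlog M (y i) (y j)))
       \<le> (\<Sum>j\<in>UNIV. W $ i $ j * ((rdist M z (y j))\<^sup>2 - C2 * (rdist M (y i) (y j))\<^sup>2 - (rdist M z (y i))\<^sup>2))"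
      unfolding sum_distrib_left
    proof (rule sum_mono)
      fix j
      have "- 2 * metric M (y i) (rlog M (y i) z) (rlog M (y i) (y j))
        \<le> (rdist M z (y j))\<^sup>2 - C2 * (rdist M (y i) (y j))\<^sup>2 - (rdist M z (y i))\<^sup>2"
        using comparison_lower[OF z y y, of i j] by simp
      from mult_left_mono[OF this W_nonneg[of i j]]
      show "- 2 * (W $ i $ j * metric M (y i) (rlog M (y i) z) (rlog M (y i) (y j)))
        \<le> W $ i $ j * ((rdist M z (y j))\<^sup>2 - C2 * (rdist M (y i) (y j))\<^sup>2 - (rdist M z (y i))\<^sup>2)"
        by (simp add: mult.left_commute)
    qed
    have m3: "(\<Sum>j\<in>UNIV. W $ i $ j * ((rdist M z (y j))\<^sup>2 - C2 * (rdist M (y i) (y j))\<^sup>2 - (rdist M z (y i))\<^sup>2))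
       = (\<Sum>j\<in>UNIV. W $ i $ j * (rdist M z (y j))\<^sup>2) - C2 * Q i - (\<Sum>j\<in>UNIV. W $ i $ j) * (rdist M z (y i))\<^sup>2"
      unfolding Q_def by (simp add: right_diff_distrib sum_subtractf sum_distrib_left sum_distrib_right mult.left_commute)
    have "s * (- 2 * (\<Sum>j\<in>UNIV. W $ i $ j * metric M (y i) (rlog M (y i) z) (rlog M (y i) (y j))))
       \<le> s * ((\<Sum>j\<in>UNIV. W $ i $ j * (rdist M z (y j))\<^sup>2) - C2 * Q i - (rdist M z (y i))\<^sup>2)"
      using m2[unfolded m3 W_stoch mult_1] s(1) by (intro mult_left_mono) auto
    then have "- 2 * metric M (y i) (rlog M (y i) z) (s *\<^sub>R v)
       \<le> s * ((\<Sum>j\<in>UNIV. W $ i $ j * (rdist M z (y j))\<^sup>2) - C2 * Q i - (rdist M z (y i))\<^sup>2)"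
      unfolding m1 by (simp only: mult.left_commute)
    then show ?thesis using comparison_upper[OF z y x, of i i] d unfolding l
      by (simp add: algebra_simps)
  qed
  have swap: "(\<Sum>i\<in>UNIV. \<Sum>j\<in>UNIV. W $ i $ j * (rdist M z (y j))\<^sup>2) = (\<Sum>i\<in>UNIV. (rdist M z (y i))\<^sup>2)"
    by (subst sum.swap) (simp add: sum_distrib_right[symmetric] W_stoch')
  have "(\<Sum>i\<in>UNIV. (rdist M z (consensus_step y i))\<^sup>2) \<le> (\<Sum>i\<in>UNIV. (1 - s) * (rdist M z (y i))\<^sup>2
      + s * (\<Sum>j\<in>UNIV. W $ i $ j * (rdist M z (y j))\<^sup>2) + (C1 * s\<^sup>2 - s * C2) * Q i)"
    by (intro sum_mono one)
  also have "\<dots> = (1 - s) * (\<Sum>i\<in>UNIV. (rdist M z (y i))\<^sup>2)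
      + s * (\<Sum>i\<in>UNIV. \<Sum>j\<in>UNIV. W $ i $ j * (rdist M z (y j))\<^sup>2) + (C1 * s\<^sup>2 - s * C2) * (\<Sum>i\<in>UNIV. Q i)"
    by (simp only: sum.distrib sum_distrib_left)
  also have "\<dots> = (\<Sum>i\<in>UNIV. (rdist M z (y i))\<^sup>2) + (C1 * s\<^sup>2 - s * C2) * (\<Sum>i\<in>UNIV. Q i)"
    unfolding swap by (simp add: left_diff_distrib)
  finally have "(\<Sum>i\<in>UNIV. (rdist M z (consensus_step y i))\<^sup>2)
     \<le> (\<Sum>i\<in>UNIV. (rdist M z (y i))\<^sup>2) + (C1 * s\<^sup>2 - s * C2) * (\<Sum>i\<in>UNIV. Q i)" .
  moreover have "C1 * s\<^sup>2 - s * C2 = - (C2\<^sup>2 / (4 * C1))"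
    using C1 by (simp add: s_def power2_eq_square field_simps)
  ultimately show ?thesis by (simp add: Q_def)
qed

text \<open>The infimum of the Frechet functional. It stands for the value at a Frechet mean and is meaningful for the
  intermediate points of the algorithm too, for which \<open>X\<close> may contain no mean.\<close>

definition dispersion :: "('n \<Rightarrow> 'm) \<Rightarrow> real" where
  "dispersion z = (INF p\<in>X. \<Sum>i\<in>UNIV. (rdist M (z i) p)\<^sup>2)"

lemma dispersion_le: "p \<in> X \<Longrightarrow> dispersion z \<le> (\<Sum>i\<in>UNIV. (rdist M (z i) p)\<^sup>2)"
  unfolding dispersion_def
  by (rule cINF_lower) (auto intro!: bdd_belowI[of _ 0] sum_nonneg)

lemma dispersion_nonneg: "X \<noteq> {} \<Longrightarrow> dispersion z \<ge> 0"
  unfolding dispersion_def by (rule cINF_greatest) (auto intro!: sum_nonneg)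

lemma dispersion_approx:
  assumes "X \<noteq> {}" "e > 0"
  shows "\<exists>p\<in>X. (\<Sum>i\<in>UNIV. (rdist M (z i) p)\<^sup>2) < dispersion z + e"
proof -
  have "bdd_below ((\<lambda>p. \<Sum>i\<in>UNIV. (rdist M (z i) p)\<^sup>2) ` X)"
    by (auto intro!: bdd_belowI[of _ 0] sum_nonneg)
  then show ?thesis
    using cINF_less_iff[of X "\<lambda>p. \<Sum>i\<in>UNIV. (rdist M (z i) p)\<^sup>2" "dispersion z + e"] assms
    unfolding dispersion_def by auto
qed

lemma dispersion_frechet_mean:
  assumes "is_frechet_mean M X z p"
  shows "p \<in> X" "dispersion z = (\<Sum>i\<in>UNIV. (rdist M (z i) p)\<^sup>2)"
proof -
  show p: "p \<in> X" using assms by (simp add: is_frechet_mean_def is_arg_min_def)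
  have "(\<Sum>i\<in>UNIV. (rdist M (z i) p)\<^sup>2) \<le> (\<Sum>i\<in>UNIV. (rdist M (z i) q)\<^sup>2)" if "q \<in> X" for q
    using assms that by (auto simp: is_frechet_mean_def is_arg_min_def not_less divide_le_cancel)
  then have "(\<Sum>i\<in>UNIV. (rdist M (z i) p)\<^sup>2) \<le> dispersion z"
    unfolding dispersion_def using p by (intro cINF_greatest) auto
  then show "dispersion z = (\<Sum>i\<in>UNIV. (rdist M (z i) p)\<^sup>2)" using dispersion_le[OF p] by (simp add: antisym)
qed

text \<open>First-order optimality of a point \<open>z\<close> minimising the Frechet functional up to \<open>h\<^sup>2\<close>: moving from \<open>z\<close> towards
  \<open>y\<^sub>j\<close> by the fraction \<open>h\<close> stays in \<open>X\<close> and cannot gain more than \<open>h\<^sup>2\<close>, so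
  \<open>\<langle>\<Sum>\<^sub>i log\<^sub>z y\<^sub>i, log\<^sub>z y\<^sub>j\<rangle> = O(h)\<close>; summing over \<open>j\<close> bounds the sum of the logarithms.\<close>

lemma near_mean_sum_log_small:
  fixes y :: "'n \<Rightarrow> 'm"
  assumes y: "\<And>i. y i \<in> X" and z: "z \<in> X" and h: "0 < h" "h \<le> 1"
    and near: "(\<Sum>i\<in>UNIV. (rdist M (y i) z)\<^sup>2) \<le> dispersion y + h\<^sup>2"
  shows "metric M z (\<Sum>i\<in>UNIV. rlog M z (y i)) (\<Sum>i\<in>UNIV. rlog M z (y i)) / real CARD('n)
    \<le> h * ((real CARD('n) * C1 * D\<^sup>2 + 1) / 2)"
proof -
  define u where "u i = rlog M z (y i)" for i
  define S where "S = (\<Sum>i\<in>UNIV. (rdist M (y i) z)\<^sup>2)"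
  have *: "2 * metric M z (\<Sum>i\<in>UNIV. u i) (u j) \<le> h * (real CARD('n) * C1 * D\<^sup>2 + 1)" for j
  proof -
    define p where "p = rexp M z (h *\<^sub>R u j)"
    have p: "p \<in> X" "rlog M z p = h *\<^sub>R u j"
      using rexp_scaled_rlog[OF z y, of h j] h by (auto simp: p_def u_def)
    have "rdist M z p = h * rdist M z (y j)"
      using norm_rlog[OF z p(1)] norm_rlog[OF z y, of j] p(2) h by (simp add: norm_at_scaleR u_def)
    also have "\<dots> \<le> h * D" using h diameter[OF z y] by (intro mult_left_mono) auto
    finally have "(rdist M z p)\<^sup>2 \<le> (h * D)\<^sup>2" using rdist_nonneg[OF z p(1)] by (intro power_mono)
    then have dp: "C1 * (rdist M z p)\<^sup>2 \<le> C1 * (h * D)\<^sup>2" using C1 by (intro mult_left_mono) auto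
    have "dispersion y \<le> (\<Sum>i\<in>UNIV. (rdist M (y i) p)\<^sup>2)" by (rule dispersion_le[OF p(1)])
    also have "\<dots> \<le> (\<Sum>i\<in>UNIV. C1 * (h * D)\<^sup>2 + (rdist M (y i) z)\<^sup>2 - 2 * h * metric M z (u i) (u j))"
    proof (rule sum_mono)
      fix i
      have "metric M z (rlog M z (y i)) (rlog M z p) = h * metric M z (u i) (u j)"
        by (simp add: p(2) u_def metric_simps)
      then show "(rdist M (y i) p)\<^sup>2 \<le> C1 * (h * D)\<^sup>2 + (rdist M (y i) z)\<^sup>2 - 2 * h * metric M z (u i) (u j)"
        using comparison_upper[OF y[of i] z p(1)] dp by simp
    qed
    also have "\<dots> = real CARD('n) * (C1 * (h * D)\<^sup>2) + S - 2 * h * metric M z (\<Sum>i\<in>UNIV. u i) (u j)"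
      by (simp add: sum.distrib sum_subtractf S_def metric_simps sum_distrib_left)
    finally have "2 * h * metric M z (\<Sum>i\<in>UNIV. u i) (u j) \<le> real CARD('n) * (C1 * (h * D)\<^sup>2) + h\<^sup>2"
      using near by (simp add: S_def)
    also have "\<dots> = h * (h * (real CARD('n) * C1 * D\<^sup>2 + 1))"
      by (simp add: power2_eq_square algebra_simps)
    finally have "h * (2 * metric M z (\<Sum>i\<in>UNIV. u i) (u j)) \<le> h * (h * (real CARD('n) * C1 * D\<^sup>2 + 1))"
      by (simp add: mult.left_commute mult.assoc)
    then show ?thesis using h by simp
  qed
  have "2 * metric M z (\<Sum>i\<in>UNIV. u i) (\<Sum>j\<in>UNIV. u j) = (\<Sum>j\<in>UNIV. 2 * metric M z (\<Sum>i\<in>UNIV. u i) (u j))"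
    by (simp only: metric_simps(11) sum_distrib_left)
  also have "\<dots> \<le> (\<Sum>j::'n\<in>UNIV. h * (real CARD('n) * C1 * D\<^sup>2 + 1))" by (intro sum_mono *)
  also have "\<dots> = real CARD('n) * (h * (real CARD('n) * C1 * D\<^sup>2 + 1))" by simp
  finally have "metric M z (\<Sum>i\<in>UNIV. u i) (\<Sum>j\<in>UNIV. u j) \<le> (h * ((real CARD('n) * C1 * D\<^sup>2 + 1) / 2)) * real CARD('n)"
    by (simp add: mult.commute mult.left_commute)
  then show ?thesis unfolding u_def by (simp only: pos_divide_le_eq[OF of_nat_0_less_iff[THEN iffD2, OF zero_less_card_finite]])
qed

definition rate :: real where
  "rate = C2 ^ 3 * (1 - sigma2 W) / (4 * C1 * (1 + C4 * D\<^sup>2)\<^sup>2)"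

text \<open>The contraction rate that the spectral gap yields directly; \<open>rate\<close> is \<open>C2 / 2\<close> times this.\<close>

definition rate2 :: real where
  "rate2 = 2 * (C2\<^sup>2 / (4 * C1)) * (1 - sigma2 W) / (1 + C4 * D\<^sup>2)\<^sup>2"

lemma rate: "0 < rate" "rate \<le> rate2" "rate2 \<le> 1" "rate < 1"
proof -
  define k where "k = (1 + C4 * D\<^sup>2)\<^sup>2"
  have k: "k \<ge> 1" using C4 by (simp add: k_def one_le_power)
  have g: "0 < 1 - sigma2 W" "1 - sigma2 W \<le> 1" using W_gap sigma2_nonneg[of W] by auto
  show r0: "0 < rate" unfolding rate_def using C1 C2 g k by (simp flip: k_def)
  have e: "rate2 = 2 * (C2\<^sup>2 * (1 - sigma2 W) / (4 * C1 * k))"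
    by (simp only: rate2_def k_def divide_inverse inverse_mult_distrib mult_ac)
  have e': "rate = C2 * (C2\<^sup>2 * (1 - sigma2 W) / (4 * C1 * k))"
    by (simp add: rate_def k_def power2_eq_square power3_eq_cube)
  have nn: "0 \<le> C2\<^sup>2 * (1 - sigma2 W) / (4 * C1 * k)" using C1 g k by simp
  show "rate \<le> rate2" unfolding e e' using C2 nn by (intro mult_right_mono) auto
  have "C2\<^sup>2 * (1 - sigma2 W) \<le> 1 * 1" using C2 g by (intro mult_mono power_le_one) auto
  moreover have "4 * 1 \<le> 4 * C1 * k" using mult_mono[of 1 C1 1 k] C1 k by simp
  ultimately have "C2\<^sup>2 * (1 - sigma2 W) / (4 * C1 * k) \<le> 1 / 4"
    using frac_le[of 1 "C2\<^sup>2 * (1 - sigma2 W)" 4 "4 * C1 * k"] by simp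
  then have "rate2 \<le> 1 / 2" unfolding e by linarith
  then show "rate2 \<le> 1" "rate < 1" using \<open>rate \<le> rate2\<close> by auto
qed

text \<open>At a near-minimiser \<open>z\<close> for the points \<open>y\<close>, the consensus step gains a multiple of the Dirichlet form of \<open>y\<close>. The map \<open>log\<^sub>z\<close>
  carries this form to a Euclidean one up to the factor \<open>(1 + C4 D\<^sup>2)\<^sup>2\<close>. There the spectral gap bounds it from below by the
  sum of the \<open>d\<^sup>2(z, y\<^sub>i)\<close>, up to the norm of the sum of the logarithms, which is \<open>O(h)\<close>.\<close>

lemma dispersion_contraction:
  assumes y: "\<And>i. y i \<in> X" and x: "\<And>i. consensus_step y i \<in> X"
  shows "dispersion (consensus_step y) \<le> (1 - rate) * dispersion y"
proof -
  have X: "X \<noteq> {}" using y by auto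
  define K where "K = (real CARD('n) * C1 * D\<^sup>2 + 1) / 2"
  have K: "K \<ge> 0" using C1 by (simp add: K_def)
  have "dispersion (consensus_step y) \<le> (1 - rate2) * dispersion y + h * (1 + K)"
    if h: "0 < h" "h \<le> 1" for h
  proof -
    obtain z where z: "z \<in> X" "(\<Sum>i\<in>UNIV. (rdist M (y i) z)\<^sup>2) < dispersion y + h\<^sup>2"
      using dispersion_approx[OF X, of "h\<^sup>2" y] h by auto
    define S where "S = (\<Sum>i\<in>UNIV. (rdist M (y i) z)\<^sup>2)"
    define u where "u i = rlog M z (y i)" for i
    define k where "k = 1 + C4 * D\<^sup>2"
    have k: "k > 0" using C4 D_pos by (simp add: k_def add_pos_nonneg)
    have small: "metric M z (\<Sum>i\<in>UNIV. u i) (\<Sum>i\<in>UNIV. u i) / real CARD('n) \<le> h * K"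
      using near_mean_sum_log_small[OF y z(1) h] z(2) by (simp add: u_def K_def)
    have uu: "(\<Sum>i\<in>UNIV. metric M z (u i) (u i)) = S"
      using z y by (simp add: u_def metric_self(1) norm_rlog S_def rdist_sym[of z])
    have "2 * (1 - sigma2 W) * (S - h * K)
      \<le> 2 * (1 - sigma2 W) * ((\<Sum>i\<in>UNIV. metric M z (u i) (u i))
         - metric M z (\<Sum>i\<in>UNIV. u i) (\<Sum>i\<in>UNIV. u i) / real CARD('n))"
      unfolding uu using small W_gap by (intro mult_left_mono) auto
    also have "\<dots> \<le> (\<Sum>i\<in>UNIV. \<Sum>j\<in>UNIV. W $ i $ j * metric M z (u i - u j) (u i - u j))"
      by (rule dirichlet_form_ge[OF W_sym W_stoch W_gap metric_bilinear metric_sym metric_pos])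
    also have "\<dots> \<le> (\<Sum>i\<in>UNIV. \<Sum>j\<in>UNIV. k\<^sup>2 * (W $ i $ j * (rdist M (y i) (y j))\<^sup>2))"
    proof (intro sum_mono)
      fix i j
      have "(norm_at M z (u i - u j))\<^sup>2 \<le> (k * rdist M (y i) (y j))\<^sup>2"
        unfolding u_def k_def by (intro power_mono log_upper z y norm_at_nonneg)
      then have "W $ i $ j * metric M z (u i - u j) (u i - u j) \<le> W $ i $ j * (k * rdist M (y i) (y j))\<^sup>2"
        unfolding metric_self(1) by (rule mult_left_mono) (rule W_nonneg)
      then show "W $ i $ j * metric M z (u i - u j) (u i - u j) \<le> k\<^sup>2 * (W $ i $ j * (rdist M (y i) (y j))\<^sup>2)"
        by (simp add: power_mult_distrib mult.left_commute)
    qed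
    also have "\<dots> = (\<Sum>i\<in>UNIV. \<Sum>j\<in>UNIV. W $ i $ j * (rdist M (y i) (y j))\<^sup>2) * k\<^sup>2"
      by (simp add: sum_distrib_left mult.commute)
    finally have "2 * (1 - sigma2 W) * (S - h * K) / k\<^sup>2 \<le> (\<Sum>i\<in>UNIV. \<Sum>j\<in>UNIV. W $ i $ j * (rdist M (y i) (y j))\<^sup>2)"
      using k by (simp add: pos_divide_le_eq)
    then have "C2\<^sup>2 / (4 * C1) * (2 * (1 - sigma2 W) * (S - h * K) / k\<^sup>2)
        \<le> C2\<^sup>2 / (4 * C1) * (\<Sum>i\<in>UNIV. \<Sum>j\<in>UNIV. W $ i $ j * (rdist M (y i) (y j))\<^sup>2)"
      using C1 by (intro mult_left_mono) auto
    moreover have "rate2 * (S - h * K) = C2\<^sup>2 / (4 * C1) * (2 * (1 - sigma2 W) * (S - h * K) / k\<^sup>2)"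
      by (simp only: rate2_def k_def divide_inverse mult_ac)
    ultimately have E: "rate2 * (S - h * K) \<le> C2\<^sup>2 / (4 * C1) * (\<Sum>i\<in>UNIV. \<Sum>j\<in>UNIV. W $ i $ j * (rdist M (y i) (y j))\<^sup>2)"
      by simp
    have "dispersion (consensus_step y) \<le> (\<Sum>i\<in>UNIV. (rdist M (consensus_step y i) z)\<^sup>2)"
      by (rule dispersion_le[OF z(1)])
    also have "\<dots> = (\<Sum>i\<in>UNIV. (rdist M z (consensus_step y i))\<^sup>2)" by (simp add: rdist_sym[OF x z(1)])
    also have "\<dots> \<le> (\<Sum>i\<in>UNIV. (rdist M z (y i))\<^sup>2) - rate2 * (S - h * K)"
      using consensus_step_decreases[OF y x z(1)] E by linarith
    also have "(\<Sum>i\<in>UNIV. (rdist M z (y i))\<^sup>2) = S" unfolding S_def by (simp add: rdist_sym[OF y z(1)])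
    also have "S - rate2 * (S - h * K) = (1 - rate2) * S + rate2 * (h * K)" by (simp add: algebra_simps)
    also have "\<dots> \<le> (1 - rate2) * (dispersion y + h) + 1 * (h * K)"
    proof (intro add_mono mult_mono)
      have "h\<^sup>2 \<le> h" using h by (simp add: power2_eq_square mult_left_le)
      then show "S \<le> dispersion y + h" using z(2) by (simp add: S_def)
    qed (use rate K h in \<open>auto simp: S_def sum_nonneg\<close>)
    also have "\<dots> \<le> (1 - rate2) * dispersion y + h * (1 + K)"
      using rate(1,2) h by (simp add: algebra_simps)
    finally show ?thesis .
  qed
  then have "dispersion (consensus_step y) \<le> (1 - rate2) * dispersion y" by (rule le_of_le_add_small)
  also have "\<dots> \<le> (1 - rate) * dispersion y"
    using rate(2) dispersion_nonneg[OF X] by (intro mult_right_mono) auto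
  finally show ?thesis .
qed

lemma round_distance:
  assumes x: "\<And>i. x i \<in> X" and y: "\<And>i. rexp M (x i) (- \<eta> *\<^sub>R v i) \<in> X"
    and x': "\<And>i. consensus_step (\<lambda>i. rexp M (x i) (- \<eta> *\<^sub>R v i)) i \<in> X"
    and \<eta>: "\<eta> \<ge> 0" "\<And>i. \<eta> * norm_at M (x i) (v i) \<le> D" and z: "z \<in> X"
  shows "(\<Sum>i\<in>UNIV. (rdist M z (consensus_step (\<lambda>i. rexp M (x i) (- \<eta> *\<^sub>R v i)) i))\<^sup>2) \<le>
     (\<Sum>i\<in>UNIV. (rdist M z (x i))\<^sup>2 + C1 * \<eta>\<^sup>2 * (norm_at M (x i) (v i))\<^sup>2
        + 2 * \<eta> * metric M (x i) (v i) (rlog M (x i) z))"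
proof -
  let ?y = "\<lambda>i. rexp M (x i) (- \<eta> *\<^sub>R v i)"
  have "0 \<le> C2\<^sup>2 / (4 * C1) * (\<Sum>i\<in>UNIV. \<Sum>j\<in>UNIV. W $ i $ j * (rdist M (?y i) (?y j))\<^sup>2)"
    using C1 by (intro mult_nonneg_nonneg sum_nonneg W_nonneg) auto
  then have "(\<Sum>i\<in>UNIV. (rdist M z (consensus_step ?y i))\<^sup>2) \<le> (\<Sum>i\<in>UNIV. (rdist M z (?y i))\<^sup>2)"
    using consensus_step_decreases[OF y x' z] by linarith
  also have "\<dots> \<le> (\<Sum>i\<in>UNIV. (rdist M z (x i))\<^sup>2 + C1 * \<eta>\<^sup>2 * (norm_at M (x i) (v i))\<^sup>2
        + 2 * \<eta> * metric M (x i) (v i) (rlog M (x i) z))"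
    by (intro sum_mono gradient_step x z y \<eta>)
  finally show ?thesis .
qed

lemma round_dispersion:
  assumes x: "\<And>i. x i \<in> X" and y: "\<And>i. rexp M (x i) (- \<eta> *\<^sub>R v i) \<in> X"
    and x': "\<And>i. consensus_step (\<lambda>i. rexp M (x i) (- \<eta> *\<^sub>R v i)) i \<in> X"
    and \<eta>: "\<eta> \<ge> 0" "\<And>i. \<eta> * norm_at M (x i) (v i) \<le> D" and z: "z \<in> X"
  shows "dispersion (consensus_step (\<lambda>i. rexp M (x i) (- \<eta> *\<^sub>R v i))) \<le>
     (1 - rate) * (\<Sum>i\<in>UNIV. (rdist M z (x i))\<^sup>2 + C1 * \<eta>\<^sup>2 * (norm_at M (x i) (v i))\<^sup>2
        + 2 * \<eta> * metric M (x i) (v i) (rlog M (x i) z))"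
proof -
  let ?y = "\<lambda>i. rexp M (x i) (- \<eta> *\<^sub>R v i)"
  have "dispersion ?y \<le> (\<Sum>i\<in>UNIV. (rdist M (?y i) z)\<^sup>2)" by (rule dispersion_le[OF z])
  also have "\<dots> = (\<Sum>i\<in>UNIV. (rdist M z (?y i))\<^sup>2)" by (simp only: rdist_sym[OF y z])
  also have "\<dots> \<le> (\<Sum>i\<in>UNIV. (rdist M z (x i))\<^sup>2 + C1 * \<eta>\<^sup>2 * (norm_at M (x i) (v i))\<^sup>2
        + 2 * \<eta> * metric M (x i) (v i) (rlog M (x i) z))"
    by (intro sum_mono gradient_step x z y \<eta>)
  finally have "(1 - rate) * dispersion ?y \<le> (1 - rate) * \<dots>" using rate by (intro mult_left_mono) auto
  then show ?thesis using dispersion_contraction[OF y x'] by linarith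
qed

lemma convex_fun_diff_le:
  assumes "geodesically_convex_fun M X f g" "\<And>p. p \<in> X \<Longrightarrow> norm_at M p (g p) \<le> \<delta>" "p \<in> X" "q \<in> X"
  shows "f p - f q \<le> \<delta> * rdist M p q"
proof -
  have "- metric M p (g p) (rlog M p q) \<le> norm_at M p (g p) * norm_at M p (rlog M p q)"
    using metric_Cauchy_Schwarz[of p "g p" "rlog M p q"] by linarith
  also have "\<dots> \<le> \<delta> * rdist M p q"
    using assms by (simp add: norm_rlog mult_right_mono rdist_nonneg)
  finally show ?thesis using assms unfolding geodesically_convex_fun_def by fastforce
qed

text \<open>Each \<open>f\<^sub>i(p) - f\<^sub>i(q)\<close> is split at \<open>x\<^sub>i\<close>. The first part is at most \<open>\<delta> d(x\<^sub>i, p)\<close>, and Cauchy-Schwarz over the agents brings in the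
  dispersion; the second part is bounded by convexity.\<close>

lemma objective_gap_at_mean:
  assumes x: "\<And>i. x i \<in> X" and mean: "is_frechet_mean M X x p" and q: "q \<in> X" and \<delta>: "\<delta> \<ge> 0"
    and f: "\<And>i. geodesically_convex_fun M X (f i) (g i)"
    and g: "\<And>i p. p \<in> X \<Longrightarrow> norm_at M p (g i p) \<le> \<delta>"
  shows "(\<Sum>i\<in>UNIV. f i p) - (\<Sum>i\<in>UNIV. f i q)
    \<le> \<delta> * sqrt (real CARD('n) * dispersion x) - (\<Sum>i\<in>UNIV. metric M (x i) (g i (x i)) (rlog M (x i) q))"
proof -
  note p = dispersion_frechet_mean[OF mean]
  have "(\<Sum>i\<in>UNIV. 1 * rdist M (x i) p)\<^sup>2 \<le> (\<Sum>i\<in>(UNIV :: 'n set). 1\<^sup>2) * (\<Sum>i\<in>UNIV. (rdist M (x i) p)\<^sup>2)"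
    by (rule Cauchy_Schwarz_ineq_sum)
  then have "(\<Sum>i\<in>UNIV. rdist M (x i) p)\<^sup>2 \<le> real CARD('n) * dispersion x" by (simp add: p(2))
  then have cs: "(\<Sum>i\<in>UNIV. rdist M (x i) p) \<le> sqrt (real CARD('n) * dispersion x)" by (rule real_le_rsqrt)
  have "(\<Sum>i\<in>UNIV. f i p) - (\<Sum>i\<in>UNIV. f i q) = (\<Sum>i\<in>UNIV. (f i p - f i (x i)) + (f i (x i) - f i q))"
    by (simp add: sum_subtractf)
  also have "\<dots> \<le> (\<Sum>i\<in>UNIV. \<delta> * rdist M (x i) p + - metric M (x i) (g i (x i)) (rlog M (x i) q))"
  proof (intro sum_mono add_mono)
    fix i
    show "f i p - f i (x i) \<le> \<delta> * rdist M (x i) p"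
      using convex_fun_diff_le[OF f g p(1) x, of i i] by (simp add: rdist_sym[OF x p(1)])
    show "f i (x i) - f i q \<le> - metric M (x i) (g i (x i)) (rlog M (x i) q)"
      using f[of i] x[of i] q unfolding geodesically_convex_fun_def by fastforce
  qed
  also have "\<dots> = \<delta> * (\<Sum>i\<in>UNIV. rdist M (x i) p) - (\<Sum>i\<in>UNIV. metric M (x i) (g i (x i)) (rlog M (x i) q))"
    by (simp add: sum_subtractf sum_distrib_left)
  also have "\<dots> \<le> \<delta> * sqrt (real CARD('n) * dispersion x) - (\<Sum>i\<in>UNIV. metric M (x i) (g i (x i)) (rlog M (x i) q))"
    using cs \<delta> by (simp add: mult_left_mono)
  finally show ?thesis .
qed

end

section \<open>Measurability of the geometric quantities\<close>

lemma borel_measurable_countable_cover: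
  fixes f :: "'a \<Rightarrow> real"
  assumes "countable C" "\<And>c. c \<in> C \<Longrightarrow> {\<omega>\<in>space N. \<omega> \<in> \<Omega> c} \<in> sets N" "space N \<subseteq> (\<Union>c\<in>C. \<Omega> c)"
    and h: "\<And>c. c \<in> C \<Longrightarrow> h c \<in> borel_measurable N"
    and eq: "\<And>c \<omega>. c \<in> C \<Longrightarrow> \<omega> \<in> space N \<Longrightarrow> \<omega> \<in> \<Omega> c \<Longrightarrow> f \<omega> = h c \<omega>"
  shows "f \<in> borel_measurable N"
  unfolding borel_measurable_iff_less
proof
  fix a
  have "{\<omega>\<in>space N. f \<omega> < a} = (\<Union>c\<in>C. {\<omega>\<in>space N. \<omega> \<in> \<Omega> c} \<inter> {\<omega>\<in>space N. h c \<omega> < a})"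
  proof (intro equalityI subsetI)
    fix \<omega> assume w: "\<omega> \<in> {\<omega>\<in>space N. f \<omega> < a}"
    then obtain c where "c \<in> C" "\<omega> \<in> \<Omega> c" using assms(3) by blast
    then show "\<omega> \<in> (\<Union>c\<in>C. {\<omega>\<in>space N. \<omega> \<in> \<Omega> c} \<inter> {\<omega>\<in>space N. h c \<omega> < a})"
      using w eq[of c \<omega>] by (intro UN_I[of c]) auto
  qed (use eq in auto)
  also have "\<dots> \<in> sets N"
    using assms(1,2) h by (intro sets.countable_UN' sets.Int) (auto simp: borel_measurable_iff_less)
  finally show "{\<omega>\<in>space N. f \<omega> < a} \<in> sets N" .
qed

lemma borel_measurable_continuous_on_range:
  fixes h :: "'b::topological_space \<Rightarrow> 'c::topological_space"
  assumes "b \<in> borel_measurable N" "\<And>\<omega>. \<omega> \<in> space N \<Longrightarrow> b \<omega> \<in> A" "continuous_on A h"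
  shows "(\<lambda>\<omega>. h (b \<omega>)) \<in> borel_measurable N"
proof -
  have "b \<in> measurable N (restrict_space borel A)"
    using assms by (intro measurable_restrict_space2) auto
  from measurable_compose[OF this borel_measurable_continuous_on_restrict[OF assms(3)]] show ?thesis .
qed

lemma countable_dense_subset:
  fixes X :: "'a::second_countable_topology set"
  obtains Q where "countable Q" "Q \<subseteq> X" "\<forall>U. open U \<longrightarrow> U \<inter> X \<noteq> {} \<longrightarrow> U \<inter> Q \<noteq> {}"
proof -
  obtain B :: "'a set set" where B: "countable B" "topological_basis B" using ex_countable_basis by blast
  define pick where "pick b = (SOME p. p \<in> b \<inter> X)" for b
  have pick: "pick b \<in> b \<inter> X" if "b \<inter> X \<noteq> {}" for b
  proof -
    have "\<exists>p. p \<in> b \<inter> X" using that by blast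
    then show ?thesis unfolding pick_def by (rule someI_ex)
  qed
  define Q where "Q = pick ` {b\<in>B. b \<inter> X \<noteq> {}}"
  have dense: "U \<inter> Q \<noteq> {}" if U: "open U" "U \<inter> X \<noteq> {}" for U
  proof -
    obtain p where p: "p \<in> U" "p \<in> X" using U by blast
    obtain b where "b \<in> B" "p \<in> b" "b \<subseteq> U" by (rule topological_basisE[OF B(2) U(1) p(1)])
    then have "pick b \<in> U \<inter> Q" using pick[of b] p(2) by (auto simp: Q_def)
    then show ?thesis by blast
  qed
  have "countable Q" using B(1) by (auto simp: Q_def)
  moreover have "Q \<subseteq> X" using pick by (auto simp: Q_def)
  ultimately show ?thesis using that[of Q] dense by metis
qed

context riemannian_mfd
begin

lemma countable_atlas:
  obtains A where "A \<subseteq> atlas M" "countable A" "(\<Union>c\<in>A. fst c) = UNIV"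
proof -
  obtain F' where F': "F' \<subseteq> fst ` atlas M" "countable F'" "\<Union>F' = \<Union>(fst ` atlas M)"
    by (rule Lindelof[of "fst ` atlas M"]) (use chart_open(1) in blast)
  then have "\<exists>A. countable A \<and> A \<subseteq> atlas M \<and> F' = fst ` A"
    using countable_subset_image[of F' fst "atlas M"] by blast
  then obtain A where A: "A \<subseteq> atlas M" "countable A" "F' = fst ` A" by blast
  moreover have "(\<Union>c\<in>A. fst c) = UNIV"
    using F'(3) A(3) atlas unfolding smooth_atlas_def by simp
  ultimately show ?thesis using that by blast
qed

lemma borel_measurable_gram_entry:
  assumes c: "c \<in> atlas M"
  shows "(\<lambda>p. if p \<in> fst c then chart_metric M c (snd c p) u v else 0) \<in> borel_measurable borel"
proof (rule borel_measurable_continuous_on_if)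
  show "fst c \<in> sets borel" using chart_open(1)[OF c] by auto
  have "Ck_on 0 (snd c ` fst c) (\<lambda>x. chart_metric M c x u v)"
    using chart_metric_smooth[OF c] unfolding smooth_on_def by blast
  then have "continuous_on (snd c ` fst c) (\<lambda>x. chart_metric M c x u v)" by simp
  from continuous_on_compose2[OF this chart_open(3)[OF c]]
  show "continuous_on (fst c) (\<lambda>p. chart_metric M c (snd c p) u v)" by blast
qed auto

lemma tangent_measurable_chart:
  "tangent_measurable M N b V \<Longrightarrow> c \<in> atlas M \<Longrightarrow>
    (\<lambda>\<omega>. if b \<omega> \<in> fst c then to_chart M c (b \<omega>) (V \<omega>) else 0) \<in> borel_measurable N"
  and tangent_measurable_base: "tangent_measurable M N b V \<Longrightarrow> b \<in> borel_measurable N"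
  by (simp_all add: tangent_measurable_def)

text \<open>Countably many charts cover the manifold, and in each of them the metric is a continuous function
  of the coordinates.\<close>

lemma metric_measurable:
  assumes V: "tangent_measurable M N b V" and U: "tangent_measurable M N b U"
  shows "(\<lambda>\<omega>. metric M (b \<omega>) (V \<omega>) (U \<omega>)) \<in> borel_measurable N"
proof -
  obtain A where A: "A \<subseteq> atlas M" "countable A" "(\<Union>c\<in>A. fst c) = UNIV" by (rule countable_atlas)
  note b = tangent_measurable_base[OF V]
  define coord where "coord V c \<omega> = (if b \<omega> \<in> fst c then to_chart M c (b \<omega>) (V \<omega>) else 0)" for V c \<omega>
  define h where "h c \<omega> = (\<Sum>i\<in>Basis. \<Sum>j\<in>Basis. (coord V c \<omega> \<bullet> i) * (coord U c \<omega> \<bullet> j)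
      * (if b \<omega> \<in> fst c then chart_metric M c (snd c (b \<omega>)) i j else 0))" for c \<omega>
  show ?thesis
  proof (rule borel_measurable_countable_cover[OF A(2), where \<Omega> = "\<lambda>c. b -` fst c" and h = h])
    show "space N \<subseteq> (\<Union>c\<in>A. b -` fst c)" using A(3) by blast
    fix c assume "c \<in> A"
    then have c: "c \<in> atlas M" using A by blast
    show "{\<omega>\<in>space N. \<omega> \<in> b -` fst c} \<in> sets N"
      using measurable_sets[OF b, of "fst c"] chart_open(1)[OF c]
      by (simp add: vimage_def Int_def conj_commute)
    have [measurable]: "coord V c \<in> borel_measurable N" "coord U c \<in> borel_measurable N"
      using tangent_measurable_chart[OF V c] tangent_measurable_chart[OF U c] by (simp_all add: coord_def[abs_def])
    have [measurable]: "(\<lambda>\<omega>. if b \<omega> \<in> fst c then chart_metric M c (snd c (b \<omega>)) i j else 0) \<in> borel_measurable N" for i j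
      by (rule measurable_compose[OF b borel_measurable_gram_entry[OF c]])
    show "h c \<in> borel_measurable N" unfolding h_def[abs_def] by measurable
    fix \<omega> assume w: "\<omega> \<in> b -` fst c"
    then have bc: "b \<omega> \<in> fst c" by simp
    have "metric M (b \<omega>) (V \<omega>) (U \<omega>) = chart_metric M c (snd c (b \<omega>)) (coord V c \<omega>) (coord U c \<omega>)"
      using metric_eq_chart_metric[OF c bc] bc by (simp add: coord_def)
    also have "\<dots> = h c \<omega>"
      unfolding h_def if_P[OF bc] by (rule bilinear_expand[OF chart_metric_inner(1)[OF c]]) (use bc in blast)
    finally show "metric M (b \<omega>) (V \<omega>) (U \<omega>) = h c \<omega>" .
  qed
qed

lemma tangent_measurable_field:
  assumes V: "continuous_field_on M X V" and b: "b \<in> borel_measurable N" "\<And>\<omega>. \<omega> \<in> space N \<Longrightarrow> b \<omega> \<in> X"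
  shows "tangent_measurable M N b (\<lambda>\<omega>. V (b \<omega>))"
  unfolding tangent_measurable_def
proof (intro conjI ballI b(1))
  fix c assume c: "c \<in> atlas M"
  have "continuous_on (X \<inter> fst c) (\<lambda>p. to_chart M c p (V p))" using V c by (simp add: continuous_field_on_def)
  then have 1: "(\<lambda>p. to_chart M c p (V p)) \<in> borel_measurable (restrict_space borel (X \<inter> fst c))"
    by (rule borel_measurable_continuous_on_restrict)
  have S: "{\<omega>\<in>space N. b \<omega> \<in> fst c} \<in> sets N"
    using measurable_sets[OF b(1), of "fst c"] chart_open(1)[OF c]
    by (simp add: vimage_def Int_def conj_commute)
  show "(\<lambda>\<omega>. if b \<omega> \<in> fst c then to_chart M c (b \<omega>) (V (b \<omega>)) else 0) \<in> borel_measurable N"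
  proof (subst measurable_If_restrict_space_iff[OF S], intro conjI)
    have "b \<in> measurable (restrict_space N {\<omega>. b \<omega> \<in> fst c}) (restrict_space borel (X \<inter> fst c))"
      using b by (intro measurable_restrict_space2 measurable_restrict_space1) (auto simp: space_restrict_space)
    from measurable_compose[OF this 1]
    show "(\<lambda>\<omega>. to_chart M c (b \<omega>) (V (b \<omega>))) \<in> borel_measurable (restrict_space N {\<omega>. b \<omega> \<in> fst c})" .
  qed auto
qed

lemma tangent_measurable_countable_choice:
  assumes V: "\<And>k::nat. tangent_measurable M N b (V k)" and K: "K \<in> measurable N (count_space UNIV)"
  shows "tangent_measurable M N b (\<lambda>\<omega>. V (K \<omega>) \<omega>)"
  unfolding tangent_measurable_def
proof (intro conjI ballI tangent_measurable_base[OF V])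
  fix c assume c: "c \<in> atlas M"
  show "(\<lambda>\<omega>. if b \<omega> \<in> fst c then to_chart M c (b \<omega>) (V (K \<omega>) \<omega>) else 0) \<in> borel_measurable N"
    by (rule measurable_compose_countable[OF tangent_measurable_chart[OF V c] K])
qed

lemma tangent_measurable_subalgebra:
  assumes "subalgebra N F" "tangent_measurable M F b V"
  shows "tangent_measurable M N b V"
  unfolding tangent_measurable_def
  by (intro conjI ballI measurable_from_subalg[OF assms(1)] tangent_measurable_base[OF assms(2)]
    tangent_measurable_chart[OF assms(2)])

end

context mixing_domain
begin

text \<open>The Frechet functional is continuous on \<open>X\<close>, so each of its nonempty strict sublevel sets meets a dense set.\<close>

lemma dispersion_less_dense:
  assumes Q: "Q \<subseteq> X" "\<forall>U. open U \<longrightarrow> U \<inter> X \<noteq> {} \<longrightarrow> U \<inter> Q \<noteq> {}"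
    and z: "\<And>i. z i \<in> X"
  shows "dispersion z < a \<longleftrightarrow> (\<exists>q\<in>Q. (\<Sum>i\<in>UNIV. (rdist M (z i) q)\<^sup>2) < a)"
proof
  assume "\<exists>q\<in>Q. (\<Sum>i\<in>UNIV. (rdist M (z i) q)\<^sup>2) < a"
  then show "dispersion z < a" using dispersion_le Q(1) by (meson le_less_trans subsetD)
next
  assume a: "dispersion z < a"
  let ?\<Phi> = "\<lambda>p. \<Sum>i\<in>UNIV. (rdist M (z i) p)\<^sup>2"
  have "X \<noteq> {}" using z by auto
  from dispersion_approx[OF this, of "a - dispersion z" z] a obtain p where p: "p \<in> X" "?\<Phi> p < a" by auto
  have "continuous_on X ?\<Phi>" by (intro continuous_intros rdist_continuous z)
  then obtain U where U: "open U" "U \<inter> X = ?\<Phi> -` {..<a} \<inter> X"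
    using continuous_on_open_invariant[of X ?\<Phi>] open_lessThan by metis
  then have "U \<inter> X \<noteq> {}" using p by auto
  then obtain q where "q \<in> U" "q \<in> Q" using Q(2) U(1) by blast
  then show "\<exists>q\<in>Q. ?\<Phi> q < a" using U(2) Q(1) by blast
qed

lemma rdist_measurable:
  assumes "b \<in> borel_measurable N" "\<And>\<omega>. \<omega> \<in> space N \<Longrightarrow> b \<omega> \<in> X" "q \<in> X"
  shows "(\<lambda>\<omega>. rdist M q (b \<omega>)) \<in> borel_measurable N"
  by (rule borel_measurable_continuous_on_range[OF assms(1,2) rdist_continuous[OF assms(3)]])

lemma sum_rdist_measurable:
  assumes "\<And>i. z i \<in> borel_measurable N" "\<And>i \<omega>. \<omega> \<in> space N \<Longrightarrow> z i \<omega> \<in> X" "q \<in> X"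
  shows "(\<lambda>\<omega>. \<Sum>i\<in>(UNIV :: 'n set). (rdist M (z i \<omega>) q)\<^sup>2) \<in> borel_measurable N"
proof -
  have "(\<lambda>\<omega>. \<Sum>i\<in>(UNIV :: 'n set). (rdist M q (z i \<omega>))\<^sup>2) \<in> borel_measurable N"
    by (intro borel_measurable_sum borel_measurable_power rdist_measurable assms)
  then show ?thesis
    by (rule measurable_cong[THEN iffD1, rotated]) (use rdist_sym[OF assms(2,3)] in simp)
qed

lemma dispersion_measurable:
  assumes z: "\<And>i. z i \<in> borel_measurable N" "\<And>i \<omega>. \<omega> \<in> space N \<Longrightarrow> z i \<omega> \<in> X"
  shows "(\<lambda>\<omega>. dispersion (\<lambda>i. z i \<omega>)) \<in> borel_measurable N"
  unfolding borel_measurable_iff_less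
proof
  fix a
  obtain Q where Q: "countable Q" "Q \<subseteq> X" "\<forall>U. open U \<longrightarrow> U \<inter> X \<noteq> {} \<longrightarrow> U \<inter> Q \<noteq> {}"
    by (rule countable_dense_subset)
  have "{\<omega>\<in>space N. dispersion (\<lambda>i. z i \<omega>) < a} =
      (\<Union>q\<in>Q. {\<omega>\<in>space N. (\<Sum>i\<in>UNIV. (rdist M (z i \<omega>) q)\<^sup>2) < a})"
    using dispersion_less_dense[OF Q(2,3) z(2)] by auto
  also have "\<dots> \<in> sets N"
    using sum_rdist_measurable[OF z] Q(1,2) by (intro sets.countable_UN') (auto simp: borel_measurable_iff_less)
  finally show "{\<omega>\<in>space N. dispersion (\<lambda>i. z i \<omega>) < a} \<in> sets N" .
qed

text \<open>A substitute for the Frechet mean whose measurability is clear: the first point of a dense sequence that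
  minimises the Frechet functional up to \<open>e\<close>. As \<open>p\<close> has countably many values, \<open>log\<^sub>z p\<close> is measurable if
  the logarithm of each fixed point is measurable.\<close>

lemma measurable_near_mean:
  fixes z :: "'n \<Rightarrow> 'w \<Rightarrow> 'm"
  assumes z: "\<And>i. z i \<in> borel_measurable N" "\<And>i \<omega>. \<omega> \<in> space N \<Longrightarrow> z i \<omega> \<in> X"
    and e: "e > 0" and ne: "space N \<noteq> {}"
  shows "\<exists>p. (\<forall>\<omega>\<in>space N. p \<omega> \<in> X \<and>
      (\<Sum>i\<in>UNIV. (rdist M (z i \<omega>) (p \<omega>))\<^sup>2) \<le> dispersion (\<lambda>i. z i \<omega>) + e) \<and>
    (\<forall>i. tangent_measurable M N (z i) (\<lambda>\<omega>. rlog M (z i \<omega>) (p \<omega>)))"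
proof -
  obtain Q where Q: "countable Q" "Q \<subseteq> X" "\<forall>U. open U \<longrightarrow> U \<inter> X \<noteq> {} \<longrightarrow> U \<inter> Q \<noteq> {}"
    by (rule countable_dense_subset)
  have "X \<noteq> {}" using ne z(2) by blast
  then have Qne: "Q \<noteq> {}" using Q(3)[rule_format, of UNIV] by auto
  define q where "q = from_nat_into Q"
  have q: "q k \<in> X" for k using from_nat_into[OF Qne] Q(2) by (auto simp: q_def)
  define near where "near k \<omega> \<longleftrightarrow> (\<Sum>i\<in>UNIV. (rdist M (z i \<omega>) (q k))\<^sup>2) < dispersion (\<lambda>i. z i \<omega>) + e" for k \<omega>
  define K where "K \<omega> = (LEAST k. near k \<omega>)" for \<omega>
  have near: "near (K \<omega>) \<omega>" if w: "\<omega> \<in> space N" for \<omega>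
  proof -
    have "dispersion (\<lambda>i. z i \<omega>) < dispersion (\<lambda>i. z i \<omega>) + e" using e by simp
    then have "\<exists>q'\<in>Q. (\<Sum>i\<in>UNIV. (rdist M (z i \<omega>) q')\<^sup>2) < dispersion (\<lambda>i. z i \<omega>) + e"
      by (rule dispersion_less_dense[OF Q(2,3) z(2)[OF w], THEN iffD1])
    then obtain q' where "q' \<in> Q" "(\<Sum>i\<in>UNIV. (rdist M (z i \<omega>) q')\<^sup>2) < dispersion (\<lambda>i. z i \<omega>) + e"
      by blast
    then have "near (to_nat_on Q q') \<omega>" using Q(1) by (simp add: near_def q_def)
    then show ?thesis unfolding K_def by (rule LeastI)
  qed
  have "Measurable.pred N (near k)" for k
    unfolding near_def[abs_def]
    by (intro borel_measurable_pred_less borel_measurable_add dispersion_measurable 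
      borel_measurable_const z sum_rdist_measurable q)
  then have K: "K \<in> measurable N (count_space UNIV)"
    unfolding K_def[abs_def] by (rule measurable_Least)
  have "tangent_measurable M N (z i) (\<lambda>\<omega>. rlog M (z i \<omega>) (q (K \<omega>)))" for i
    by (rule tangent_measurable_countable_choice[OF _ K, of _ "\<lambda>k \<omega>. rlog M (z i \<omega>) (q k)"])
      (rule tangent_measurable_field[OF rlog_field_continuous[OF q] z])
  then show ?thesis using near q unfolding near_def
    by (intro exI[of _ "\<lambda>\<omega>. q (K \<omega>)"]) (auto intro: less_imp_le)
qed

end

section \<open>Expected progress of one round\<close>

locale stochastic_rounds = mixing_domain M X D C1 C2 C4 W + prob_space P
  for M :: "('m::{t2_space,second_countable_topology}, 'e::euclidean_space) riemannian" and X D C1 C2 C4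
    and W :: "real^'n^'n" and P :: "'w measure" +
  fixes x :: "nat \<Rightarrow> 'n \<Rightarrow> 'w \<Rightarrow> 'm" and v :: "nat \<Rightarrow> 'n \<Rightarrow> 'w \<Rightarrow> 'e"
    and f :: "'n \<Rightarrow> 'm \<Rightarrow> real" and grad :: "'n \<Rightarrow> 'm \<Rightarrow> 'e"
    and \<delta> \<sigma> G :: real and \<eta> :: "nat \<Rightarrow> real" and T :: nat
  assumes x_measurable: "t \<in> {1..Suc T} \<Longrightarrow> x t i \<in> borel_measurable P"
    and x_in: "t \<in> {1..Suc T} \<Longrightarrow> \<omega> \<in> space P \<Longrightarrow> x t i \<omega> \<in> X"
    and y_in: "t \<in> {1..T} \<Longrightarrow> \<omega> \<in> space P \<Longrightarrow> rexp M (x t i \<omega>) (- \<eta> t *\<^sub>R v t i \<omega>) \<in> X"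
    and round: "t \<in> {1..T} \<Longrightarrow> \<omega> \<in> space P \<Longrightarrow>
      x (Suc t) i \<omega> = consensus_step (\<lambda>i. rexp M (x t i \<omega>) (- \<eta> t *\<^sub>R v t i \<omega>)) i"
    and \<eta>: "t \<in> {1..T} \<Longrightarrow> \<eta> t \<ge> 0" "t \<in> {1..T} \<Longrightarrow> \<eta> t * G \<le> D"
    and \<delta>_nonneg: "\<delta> \<ge> 0"
    and grad_bound: "p \<in> X \<Longrightarrow> norm_at M p (grad i p) \<le> \<delta>"
    and f_convex: "geodesically_convex_fun M X (f i) (grad i)"
    and unbiased: "t \<in> {1..T} \<Longrightarrow>
      tangent_cond_exp M P (iterate_filtration P x t) (x t i) (v t i) (\<lambda>\<omega>. grad i (x t i \<omega>))"
    and variance: "t \<in> {1..T} \<Longrightarrow> AE \<omega> in P. real_cond_exp P (iterate_filtration P x t)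
      (\<lambda>\<omega>. (norm_at M (x t i \<omega>) (v t i \<omega> - grad i (x t i \<omega>)))\<^sup>2) \<omega> \<le> \<sigma>\<^sup>2"
    and v_bound: "t \<in> {1..T} \<Longrightarrow> AE \<omega> in P. norm_at M (x t i \<omega>) (v t i \<omega>) \<le> G"
begin

abbreviation Fil :: "nat \<Rightarrow> 'w measure" where "Fil \<equiv> iterate_filtration P x"

lemma Fil: "t \<in> {1..T} \<Longrightarrow> subalgebra P (Fil t)" "space (Fil t) = space P"
proof -
  have sub: "{x k i -` A \<inter> space P | k i A. k \<in> {1..t} \<and> A \<in> sets borel} \<subseteq> Pow (space P)" by auto
  then show sp: "space (Fil t) = space P" by (simp add: iterate_filtration_def space_measure_of)
  assume t: "t \<in> {1..T}"
  have "x k i -` A \<inter> space P \<in> sets P" if "k \<in> {1..t}" "A \<in> sets borel" for k i A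
    using measurable_sets[OF x_measurable that(2)] that(1) t by simp
  then have "{x k i -` A \<inter> space P | k i A. k \<in> {1..t} \<and> A \<in> sets borel} \<subseteq> sets P" by blast
  then have "sets (Fil t) \<subseteq> sets P"
    unfolding iterate_filtration_def sets_measure_of[OF sub] by (rule sets.sigma_sets_subset)
  then show "subalgebra P (Fil t)" using sp by (simp add: subalgebra_def)
qed

lemma sigma_finite_Fil: "t \<in> {1..T} \<Longrightarrow> sigma_finite_subalgebra P (Fil t)"
  by (intro finite_measure_subalgebra_is_sigma_finite finite_measure_subalgebra.intro
    finite_measure_subalgebra_axioms.intro Fil finite_measure_axioms)

lemma tangent_measurable_v: "t \<in> {1..T} \<Longrightarrow> tangent_measurable M P (x t i) (v t i)"
  and tangent_measurable_grad: "t \<in> {1..T} \<Longrightarrow> tangent_measurable M (Fil t) (x t i) (\<lambda>\<omega>. grad i (x t i \<omega>))"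
  using unbiased[of t i] unfolding tangent_cond_exp_def by blast+

lemma tangent_measurable_grad': "t \<in> {1..T} \<Longrightarrow> tangent_measurable M P (x t i) (\<lambda>\<omega>. grad i (x t i \<omega>))"
  using tangent_measurable_subalgebra[OF Fil(1) tangent_measurable_grad] by blast

lemma integrable_metric_bounded:
  assumes "tangent_measurable M P b V" "tangent_measurable M P b U"
    and "AE \<omega> in P. norm_at M (b \<omega>) (V \<omega>) \<le> K" "AE \<omega> in P. norm_at M (b \<omega>) (U \<omega>) \<le> K'"
  shows "integrable P (\<lambda>\<omega>. metric M (b \<omega>) (V \<omega>) (U \<omega>))"
proof (rule integrable_const_bound[of _ "K * K'"])
  show "AE \<omega> in P. norm (metric M (b \<omega>) (V \<omega>) (U \<omega>)) \<le> K * K'"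
    using assms(3,4)
  proof eventually_elim
    fix \<omega> assume le: "norm_at M (b \<omega>) (V \<omega>) \<le> K" "norm_at M (b \<omega>) (U \<omega>) \<le> K'"
    have "norm (metric M (b \<omega>) (V \<omega>) (U \<omega>)) \<le> norm_at M (b \<omega>) (V \<omega>) * norm_at M (b \<omega>) (U \<omega>)"
      using metric_Cauchy_Schwarz by simp
    also have "\<dots> \<le> K * K'"
      using le order_trans[OF norm_at_nonneg le(1)] norm_at_nonneg by (intro mult_mono) auto
    finally show "norm (metric M (b \<omega>) (V \<omega>) (U \<omega>)) \<le> K * K'" .
  qed
qed (rule metric_measurable[OF assms(1,2)])

lemma expectation_inner:
  assumes t: "t \<in> {1..T}" and U: "tangent_measurable M (Fil t) (x t i) U"
    and bound: "\<And>\<omega>. \<omega> \<in> space P \<Longrightarrow> norm_at M (x t i \<omega>) (U \<omega>) \<le> K"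
  shows "integrable P (\<lambda>\<omega>. metric M (x t i \<omega>) (v t i \<omega>) (U \<omega>))"
    and "integrable P (\<lambda>\<omega>. metric M (x t i \<omega>) (grad i (x t i \<omega>)) (U \<omega>))"
    and "(\<integral>\<omega>. metric M (x t i \<omega>) (v t i \<omega>) (U \<omega>) \<partial>P) =
         (\<integral>\<omega>. metric M (x t i \<omega>) (grad i (x t i \<omega>)) (U \<omega>) \<partial>P)"
proof -
  interpret sigma_finite_subalgebra P "Fil t" by (rule sigma_finite_Fil[OF t])
  have t': "t \<in> {1..Suc T}" using t by simp
  note UP = tangent_measurable_subalgebra[OF Fil(1)[OF t] U]
  have b: "AE \<omega> in P. norm_at M (x t i \<omega>) (U \<omega>) \<le> K" using bound by (intro AE_I2)
  have gb: "AE \<omega> in P. norm_at M (x t i \<omega>) (grad i (x t i \<omega>)) \<le> \<delta>"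
    using grad_bound x_in[OF t'] by (intro AE_I2) blast
  show int: "integrable P (\<lambda>\<omega>. metric M (x t i \<omega>) (v t i \<omega>) (U \<omega>))"
    by (rule integrable_metric_bounded[OF tangent_measurable_v[OF t] UP v_bound[OF t] b])
  show "integrable P (\<lambda>\<omega>. metric M (x t i \<omega>) (grad i (x t i \<omega>)) (U \<omega>))"
    by (rule integrable_metric_bounded[OF tangent_measurable_grad'[OF t] UP gb b])
  have "AE \<omega> in P. real_cond_exp P (Fil t) (\<lambda>\<omega>. metric M (x t i \<omega>) (v t i \<omega>) (U \<omega>)) \<omega>
      = metric M (x t i \<omega>) (grad i (x t i \<omega>)) (U \<omega>)"
    using unbiased[OF t, of i] U bound unfolding tangent_cond_exp_def by blast
  then have "(\<integral>\<omega>. real_cond_exp P (Fil t) (\<lambda>\<omega>. metric M (x t i \<omega>) (v t i \<omega>) (U \<omega>)) \<omega> \<partial>P)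
      = (\<integral>\<omega>. metric M (x t i \<omega>) (grad i (x t i \<omega>)) (U \<omega>) \<partial>P)"
    by (intro integral_cong_AE metric_measurable tangent_measurable_grad'[OF t] UP) auto
  then show "(\<integral>\<omega>. metric M (x t i \<omega>) (v t i \<omega>) (U \<omega>) \<partial>P) =
         (\<integral>\<omega>. metric M (x t i \<omega>) (grad i (x t i \<omega>)) (U \<omega>) \<partial>P)"
    using real_cond_exp_int(2)[OF int] by simp
qed

text \<open>In the expansion of \<open>\<bar>v - grad\<bar>\<^sup>2\<close> the cross term has expectation \<open>\<bar>grad\<bar>\<^sup>2\<close>, by unbiasedness tested against the
  gradient itself.\<close>

lemma second_moment:
  assumes t: "t \<in> {1..T}"
  shows "integrable P (\<lambda>\<omega>. (norm_at M (x t i \<omega>) (v t i \<omega>))\<^sup>2)"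
    and "(\<integral>\<omega>. (norm_at M (x t i \<omega>) (v t i \<omega>))\<^sup>2 \<partial>P) \<le> \<sigma>\<^sup>2 + \<delta>\<^sup>2"
proof -
  interpret sigma_finite_subalgebra P "Fil t" by (rule sigma_finite_Fil[OF t])
  have t': "t \<in> {1..Suc T}" using t by simp
  let ?b = "x t i" and ?v = "v t i" and ?g = "\<lambda>\<omega>. grad i (x t i \<omega>)"
  have gb: "norm_at M (?b \<omega>) (?g \<omega>) \<le> \<delta>" if "\<omega> \<in> space P" for \<omega>
    using grad_bound x_in[OF t' that] by blast
  note vm = tangent_measurable_v[OF t, of i] and gm = tangent_measurable_grad'[OF t, of i]
  have vv: "integrable P (\<lambda>\<omega>. metric M (?b \<omega>) (?v \<omega>) (?v \<omega>))"
    by (rule integrable_metric_bounded[OF vm vm v_bound[OF t] v_bound[OF t]])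
  then show "integrable P (\<lambda>\<omega>. (norm_at M (?b \<omega>) (?v \<omega>))\<^sup>2)" by (simp add: metric_self(1))
  note vg = expectation_inner[OF t tangent_measurable_grad[OF t] gb]
  have ex: "(norm_at M (?b \<omega>) (?v \<omega> - ?g \<omega>))\<^sup>2 = metric M (?b \<omega>) (?v \<omega>) (?v \<omega>)
      - 2 * metric M (?b \<omega>) (?v \<omega>) (?g \<omega>) + metric M (?b \<omega>) (?g \<omega>) (?g \<omega>)" for \<omega>
    using metric_sym[of "?b \<omega>" "?v \<omega>" "?g \<omega>"] by (simp add: metric_self(1)[symmetric] metric_simps(3,4))
  have int: "integrable P (\<lambda>\<omega>. (norm_at M (?b \<omega>) (?v \<omega> - ?g \<omega>))\<^sup>2)"
    unfolding ex by (intro Bochner_Integration.integrable_add Bochner_Integration.integrable_diff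
      integrable_mult_right vv vg(1,2))
  have "(\<integral>\<omega>. (norm_at M (?b \<omega>) (?v \<omega> - ?g \<omega>))\<^sup>2 \<partial>P)
      = (\<integral>\<omega>. real_cond_exp P (Fil t) (\<lambda>\<omega>. (norm_at M (?b \<omega>) (?v \<omega> - ?g \<omega>))\<^sup>2) \<omega> \<partial>P)"
    using real_cond_exp_int(2)[OF int] by simp
  also have "\<dots> \<le> (\<integral>\<omega>. \<sigma>\<^sup>2 \<partial>P)"
    by (intro integral_mono_AE real_cond_exp_int(1)[OF int] variance[OF t]) simp
  finally have var: "(\<integral>\<omega>. (norm_at M (?b \<omega>) (?v \<omega> - ?g \<omega>))\<^sup>2 \<partial>P) \<le> \<sigma>\<^sup>2" by (simp add: prob_space)
  have "(\<integral>\<omega>. (norm_at M (?b \<omega>) (?v \<omega> - ?g \<omega>))\<^sup>2 \<partial>P) = (\<integral>\<omega>. metric M (?b \<omega>) (?v \<omega>) (?v \<omega>) \<partial>P)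
      - 2 * (\<integral>\<omega>. metric M (?b \<omega>) (?v \<omega>) (?g \<omega>) \<partial>P) + (\<integral>\<omega>. metric M (?b \<omega>) (?g \<omega>) (?g \<omega>) \<partial>P)"
    unfolding ex using vv vg(1,2) by simp
  then have "(\<integral>\<omega>. metric M (?b \<omega>) (?v \<omega>) (?v \<omega>) \<partial>P) \<le> \<sigma>\<^sup>2 + (\<integral>\<omega>. metric M (?b \<omega>) (?g \<omega>) (?g \<omega>) \<partial>P)"
    using var vg(3) by simp
  also have "(\<integral>\<omega>. metric M (?b \<omega>) (?g \<omega>) (?g \<omega>) \<partial>P) \<le> (\<integral>\<omega>. \<delta>\<^sup>2 \<partial>P)"
    by (intro integral_mono vg(2)) (auto simp: metric_self(1) intro!: power_mono gb norm_at_nonneg)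
  finally show "(\<integral>\<omega>. (norm_at M (?b \<omega>) (?v \<omega>))\<^sup>2 \<partial>P) \<le> \<sigma>\<^sup>2 + \<delta>\<^sup>2"
    by (simp add: prob_space metric_self(1))
qed

lemma small_steps:
  assumes t: "t \<in> {1..T}"
  shows "AE \<omega> in P. \<forall>i. \<eta> t * norm_at M (x t i \<omega>) (v t i \<omega>) \<le> D"
proof -
  have "AE \<omega> in P. \<forall>i\<in>UNIV. norm_at M (x t i \<omega>) (v t i \<omega>) \<le> G"
    using v_bound[OF t] by (intro AE_finite_allI) auto
  then show ?thesis
  proof eventually_elim
    fix \<omega> assume le: "\<forall>i\<in>UNIV. norm_at M (x t i \<omega>) (v t i \<omega>) \<le> G"
    show "\<forall>i. \<eta> t * norm_at M (x t i \<omega>) (v t i \<omega>) \<le> D"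
    proof
      fix i
      have "\<eta> t * norm_at M (x t i \<omega>) (v t i \<omega>) \<le> \<eta> t * G"
        using le \<eta>(1)[OF t] by (intro mult_left_mono) auto
      then show "\<eta> t * norm_at M (x t i \<omega>) (v t i \<omega>) \<le> D" using \<eta>(2)[OF t] by linarith
    qed
  qed
qed

text \<open>The point \<open>p\<close> is the optimum in the recursion for the distances and a near-mean in that for the dispersion.\<close>

definition increment :: "nat \<Rightarrow> ('w \<Rightarrow> 'm) \<Rightarrow> 'w \<Rightarrow> real" where
  "increment t p \<omega> = (\<Sum>i\<in>UNIV. C1 * (\<eta> t)\<^sup>2 * (norm_at M (x t i \<omega>) (v t i \<omega>))\<^sup>2
        + 2 * \<eta> t * metric M (x t i \<omega>) (v t i \<omega>) (rlog M (x t i \<omega>) (p \<omega>)))"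

definition slope :: "nat \<Rightarrow> ('w \<Rightarrow> 'm) \<Rightarrow> 'w \<Rightarrow> real" where
  "slope t p \<omega> = (\<Sum>i\<in>UNIV. metric M (x t i \<omega>) (grad i (x t i \<omega>)) (rlog M (x t i \<omega>) (p \<omega>)))"

lemma expectation_round:
  assumes t: "t \<in> {1..T}"
    and p: "\<And>\<omega>. \<omega> \<in> space P \<Longrightarrow> p \<omega> \<in> X"
    and meas: "\<And>i. tangent_measurable M (Fil t) (x t i) (\<lambda>\<omega>. rlog M (x t i \<omega>) (p \<omega>))"
  shows "integrable P (increment t p)"
    and "integrable P (slope t p)"
    and "(\<integral>\<omega>. increment t p \<omega> \<partial>P) \<le> real CARD('n) * C1 * (\<eta> t)\<^sup>2 * (\<sigma>\<^sup>2 + \<delta>\<^sup>2) + 2 * \<eta> t * (\<integral>\<omega>. slope t p \<omega> \<partial>P)"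
proof -
  have t': "t \<in> {1..Suc T}" using t by simp
  have "norm_at M (x t i \<omega>) (rlog M (x t i \<omega>) (p \<omega>)) \<le> D" if "\<omega> \<in> space P" for i \<omega>
    using norm_rlog[OF x_in[OF t' that] p[OF that]] diameter[OF x_in[OF t' that] p[OF that]] by simp
  note in1 = expectation_inner[OF t meas this]
  note sm = second_moment[OF t]
  show "integrable P (increment t p)"
    unfolding increment_def
    by (intro Bochner_Integration.integrable_sum Bochner_Integration.integrable_add integrable_mult_right sm in1)
  show "integrable P (slope t p)" unfolding slope_def by (intro Bochner_Integration.integrable_sum in1)
  have "(\<integral>\<omega>. increment t p \<omega> \<partial>P) = (\<Sum>i\<in>UNIV. C1 * (\<eta> t)\<^sup>2 * (\<integral>\<omega>. (norm_at M (x t i \<omega>) (v t i \<omega>))\<^sup>2 \<partial>P)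
        + 2 * \<eta> t * (\<integral>\<omega>. metric M (x t i \<omega>) (v t i \<omega>) (rlog M (x t i \<omega>) (p \<omega>)) \<partial>P))"
    using sm(1) in1(1) unfolding increment_def by (subst Bochner_Integration.integral_sum) auto
  also have "\<dots> \<le> (\<Sum>i::'n\<in>UNIV. C1 * (\<eta> t)\<^sup>2 * (\<sigma>\<^sup>2 + \<delta>\<^sup>2)
        + 2 * \<eta> t * (\<integral>\<omega>. metric M (x t i \<omega>) (grad i (x t i \<omega>)) (rlog M (x t i \<omega>) (p \<omega>)) \<partial>P))"
    using C1 sm(2) \<eta>(1)[OF t] by (intro sum_mono add_mono mult_left_mono) (auto simp: in1(3))
  also have "\<dots> = real CARD('n) * C1 * (\<eta> t)\<^sup>2 * (\<sigma>\<^sup>2 + \<delta>\<^sup>2) + 2 * \<eta> t * (\<integral>\<omega>. slope t p \<omega> \<partial>P)"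
    using in1(2) unfolding slope_def by (simp add: sum.distrib sum_distrib_left)
  finally show "(\<integral>\<omega>. increment t p \<omega> \<partial>P) \<le> real CARD('n) * C1 * (\<eta> t)\<^sup>2 * (\<sigma>\<^sup>2 + \<delta>\<^sup>2) + 2 * \<eta> t * (\<integral>\<omega>. slope t p \<omega> \<partial>P)" .
qed

definition disp :: "nat \<Rightarrow> 'w \<Rightarrow> real" where
  "disp t \<omega> = dispersion (\<lambda>i. x t i \<omega>)"

lemma disp_integrable:
  assumes "t \<in> {1..Suc T}"
  shows "integrable P (disp t)" and "\<And>\<omega>. \<omega> \<in> space P \<Longrightarrow> disp t \<omega> \<ge> 0"
proof -
  have ne: "X \<noteq> {}" using not_empty x_in[OF assms] by blast
  show nn: "disp t \<omega> \<ge> 0" for \<omega> by (simp add: disp_def dispersion_nonneg[OF ne])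
  have "disp t \<omega> \<le> real CARD('n) * D\<^sup>2" if w: "\<omega> \<in> space P" for \<omega>
  proof -
    obtain p where p: "p \<in> X" using ne by blast
    have "disp t \<omega> \<le> (\<Sum>i\<in>UNIV. (rdist M (x t i \<omega>) p)\<^sup>2)" unfolding disp_def by (rule dispersion_le[OF p])
    also have "\<dots> \<le> (\<Sum>i::'n\<in>UNIV. D\<^sup>2)"
      by (intro sum_mono power_mono diameter rdist_nonneg x_in[OF assms w] p)
    finally show ?thesis by simp
  qed
  then show "integrable P (disp t)"
    using nn by (intro integrable_const_bound[of _ "real CARD('n) * D\<^sup>2"] AE_I2)
      (auto simp: disp_def[abs_def] intro!: dispersion_measurable x_measurable[OF assms] x_in[OF assms])
qed

definition sqdist_to :: "'m \<Rightarrow> nat \<Rightarrow> 'w \<Rightarrow> real" where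
  "sqdist_to q t \<omega> = (\<Sum>i\<in>UNIV. (rdist M q (x t i \<omega>))\<^sup>2)"

lemma sqdist_to_integrable:
  assumes "t \<in> {1..Suc T}" "q \<in> X"
  shows "integrable P (sqdist_to q t)"
proof (rule integrable_const_bound[of _ "real CARD('n) * D\<^sup>2"])
  show "AE \<omega> in P. norm (sqdist_to q t \<omega>) \<le> real CARD('n) * D\<^sup>2"
  proof (rule AE_I2)
    fix \<omega> assume w: "\<omega> \<in> space P"
    have "sqdist_to q t \<omega> \<le> (\<Sum>i::'n\<in>UNIV. D\<^sup>2)" unfolding sqdist_to_def
      by (intro sum_mono power_mono diameter rdist_nonneg x_in[OF assms(1) w] assms(2))
    moreover have "sqdist_to q t \<omega> \<ge> 0" by (simp add: sqdist_to_def sum_nonneg)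
    ultimately show "norm (sqdist_to q t \<omega>) \<le> real CARD('n) * D\<^sup>2" by simp
  qed
  show "sqdist_to q t \<in> borel_measurable P" unfolding sqdist_to_def[abs_def]
    by (intro borel_measurable_sum borel_measurable_power rdist_measurable x_measurable[OF assms(1)]
      x_in[OF assms(1)] assms(2))
qed

lemma x_measurable_Fil: "t \<in> {1..T} \<Longrightarrow> x t i \<in> borel_measurable (Fil t)"
  using tangent_measurable_base[OF tangent_measurable_grad] .

lemma distance_recursion:
  assumes t: "t \<in> {1..T}" and q: "q \<in> X"
  shows "(\<integral>\<omega>. sqdist_to q (Suc t) \<omega> \<partial>P) \<le> (\<integral>\<omega>. sqdist_to q t \<omega> \<partial>P) + real CARD('n) * C1 * (\<eta> t)\<^sup>2 * (\<sigma>\<^sup>2 + \<delta>\<^sup>2)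
     + 2 * \<eta> t * (\<integral>\<omega>. slope t (\<lambda>_. q) \<omega> \<partial>P)"
proof -
  have t': "t \<in> {1..Suc T}" "Suc t \<in> {1..Suc T}" using t by auto
  have m: "tangent_measurable M (Fil t) (x t i) (\<lambda>\<omega>. rlog M (x t i \<omega>) q)" for i
    using tangent_measurable_field[OF rlog_field_continuous[OF q] x_measurable_Fil[OF t], of i] x_in[OF t'(1)]
    by (simp add: Fil)
  note r = expectation_round[OF t q m]
  let ?h = "increment t (\<lambda>\<omega>. q)"
  have "(\<integral>\<omega>. sqdist_to q (Suc t) \<omega> \<partial>P) \<le> (\<integral>\<omega>. sqdist_to q t \<omega> + ?h \<omega> \<partial>P)"
  proof (intro integral_mono_AE sqdist_to_integrable t' q Bochner_Integration.integrable_add r(1))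
    show "AE \<omega> in P. sqdist_to q (Suc t) \<omega> \<le> sqdist_to q t \<omega> + ?h \<omega>"
      using small_steps[OF t] AE_space
    proof eventually_elim
      fix \<omega> assume s: "\<forall>i. \<eta> t * norm_at M (x t i \<omega>) (v t i \<omega>) \<le> D" and w: "\<omega> \<in> space P"
      have "sqdist_to q (Suc t) \<omega> \<le> (\<Sum>i\<in>UNIV. (rdist M q (x t i \<omega>))\<^sup>2
          + C1 * (\<eta> t)\<^sup>2 * (norm_at M (x t i \<omega>) (v t i \<omega>))\<^sup>2
          + 2 * \<eta> t * metric M (x t i \<omega>) (v t i \<omega>) (rlog M (x t i \<omega>) q))"
        unfolding sqdist_to_def round[OF t w]
        using x_in[OF t'(2) w] s by (intro round_distance x_in[OF t'(1) w] y_in[OF t w] \<eta>(1)[OF t] q)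
          (auto simp: round[OF t w])
      also have "\<dots> = sqdist_to q t \<omega> + ?h \<omega>" by (simp add: sqdist_to_def increment_def sum.distrib)
      finally show "sqdist_to q (Suc t) \<omega> \<le> sqdist_to q t \<omega> + ?h \<omega>" .
    qed
  qed
  also have "\<dots> = (\<integral>\<omega>. sqdist_to q t \<omega> \<partial>P) + (\<integral>\<omega>. ?h \<omega> \<partial>P)"
    by (intro Bochner_Integration.integral_add sqdist_to_integrable t' q r(1))
  finally show ?thesis using r(3) by simp
qed

text \<open>The gradient step is compared with a measurable near-mean \<open>p\<close>. The drift towards the
  individual optima costs \<open>2 \<eta> \<delta> d(x\<^sub>i, p) \<le> rate d\<^sup>2(x\<^sub>i, p) + \<eta>\<^sup>2 \<delta>\<^sup>2 / rate\<close>, which turns the factor \<open>1 - rate\<close>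
  into \<open>1 - rate\<^sup>2\<close>.\<close>

lemma dispersion_recursion:
  assumes t: "t \<in> {1..T}"
  shows "(\<integral>\<omega>. disp (Suc t) \<omega> \<partial>P) \<le> (1 - rate) * ((1 + rate) * (\<integral>\<omega>. disp t \<omega> \<partial>P)
     + real CARD('n) * (\<eta> t)\<^sup>2 * (C1 * (\<sigma>\<^sup>2 + \<delta>\<^sup>2) + \<delta>\<^sup>2 / rate))" (is "_ \<le> ?R")
proof (rule le_of_le_add_small)
  fix e :: real assume e: "0 < e" "e \<le> 1"
  have t': "t \<in> {1..Suc T}" "Suc t \<in> {1..Suc T}" using t by auto
  have "space (Fil t) \<noteq> {}" using not_empty by (simp add: Fil)
  from measurable_near_mean[of "x t" "Fil t", OF x_measurable_Fil[OF t] _ e(1) this] x_in[OF t'(1)]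
  obtain p where p: "\<forall>\<omega>\<in>space P. p \<omega> \<in> X \<and>
      (\<Sum>i\<in>UNIV. (rdist M (x t i \<omega>) (p \<omega>))\<^sup>2) \<le> disp t \<omega> + e"
    and m: "\<forall>i. tangent_measurable M (Fil t) (x t i) (\<lambda>\<omega>. rlog M (x t i \<omega>) (p \<omega>))"
    by (auto simp: Fil disp_def)
  have pX: "p \<omega> \<in> X" if "\<omega> \<in> space P" for \<omega> using p that by blast
  note r = expectation_round[OF t pX m[rule_format]]
  let ?h = "increment t p"
  let ?k = "slope t p"
  let ?n = "real CARD('n)" and ?\<eta> = "\<eta> t"
  note di = disp_integrable(1)[OF t'(1)]
  have young: "2 * ?\<eta> * ?k \<omega> \<le> rate * (disp t \<omega> + e) + ?n * (?\<eta>\<^sup>2 * \<delta>\<^sup>2 / rate)" if w: "\<omega> \<in> space P" for \<omega>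
  proof -
    have one: "2 * ?\<eta> * metric M (x t i \<omega>) (grad i (x t i \<omega>)) (rlog M (x t i \<omega>) (p \<omega>))
        \<le> rate * (rdist M (x t i \<omega>) (p \<omega>))\<^sup>2 + ?\<eta>\<^sup>2 * \<delta>\<^sup>2 / rate" for i
    proof -
      let ?d = "rdist M (x t i \<omega>) (p \<omega>)"
      have xi: "x t i \<omega> \<in> X" by (rule x_in[OF t'(1) w])
      have "metric M (x t i \<omega>) (grad i (x t i \<omega>)) (rlog M (x t i \<omega>) (p \<omega>))
          \<le> norm_at M (x t i \<omega>) (grad i (x t i \<omega>)) * norm_at M (x t i \<omega>) (rlog M (x t i \<omega>) (p \<omega>))"
        using metric_Cauchy_Schwarz abs_le_D1 by blast
      also have "\<dots> \<le> \<delta> * ?d"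
        unfolding norm_rlog[OF xi pX[OF w]]
        by (intro mult_right_mono grad_bound xi rdist_nonneg pX[OF w])
      finally have "2 * ?\<eta> * metric M (x t i \<omega>) (grad i (x t i \<omega>)) (rlog M (x t i \<omega>) (p \<omega>)) \<le> 2 * ?\<eta> * (\<delta> * ?d)"
        using \<eta>(1)[OF t] by (intro mult_left_mono) auto
      also have "\<dots> \<le> rate * ?d\<^sup>2 + ?\<eta>\<^sup>2 * \<delta>\<^sup>2 / rate"
      proof -
        have "0 \<le> (rate * ?d - ?\<eta> * \<delta>)\<^sup>2 / rate" using rate(1) by simp
        also have "\<dots> = rate * ?d\<^sup>2 + ?\<eta>\<^sup>2 * \<delta>\<^sup>2 / rate - 2 * ?\<eta> * (\<delta> * ?d)"
          using rate(1) by (simp add: power2_eq_square field_simps)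
        finally show ?thesis by simp
      qed
      finally show ?thesis .
    qed
    have "2 * ?\<eta> * ?k \<omega> \<le> (\<Sum>i\<in>UNIV. rate * (rdist M (x t i \<omega>) (p \<omega>))\<^sup>2 + ?\<eta>\<^sup>2 * \<delta>\<^sup>2 / rate)"
      unfolding slope_def sum_distrib_left by (intro sum_mono one)
    also have "\<dots> = rate * (\<Sum>i\<in>UNIV. (rdist M (x t i \<omega>) (p \<omega>))\<^sup>2) + ?n * (?\<eta>\<^sup>2 * \<delta>\<^sup>2 / rate)"
      by (simp add: sum.distrib sum_distrib_left)
    also have "\<dots> \<le> rate * (disp t \<omega> + e) + ?n * (?\<eta>\<^sup>2 * \<delta>\<^sup>2 / rate)"
      using p w rate(1) by (intro add_right_mono mult_left_mono) auto
    finally show ?thesis .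
  qed
  have "2 * ?\<eta> * (\<integral>\<omega>. ?k \<omega> \<partial>P) = (\<integral>\<omega>. 2 * ?\<eta> * ?k \<omega> \<partial>P)" by simp
  also have "\<dots> \<le> (\<integral>\<omega>. rate * (disp t \<omega> + e) + ?n * (?\<eta>\<^sup>2 * \<delta>\<^sup>2 / rate) \<partial>P)"
    by (intro integral_mono integrable_mult_right r(2) Bochner_Integration.integrable_add di integrable_const young)
  also have "\<dots> = rate * ((\<integral>\<omega>. disp t \<omega> \<partial>P) + e) + ?n * (?\<eta>\<^sup>2 * \<delta>\<^sup>2 / rate)"
    using di by (simp add: prob_space)
  finally have k: "2 * ?\<eta> * (\<integral>\<omega>. ?k \<omega> \<partial>P) \<le> rate * ((\<integral>\<omega>. disp t \<omega> \<partial>P) + e) + ?n * (?\<eta>\<^sup>2 * \<delta>\<^sup>2 / rate)" .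
  have "(\<integral>\<omega>. disp (Suc t) \<omega> \<partial>P) \<le> (\<integral>\<omega>. (1 - rate) * (disp t \<omega> + e + ?h \<omega>) \<partial>P)"
  proof (intro integral_mono_AE disp_integrable(1) t' Bochner_Integration.integrable_add r(1)
      integrable_mult_right integrable_const)
    show "AE \<omega> in P. disp (Suc t) \<omega> \<le> (1 - rate) * (disp t \<omega> + e + ?h \<omega>)"
      using small_steps[OF t] AE_space
    proof eventually_elim
      fix \<omega> assume s: "\<forall>i. \<eta> t * norm_at M (x t i \<omega>) (v t i \<omega>) \<le> D" and w: "\<omega> \<in> space P"
      have eq: "(\<lambda>i. x (Suc t) i \<omega>) = consensus_step (\<lambda>i. rexp M (x t i \<omega>) (- \<eta> t *\<^sub>R v t i \<omega>))"
        using round[OF t w] by blast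
      have "disp (Suc t) \<omega> \<le> (1 - rate) * (\<Sum>i\<in>UNIV. (rdist M (p \<omega>) (x t i \<omega>))\<^sup>2
          + C1 * (\<eta> t)\<^sup>2 * (norm_at M (x t i \<omega>) (v t i \<omega>))\<^sup>2
          + 2 * \<eta> t * metric M (x t i \<omega>) (v t i \<omega>) (rlog M (x t i \<omega>) (p \<omega>)))"
        unfolding disp_def eq
        using x_in[OF t'(2) w] s by (intro round_dispersion x_in[OF t'(1) w] y_in[OF t w] \<eta>(1)[OF t] pX[OF w])
          (auto simp: round[OF t w])
      also have "\<dots> = (1 - rate) * ((\<Sum>i\<in>UNIV. (rdist M (x t i \<omega>) (p \<omega>))\<^sup>2) + ?h \<omega>)"
        by (simp add: increment_def sum.distrib rdist_sym[OF pX[OF w] x_in[OF t'(1) w]])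
      also have "\<dots> \<le> (1 - rate) * (disp t \<omega> + e + ?h \<omega>)"
        using p w rate(4) by (intro mult_left_mono add_right_mono) auto
      finally show "disp (Suc t) \<omega> \<le> (1 - rate) * (disp t \<omega> + e + ?h \<omega>)" .
    qed
  qed
  also have "\<dots> = (1 - rate) * ((\<integral>\<omega>. disp t \<omega> \<partial>P) + e + (\<integral>\<omega>. ?h \<omega> \<partial>P))"
    using di r(1) by (simp add: prob_space)
  also have "\<dots> \<le> (1 - rate) * ((\<integral>\<omega>. disp t \<omega> \<partial>P) + e + (?n * C1 * ?\<eta>\<^sup>2 * (\<sigma>\<^sup>2 + \<delta>\<^sup>2)
      + (rate * ((\<integral>\<omega>. disp t \<omega> \<partial>P) + e) + ?n * (?\<eta>\<^sup>2 * \<delta>\<^sup>2 / rate))))"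
    using r(3) k rate(4) by (intro mult_left_mono add_left_mono) auto
  also have "\<dots> = ?R + e * ((1 - rate) * (1 + rate))"
    by (simp add: algebra_simps)
  finally show "(\<integral>\<omega>. disp (Suc t) \<omega> \<partial>P) \<le> ?R + e * ((1 - rate) * (1 + rate))" .
qed

lemma expected_gap:
  assumes t: "t \<in> {1..T}" and q: "is_arg_min (\<lambda>p. \<Sum>i\<in>UNIV. f i p) (\<lambda>p. p \<in> X) q"
    and mean: "\<And>\<omega>. \<omega> \<in> space P \<Longrightarrow> is_frechet_mean M X (\<lambda>i. x t i \<omega>) (m \<omega>)"
  shows "(\<integral>\<omega>. (\<Sum>i\<in>UNIV. f i (m \<omega>)) - (\<Sum>i\<in>UNIV. f i q) \<partial>P) \<le> \<delta> * sqrt (real CARD('n) * (\<integral>\<omega>. disp t \<omega> \<partial>P))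
     - (\<integral>\<omega>. slope t (\<lambda>_. q) \<omega> \<partial>P)"
proof -
  have t': "t \<in> {1..Suc T}" using t by simp
  have qX: "q \<in> X" using q by (simp add: is_arg_min_def)
  have mt: "tangent_measurable M (Fil t) (x t i) (\<lambda>\<omega>. rlog M (x t i \<omega>) q)" for i
    using tangent_measurable_field[OF rlog_field_continuous[OF qX] x_measurable_Fil[OF t], of i] x_in[OF t']
    by (simp add: Fil)
  note r = expectation_round[OF t qX mt]
  let ?k = "slope t (\<lambda>\<omega>. q)"
  let ?gap = "\<lambda>\<omega>. (\<Sum>i\<in>UNIV. f i (m \<omega>)) - (\<Sum>i\<in>UNIV. f i q)"
  let ?Y = "\<lambda>\<omega>. sqrt (real CARD('n) * disp t \<omega>)"
  note di = disp_integrable[OF t']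
  have Y2: "(?Y \<omega>)\<^sup>2 = real CARD('n) * disp t \<omega>" if "\<omega> \<in> space P" for \<omega> using di(2)[OF that] by simp
  have [measurable]: "disp t \<in> borel_measurable P" using di(1) by auto
  have iY2: "integrable P (\<lambda>\<omega>. (?Y \<omega>)\<^sup>2)"
    using di(1) Y2 by (subst Bochner_Integration.integrable_cong[OF refl, of _ _ "\<lambda>\<omega>. real CARD('n) * disp t \<omega>"]) auto
  have iY: "integrable P ?Y"
    by (rule square_integrable_imp_integrable[OF _ iY2]) measurable
  have "(expectation ?Y)\<^sup>2 \<le> expectation (\<lambda>\<omega>. (?Y \<omega>)\<^sup>2)"
    using variance_eq[OF iY iY2] variance_positive[of ?Y] by simp
  also have "\<dots> = expectation (\<lambda>\<omega>. real CARD('n) * disp t \<omega>)"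
    by (rule Bochner_Integration.integral_cong[OF refl]) (rule Y2)
  also have "\<dots> = real CARD('n) * expectation (disp t)" by simp
  finally have EY: "expectation ?Y \<le> sqrt (real CARD('n) * expectation (disp t))" by (rule real_le_rsqrt)
  have maj: "integrable P (\<lambda>\<omega>. \<delta> * ?Y \<omega> - ?k \<omega>)"
    by (intro Bochner_Integration.integrable_diff integrable_mult_right iY r(2))
  have le: "?gap \<omega> \<le> \<delta> * ?Y \<omega> - ?k \<omega>" if w: "\<omega> \<in> space P" for \<omega>
    unfolding slope_def disp_def by (rule objective_gap_at_mean[OF x_in[OF t' w] mean[OF w] qX \<delta>_nonneg f_convex grad_bound])
  have nn: "0 \<le> ?gap \<omega>" if w: "\<omega> \<in> space P" for \<omega>
    using dispersion_frechet_mean(1)[OF mean[OF w]] q by (auto simp: is_arg_min_def not_less)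
  \<comment> \<open>The mean may depend on \<open>\<omega>\<close> in a nonmeasurable way; a nonintegrable function has integral \<open>0\<close>, and the
    majorant is nonnegative.\<close>
  have "expectation ?gap \<le> expectation (\<lambda>\<omega>. \<delta> * ?Y \<omega> - ?k \<omega>)"
  proof (cases "integrable P ?gap")
    case True
    then show ?thesis using maj le by (rule integral_mono)
  next
    case False
    have "0 \<le> expectation (\<lambda>\<omega>. \<delta> * ?Y \<omega> - ?k \<omega>)"
      using le nn by (intro Bochner_Integration.integral_nonneg_AE AE_I2) (meson order_trans)
    then show ?thesis using False by (simp add: not_integrable_integral_eq)
  qed
  also have "\<dots> = \<delta> * expectation ?Y - expectation ?k" using iY r(2) by simp
  also have "\<dots> \<le> \<delta> * sqrt (real CARD('n) * expectation (disp t)) - expectation ?k"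
    using EY \<delta>_nonneg by (simp add: mult_left_mono)
  finally show ?thesis .
qed

end

section \<open>Summing the recursions\<close>

text \<open>The bound \<open>c / q\<close> holds for all \<open>t\<close>, and it is the stronger one up to \<open>t = 1 + 1 / q\<close>. Afterwards \<open>q t \<ge> 1\<close>
  lets the bound \<open>(1 + q) c / (q\<^sup>2 t)\<close> reproduce itself.\<close>

lemma contraction_with_decaying_noise:
  fixes a :: "nat \<Rightarrow> real"
  assumes q: "0 < q" "q \<le> 1" and c: "c \<ge> 0" and init: "a 1 \<le> 0"
    and step: "\<And>t. t \<in> {1..T} \<Longrightarrow> a (Suc t) \<le> (1 - q) * a t + c / real t"
  shows "t \<in> {1..Suc T} \<Longrightarrow> a t \<le> (1 + q) / q\<^sup>2 * c / real t"
proof -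
  have plain: "t \<ge> 1 \<Longrightarrow> t \<le> Suc T \<Longrightarrow> a t \<le> c / q" for t
  proof (induction t rule: nat_induct_at_least)
    case base
    then show ?case using init c q by (meson divide_nonneg_pos order_trans)
  next
    case (Suc t)
    have "a (Suc t) \<le> (1 - q) * a t + c / real t" using step Suc by simp
    also have "\<dots> \<le> (1 - q) * (c / q) + c"
    proof (intro add_mono mult_left_mono)
      show "c / real t \<le> c" using c Suc.hyps by (simp add: divide_le_eq mult_le_cancel_left1)
    qed (use Suc q in auto)
    also have "\<dots> = c / q" using q by (simp add: field_simps)
    finally show ?case .
  qed
  have "t \<ge> 1 \<Longrightarrow> t \<le> Suc T \<Longrightarrow> a t \<le> (1 + q) / q\<^sup>2 * c / real t" for t
  proof (induction t rule: nat_induct_at_least)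
    case base
    then show ?case using init c q by (intro order_trans[OF init]) auto
  next
    case (Suc t)
    have t: "real t \<ge> 1" using Suc.hyps by simp
    show ?case
    proof (cases "q * real t \<le> 1")
      case True
      have "a (Suc t) \<le> c / q" using plain[of "Suc t"] Suc.prems by simp
      also have "\<dots> \<le> (1 + q) / q\<^sup>2 * c / real (Suc t)"
      proof -
        have "q * real (Suc t) \<le> 1 + q" using True by (simp add: algebra_simps)
        then have "c * (q * real (Suc t)) \<le> c * (1 + q)" using c by (intro mult_left_mono) auto
        then have "c * (q * real (Suc t)) / (q\<^sup>2 * real (Suc t)) \<le> c * (1 + q) / (q\<^sup>2 * real (Suc t))"
          by (rule divide_right_mono) simp
        moreover have "c * (q * real (Suc t)) / (q\<^sup>2 * real (Suc t)) = c / q"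
          using q by (simp add: power2_eq_square del: of_nat_Suc)
        ultimately show ?thesis by (simp add: mult.commute)
      qed
      finally show ?thesis .
    next
      case False
      have "a (Suc t) \<le> (1 - q) * a t + c / real t" using step Suc by simp
      also have "\<dots> \<le> (1 - q) * ((1 + q) / q\<^sup>2 * c / real t) + c / real t"
        using Suc q by (intro add_right_mono mult_left_mono) auto
      also have "\<dots> = c / (q\<^sup>2 * real t)"
        using q t by (simp add: field_simps power2_eq_square)
      also have "\<dots> \<le> (1 + q) / q\<^sup>2 * c / real (Suc t)"
      proof -
        have "real (Suc t) \<le> (1 + q) * real t" using False by (simp add: algebra_simps)
        then have "c * real (Suc t) \<le> c * ((1 + q) * real t)" using c by (rule mult_left_mono)
        moreover have "q\<^sup>2 > 0" using q by simp
        ultimately show ?thesis using t by (simp add: field_simps del: of_nat_Suc)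
      qed
      finally show ?thesis .
    qed
  qed
  then show "t \<in> {1..Suc T} \<Longrightarrow> a t \<le> (1 + q) / q\<^sup>2 * c / real t" by simp
qed

lemma sum_inverse_le_ln: "T \<ge> 1 \<Longrightarrow> (\<Sum>t=1..T. 1 / real t) \<le> 1 + ln (real T)"
  using decseqD[OF decseq_harm_diff_ln, of 0 "T - 1"] by (simp add: harm_def inverse_eq_divide)

lemma sum_inverse_sqrt_ge: "(\<Sum>t=1..T. 1 / sqrt (real t)) \<ge> sqrt (real T)"
proof (cases "T = 0")
  case False
  have "sqrt (real T) = (\<Sum>t=1..T. 1 / sqrt (real T))"
    using False by (simp add: real_div_sqrt)
  also have "\<dots> \<le> (\<Sum>t=1..T. 1 / sqrt (real t))"
    by (intro sum_mono divide_left_mono) auto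
  finally show ?thesis .
qed simp

context stochastic_rounds
begin

text \<open>The dispersion is \<open>O(\<eta>\<^sub>t\<^sup>2)\<close>, so its square root costs \<open>O(\<eta>\<^sub>t\<^sup>2)\<close> in the weighted gap, as does the gradient noise.
  The distances to the optimum telescope.\<close>

theorem weighted_gap_bound:
  assumes T: "T \<ge> 1" and \<eta>_eq: "\<And>t. \<eta> t = \<eta>0 / sqrt (real t)" and \<eta>0: "\<eta>0 > 0"
    and common: "\<And>i \<omega>. \<omega> \<in> space P \<Longrightarrow> x 1 i \<omega> = x1 \<omega>"
    and q: "is_arg_min (\<lambda>p. \<Sum>i\<in>UNIV. f i p) (\<lambda>p. p \<in> X) q"
    and mean: "\<And>t \<omega>. t \<in> {1..T} \<Longrightarrow> \<omega> \<in> space P \<Longrightarrow> is_frechet_mean M X (\<lambda>i. x t i \<omega>) (m t \<omega>)"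
    and C: "C = (1 + rate\<^sup>2) / rate ^ 4"
    and B: "B = (1 - rate) * (2 * C1 * (\<sigma>\<^sup>2 + \<delta>\<^sup>2) + \<delta>\<^sup>2 / rate)"
    and gap: "\<And>t. gap t = (\<integral>\<omega>. (\<Sum>i\<in>UNIV. f i (m t \<omega>)) - (\<Sum>i\<in>UNIV. f i q) \<partial>P) / real CARD('n)"
  shows "(\<Sum>t=1..T. \<eta> t * gap t) / (\<Sum>t=1..T. \<eta> t)
     \<le> 1 / (2 * real CARD('n) * \<eta>0 * sqrt (real T)) * (\<integral>\<omega>. sqdist_to q 1 \<omega> \<partial>P)
       + \<eta>0 * (\<delta> * sqrt (C * B) + C1 * (\<sigma>\<^sup>2 + \<delta>\<^sup>2)) * ((1 + ln (real T)) / sqrt (real T))"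
proof -
  let ?n = "real CARD('n)"
  have n: "?n > 0" by simp
  have qX: "q \<in> X" using q by (simp add: is_arg_min_def)
  define A where "A t = (\<integral>\<omega>. sqdist_to q t \<omega> \<partial>P)" for t
  define V where "V t = (\<integral>\<omega>. disp t \<omega> \<partial>P)" for t
  define H where "H t = (\<integral>\<omega>. slope t (\<lambda>_. q) \<omega> \<partial>P)" for t
  have B0: "B \<ge> 0" unfolding B using rate(1,4) C1 by (intro mult_nonneg_nonneg add_nonneg_nonneg) auto
  have C0: "C \<ge> 0" unfolding C by simp
  have \<eta>2: "(\<eta> t)\<^sup>2 = \<eta>0\<^sup>2 / real t" if "t \<ge> 1" for t using that by (simp add: \<eta>_eq power_divide)
  have V1: "V 1 \<le> 0"
  proof -
    have "disp 1 \<omega> \<le> 0" if w: "\<omega> \<in> space P" for \<omega>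
    proof -
      have x1: "x1 \<omega> \<in> X" using x_in[of 1 \<omega> undefined] common[OF w] T w by simp
      have "disp 1 \<omega> \<le> (\<Sum>i\<in>UNIV. (rdist M (x 1 i \<omega>) (x1 \<omega>))\<^sup>2)" unfolding disp_def by (rule dispersion_le[OF x1])
      then show ?thesis by (simp only: common[OF w] rdist_self[OF x1]) simp
    qed
    then have "(\<integral>\<omega>. disp 1 \<omega> \<partial>P) \<le> (\<integral>\<omega>. 0 \<partial>P)"
      using T by (intro integral_mono disp_integrable) auto
    then show ?thesis by (simp add: V_def)
  qed
  have V_bound: "V t \<le> (1 + rate\<^sup>2) / (rate\<^sup>2)\<^sup>2 * (?n * B * \<eta>0\<^sup>2) / real t" if "t \<in> {1..Suc T}" for t
  proof (rule contraction_with_decaying_noise[where a = V and T = T])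
    show "V 1 \<le> 0" "t \<in> {1..Suc T}" by fact+
    show "0 < rate\<^sup>2" "rate\<^sup>2 \<le> 1" using rate by (auto simp: power_le_one)
    show "0 \<le> ?n * B * \<eta>0\<^sup>2" using B0 by simp
    fix t assume t: "t \<in> {1..T}"
    have "V (Suc t) \<le> (1 - rate) * ((1 + rate) * V t + ?n * (\<eta> t)\<^sup>2 * (C1 * (\<sigma>\<^sup>2 + \<delta>\<^sup>2) + \<delta>\<^sup>2 / rate))"
      using dispersion_recursion[OF t] by (simp add: V_def)
    also have "\<dots> \<le> (1 - rate) * ((1 + rate) * V t + ?n * (\<eta> t)\<^sup>2 * (2 * C1 * (\<sigma>\<^sup>2 + \<delta>\<^sup>2) + \<delta>\<^sup>2 / rate))"
      using rate(4) C1 by (intro mult_left_mono add_left_mono add_right_mono) (auto simp: mult_right_mono)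
    also have "\<dots> = (1 - rate\<^sup>2) * V t + ?n * B * (\<eta> t)\<^sup>2"
      by (simp add: B power2_eq_square algebra_simps)
    finally show "V (Suc t) \<le> (1 - rate\<^sup>2) * V t + ?n * B * \<eta>0\<^sup>2 / real t"
      using t by (simp add: \<eta>2)
  qed
  define K where "K = \<delta> * sqrt (C * B) + C1 * (\<sigma>\<^sup>2 + \<delta>\<^sup>2)"
  have K0: "K \<ge> 0" using \<delta>_nonneg C0 B0 C1 by (simp add: K_def)
  have one_round: "\<eta> t * gap t \<le> (A t - A (Suc t)) / (2 * ?n) + \<eta>0\<^sup>2 * K * (1 / real t)" if t: "t \<in> {1..T}" for t
  proof -
    have nV: "?n * V t \<le> (?n * \<eta> t)\<^sup>2 * (C * B)"
    proof -
      have "?n * V t \<le> ?n * ((1 + rate\<^sup>2) / (rate\<^sup>2)\<^sup>2 * (?n * B * \<eta>0\<^sup>2) / real t)"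
        using V_bound[of t] t by (intro mult_left_mono) auto
      also have "\<dots> = (?n * \<eta> t)\<^sup>2 * (C * B)"
        using t by (simp add: C \<eta>2 power_mult_distrib power_mult[symmetric])
          (simp add: power2_eq_square mult_ac)
      finally show ?thesis .
    qed
    have "sqrt (?n * V t) \<le> sqrt ((?n * \<eta> t)\<^sup>2 * (C * B))" using nV by (rule real_sqrt_le_mono)
    also have "\<dots> = ?n * \<eta> t * sqrt (C * B)"
      using \<eta>(1)[OF t] by (simp add: real_sqrt_mult)
    finally have "\<delta> * sqrt (?n * V t) \<le> \<delta> * (?n * \<eta> t * sqrt (C * B))" using \<delta>_nonneg by (rule mult_left_mono)
    moreover have "?n * gap t \<le> \<delta> * sqrt (?n * V t) - H t"
      using expected_gap[OF t q mean[OF t]] by (simp add: gap V_def H_def)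
    ultimately have "?n * gap t \<le> \<delta> * (?n * \<eta> t * sqrt (C * B)) - H t" by linarith
    then have g: "\<eta> t * (?n * gap t) \<le> \<eta> t * (\<delta> * (?n * \<eta> t * sqrt (C * B)) - H t)"
      using \<eta>(1)[OF t] by (rule mult_left_mono)
    have d: "- (2 * \<eta> t * H t) \<le> A t - A (Suc t) + ?n * C1 * (\<eta> t)\<^sup>2 * (\<sigma>\<^sup>2 + \<delta>\<^sup>2)"
      using distance_recursion[OF t qX] by (simp add: A_def H_def)
    have "2 * ?n * (\<eta> t * gap t) \<le> 2 * ?n * (\<eta> t)\<^sup>2 * (\<delta> * sqrt (C * B)) - 2 * \<eta> t * H t"
      using g by (simp add: power2_eq_square algebra_simps)
    also have "\<dots> \<le> 2 * ?n * (\<eta> t)\<^sup>2 * (\<delta> * sqrt (C * B)) + (A t - A (Suc t) + 2 * ?n * (\<eta> t)\<^sup>2 * (C1 * (\<sigma>\<^sup>2 + \<delta>\<^sup>2)))"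
    proof -
      have "0 \<le> ?n * C1 * (\<eta> t)\<^sup>2 * (\<sigma>\<^sup>2 + \<delta>\<^sup>2)" using C1 by simp
      moreover have "2 * ?n * (\<eta> t)\<^sup>2 * (C1 * (\<sigma>\<^sup>2 + \<delta>\<^sup>2)) = 2 * (?n * C1 * (\<eta> t)\<^sup>2 * (\<sigma>\<^sup>2 + \<delta>\<^sup>2))" by simp
      ultimately show ?thesis using d by linarith
    qed
    also have "\<dots> = (A t - A (Suc t)) + 2 * ?n * ((\<eta> t)\<^sup>2 * K)" by (simp add: K_def algebra_simps)
    finally have "\<eta> t * gap t \<le> (A t - A (Suc t)) / (2 * ?n) + (\<eta> t)\<^sup>2 * K" using n by (simp add: field_simps)
    then show ?thesis using t by (simp add: \<eta>2)
  qed
  have A0: "A t \<ge> 0" for t unfolding A_def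
    by (rule Bochner_Integration.integral_nonneg) (simp add: sqdist_to_def sum_nonneg)
  have "(\<Sum>t=1..T. \<eta> t * gap t) \<le> (\<Sum>t=1..T. (A t - A (Suc t)) / (2 * ?n) + \<eta>0\<^sup>2 * K * (1 / real t))"
    by (intro sum_mono one_round)
  also have "\<dots> = (\<Sum>t=1..T. A t - A (Suc t)) / (2 * ?n) + \<eta>0\<^sup>2 * K * (\<Sum>t=1..T. 1 / real t)"
    by (simp only: sum.distrib sum_divide_distrib sum_distrib_left)
  also have "(\<Sum>t=1..T. A t - A (Suc t)) = A 1 - A (Suc T)"
    using sum_Suc_diff[of 1 T "\<lambda>t. - A t"] by simp
  also have "(A 1 - A (Suc T)) / (2 * ?n) + \<eta>0\<^sup>2 * K * (\<Sum>t=1..T. 1 / real t)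
      \<le> A 1 / (2 * ?n) + \<eta>0\<^sup>2 * K * (1 + ln (real T))"
    using A0[of "Suc T"] K0 sum_inverse_le_ln[OF T]
    by (intro add_mono mult_left_mono divide_right_mono) auto
  finally have num: "(\<Sum>t=1..T. \<eta> t * gap t) \<le> A 1 / (2 * ?n) + \<eta>0\<^sup>2 * K * (1 + ln (real T))" (is "_ \<le> ?R") .
  have R0: "?R \<ge> 0" using A0 K0 T by (intro add_nonneg_nonneg mult_nonneg_nonneg) auto
  have "(\<Sum>t=1..T. \<eta> t) = \<eta>0 * (\<Sum>t=1..T. 1 / sqrt (real t))" by (simp add: \<eta>_eq sum_distrib_left)
  then have den: "(\<Sum>t=1..T. \<eta> t) \<ge> \<eta>0 * sqrt (real T)"
    using sum_inverse_sqrt_ge[of T] \<eta>0 by (simp add: mult_left_mono)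
  have pos: "\<eta>0 * sqrt (real T) > 0" using \<eta>0 T by simp
  have "(\<Sum>t=1..T. \<eta> t * gap t) / (\<Sum>t=1..T. \<eta> t) \<le> ?R / (\<Sum>t=1..T. \<eta> t)"
    using num den pos by (intro divide_right_mono) auto
  also have "\<dots> \<le> ?R / (\<eta>0 * sqrt (real T))"
    using R0 den pos less_le_trans[OF pos den] by (intro divide_left_mono mult_pos_pos[of "\<Sum>t=1..T. \<eta> t"]) simp_all
  also have "\<dots> = 1 / (2 * ?n * \<eta>0 * sqrt (real T)) * A 1 + \<eta>0 * K * ((1 + ln (real T)) / sqrt (real T))"
    using \<eta>0 T by (simp add: field_simps power2_eq_square)
  finally show ?thesis by (simp add: A_def K_def)
qed

end

theorem theorem2:
  fixes M :: "('m::{t2_space,second_countable_topology}, 'e::euclidean_space) riemannian"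
    and X :: "'m set"
    and D Kmin Kmax C1 C2 C3 C4 \<delta> \<sigma> G :: real
    and E :: "'n::finite \<Rightarrow> 'n \<Rightarrow> bool"
    and W :: "real^'n^'n"
    and Ds :: "'n \<Rightarrow> 's measure"
    and F :: "'n \<Rightarrow> 'm \<Rightarrow> 's \<Rightarrow> real"
    and f :: "'n \<Rightarrow> 'm \<Rightarrow> real"
    and grad :: "'n \<Rightarrow> 'm \<Rightarrow> 'e"
    and P :: "'w measure"
    and x y :: "nat \<Rightarrow> 'n \<Rightarrow> 'w \<Rightarrow> 'm"
    and g :: "nat \<Rightarrow> 'n \<Rightarrow> 'w \<Rightarrow> 'e"
    and x1 :: "'w \<Rightarrow> 'm"
    and xbar :: "nat \<Rightarrow> 'w \<Rightarrow> 'm"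
    and xstar :: 'm
    and \<eta>0 s \<xi> C\<xi> B :: real
    and \<eta> :: "nat \<Rightarrow> real"
    and favg :: "('n \<Rightarrow> 'm) \<Rightarrow> real"
    and T :: nat
  assumes manifold: "riemannian_manifold M"
    \<comment> \<open>network\<close>
    and graph: "symp E" "\<And>i j. E\<^sup>*\<^sup>* i j"
    and W_symmetric: "transpose W = W"
    and W_stochastic: "\<And>i. (\<Sum>j\<in>UNIV. W $ i $ j) = 1" "\<And>j. (\<Sum>i\<in>UNIV. W $ i $ j) = 1"
    and W_nonneg: "\<And>i j. W $ i $ j \<ge> 0"
    and W_diag: "\<And>i. W $ i $ i > 0"
    and W_graph: "\<And>i j. i \<noteq> j \<Longrightarrow> \<not> E i j \<Longrightarrow> W $ i $ j = 0"
    and W_mixing: "sigma2 W < 1"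
    \<comment> \<open>manifold\<close>
    and X_convex: "geodesically_convex M X"
    and curvature: "\<And>p u v. p \<in> X \<Longrightarrow> u \<noteq> v \<Longrightarrow> independent {u, v} \<Longrightarrow>
          Kmin \<le> sectional_curvature M p u v \<and> sectional_curvature M p u v \<le> Kmax"
    and D_pos: "D > 0"
    and diameter: "\<And>p q. p \<in> X \<Longrightarrow> q \<in> X \<Longrightarrow> rdist M p q \<le> D"
    and D_inj: "ereal D < (INF p\<in>X. inj_radius M p)"
    and D_curvature: "Kmax > 0 \<Longrightarrow> D < pi / (2 * sqrt Kmax)"
    and constants: "C1 \<ge> 1" "0 < C2" "C2 \<le> 1" "C3 \<ge> 0" "C4 \<ge> 0"
    and comparison_lower: "\<And>a b c. a \<in> X \<Longrightarrow> b \<in> X \<Longrightarrow> c \<in> X \<Longrightarrow>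
          C2 * (rdist M b c)\<^sup>2 + (rdist M a b)\<^sup>2 - 2 * metric M b (rlog M b a) (rlog M b c)
            \<le> (rdist M a c)\<^sup>2"
    and comparison_upper: "\<And>a b c. a \<in> X \<Longrightarrow> b \<in> X \<Longrightarrow> c \<in> X \<Longrightarrow>
          (rdist M a c)\<^sup>2
            \<le> C1 * (rdist M b c)\<^sup>2 + (rdist M a b)\<^sup>2 - 2 * metric M b (rlog M b a) (rlog M b c)"
    and log_lower: "\<And>p q r. p \<in> X \<Longrightarrow> q \<in> X \<Longrightarrow> r \<in> X \<Longrightarrow>
          inverse (1 + C3 * D\<^sup>2) * rdist M q r \<le> norm_at M p (rlog M p q - rlog M p r)"
    and log_upper: "\<And>p q r. p \<in> X \<Longrightarrow> q \<in> X \<Longrightarrow> r \<in> X \<Longrightarrow>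
          norm_at M p (rlog M p q - rlog M p r) \<le> (1 + C4 * D\<^sup>2) * rdist M q r"
    \<comment> \<open>objectives\<close>
    and distributions: "\<And>i. prob_space (Ds i)"
    and F_integrable: "\<And>i p. p \<in> X \<Longrightarrow> integrable (Ds i) (F i p)"
    and f_expectation: "\<And>i p. p \<in> X \<Longrightarrow> f i p = (\<integral>z. F i p z \<partial>Ds i)"
    and f_C1: "\<And>i. C1_with_gradient M X (f i) (grad i)"
    and \<delta>_pos: "\<delta> > 0"
    and grad_bound: "\<And>i p. p \<in> X \<Longrightarrow> norm_at M p (grad i p) \<le> \<delta>"
    and f_convex: "\<And>i. geodesically_convex_fun M X (f i) (grad i)"
    and xstar: "is_arg_min (\<lambda>p. (1 / real CARD('n)) * (\<Sum>i\<in>UNIV. f i p)) (\<lambda>p. p \<in> X) xstar"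
    \<comment> \<open>iterates\<close>
    and P: "prob_space P"
    and T_pos: "T \<ge> 1"
    and G_pos: "G > 0"
    and \<eta>0: "\<eta>0 = min 1 (D / G)"
    and \<eta>: "\<And>t. \<eta> t = \<eta>0 / sqrt (real t)"
    and s: "s = C2 / (2 * C1)"
    and x_random: "\<And>i t. t \<in> {1..Suc T} \<Longrightarrow> x t i \<in> borel_measurable P"
    and x_init: "\<And>i \<omega>. \<omega> \<in> space P \<Longrightarrow> x 1 i \<omega> = x1 \<omega>"
    and y_step: "\<And>i t \<omega>. t \<in> {1..T} \<Longrightarrow> \<omega> \<in> space P \<Longrightarrow>
          y (Suc t) i \<omega> = rexp M (x t i \<omega>) (- \<eta> t *\<^sub>R g t i \<omega>)"
    and x_step: "\<And>i t \<omega>. t \<in> {1..T} \<Longrightarrow> \<omega> \<in> space P \<Longrightarrow>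
          x (Suc t) i \<omega> = rexp M (y (Suc t) i \<omega>)
            (s *\<^sub>R (\<Sum>j\<in>UNIV. W $ i $ j *\<^sub>R rlog M (y (Suc t) i \<omega>) (y (Suc t) j \<omega>)))"
    and x_in: "\<And>i t \<omega>. t \<in> {1..Suc T} \<Longrightarrow> \<omega> \<in> space P \<Longrightarrow> x t i \<omega> \<in> X"
    and y_in: "\<And>i t \<omega>. t \<in> {2..Suc T} \<Longrightarrow> \<omega> \<in> space P \<Longrightarrow> y t i \<omega> \<in> X"
    \<comment> \<open>stochastic gradients\<close>
    and unbiased: "\<And>i t. t \<in> {1..T} \<Longrightarrow>
          tangent_cond_exp M P (iterate_filtration P x t) (x t i) (g t i) (\<lambda>\<omega>. grad i (x t i \<omega>))"
    and variance: "\<And>i t. t \<in> {1..T} \<Longrightarrow>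
          AE \<omega> in P. real_cond_exp P (iterate_filtration P x t)
            (\<lambda>\<omega>. (norm_at M (x t i \<omega>) (g t i \<omega> - grad i (x t i \<omega>)))\<^sup>2) \<omega> \<le> \<sigma>\<^sup>2"
    and g_bound: "\<And>i t. t \<in> {1..T} \<Longrightarrow> AE \<omega> in P. norm_at M (x t i \<omega>) (g t i \<omega>) \<le> G"
    \<comment> \<open>quantities in the bound\<close>
    and xbar: "\<And>t \<omega>. t \<in> {1..T} \<Longrightarrow> \<omega> \<in> space P \<Longrightarrow> is_frechet_mean M X (\<lambda>i. x t i \<omega>) (xbar t \<omega>)"
    and favg: "\<And>z. favg z = (1 / real CARD('n)) * (\<Sum>i\<in>UNIV. f i (z i))"
    and \<xi>: "\<xi> = C2 ^ 3 * (1 - sigma2 W) / (4 * C1 * (1 + C4 * D\<^sup>2)\<^sup>2)"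
    and C\<xi>: "C\<xi> = (1 + \<xi>\<^sup>2) / \<xi> ^ 4"
    and B: "B = (1 - \<xi>) * (2 * C1 * (\<sigma>\<^sup>2 + \<delta>\<^sup>2) + inverse \<xi> * \<delta>\<^sup>2)"
  shows "(\<Sum>t=1..T. \<eta> t * (\<integral>\<omega>. favg (\<lambda>i. xbar t \<omega>) - favg (\<lambda>i. xstar) \<partial>P)) / (\<Sum>t=1..T. \<eta> t)
     \<le> 1 / (2 * real CARD('n) * \<eta>0 * sqrt (real T))
          * (\<Sum>i\<in>UNIV. (\<integral>\<omega>. (rdist M (x 1 i \<omega>) xstar)\<^sup>2 \<partial>P))
       + \<eta>0 * (\<delta> * sqrt (C\<xi> * B) + C1 * (\<sigma>\<^sup>2 + \<delta>\<^sup>2)) * ((1 + ln (real T)) / sqrt (real T))"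
proof -
  note step_size = \<eta>
  have \<eta>0_pos: "\<eta>0 > 0" using D_pos G_pos by (simp add: \<eta>0)
  have \<eta>0_G: "\<eta>0 * G \<le> D"
  proof -
    have "\<eta>0 * G \<le> D / G * G" using G_pos by (intro mult_right_mono) (auto simp: \<eta>0)
    then show ?thesis using G_pos by simp
  qed
  have \<eta>_nonneg: "\<eta> t \<ge> 0" for t using \<eta>0_pos by (simp add: \<eta>)
  have \<eta>_G: "\<eta> t * G \<le> D" if "t \<in> {1..T}" for t
  proof -
    have "\<eta> t \<le> \<eta>0" using that \<eta>0_pos by (simp add: \<eta> divide_le_eq mult_le_cancel_left1)
    then have "\<eta> t * G \<le> \<eta>0 * G" using G_pos by (intro mult_right_mono) auto
    then show ?thesis using \<eta>0_G by linarith
  qed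
  have below_inj: "ereal D < inj_radius M p" if "p \<in> X" for p
    using D_inj INF_lower[OF that, of "inj_radius M"] by (rule less_le_trans)
  interpret prob_space P by (rule P)
  interpret mixing_domain M X D C1 C2 C4 W
    by (unfold_locales; fact manifold X_convex D_pos diameter below_inj constants comparison_lower
      comparison_upper log_upper W_symmetric W_stochastic(1) W_nonneg W_mixing)
  have y_eq: "(\<lambda>i. rexp M (x t i \<omega>) (- \<eta> t *\<^sub>R g t i \<omega>)) = (\<lambda>i. y (Suc t) i \<omega>)"
    if "t \<in> {1..T}" "\<omega> \<in> space P" for t \<omega>
    using y_step[OF that] by simp
  interpret stochastic_rounds M X D C1 C2 C4 W P x g f grad \<delta> \<sigma> G \<eta> T
  proof unfold_locales
    show "rexp M (x t i \<omega>) (- \<eta> t *\<^sub>R g t i \<omega>) \<in> X" if "t \<in> {1..T}" "\<omega> \<in> space P" for t i \<omega>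
      using y_step[OF that, of i] y_in[of "Suc t" \<omega> i] that by simp
    show "x (Suc t) i \<omega> = consensus_step (\<lambda>i. rexp M (x t i \<omega>) (- \<eta> t *\<^sub>R g t i \<omega>)) i"
      if "t \<in> {1..T}" "\<omega> \<in> space P" for t i \<omega>
      unfolding y_eq[OF that] using x_step[OF that, of i] by (simp add: consensus_step_def s)
    show "0 \<le> \<delta>" using \<delta>_pos by simp
    show "0 \<le> \<eta> t" for t by (rule \<eta>_nonneg)
  qed (fact x_random x_in \<eta>_G grad_bound f_convex unbiased variance g_bound)+
  have r: "rate = \<xi>" by (simp add: rate_def \<xi>)
  have q: "is_arg_min (\<lambda>p. \<Sum>i\<in>UNIV. f i p) (\<lambda>p. p \<in> X) xstar"
    using xstar by (simp add: is_arg_min_def divide_less_cancel)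
  have starX: "xstar \<in> X" using xstar by (simp add: is_arg_min_def)
  have gap: "(\<integral>\<omega>. favg (\<lambda>i. xbar t \<omega>) - favg (\<lambda>i. xstar) \<partial>P)
      = (\<integral>\<omega>. (\<Sum>i\<in>UNIV. f i (xbar t \<omega>)) - (\<Sum>i\<in>UNIV. f i xstar) \<partial>P) / real CARD('n)" for t
    by (simp add: favg diff_divide_distrib[symmetric])
  have dist: "(\<Sum>i\<in>UNIV. (\<integral>\<omega>. (rdist M (x 1 i \<omega>) xstar)\<^sup>2 \<partial>P)) = (\<integral>\<omega>. sqdist_to xstar 1 \<omega> \<partial>P)"
  proof -
    have t: "(1::nat) \<in> {1..Suc T}" by simp
    have int: "integrable P (\<lambda>\<omega>. (rdist M xstar (x 1 i \<omega>))\<^sup>2)" for i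
    proof (rule integrable_const_bound[of _ "D\<^sup>2"])
      show "AE \<omega> in P. norm ((rdist M xstar (x 1 i \<omega>))\<^sup>2) \<le> D\<^sup>2"
        using diameter starX x_in[OF t] rdist_nonneg by (intro AE_I2) (simp add: power_mono)
      show "(\<lambda>\<omega>. (rdist M xstar (x 1 i \<omega>))\<^sup>2) \<in> borel_measurable P"
        by (intro borel_measurable_power rdist_measurable x_random[OF t] x_in[OF t] starX)
    qed
    have "(\<integral>\<omega>. (rdist M (x 1 i \<omega>) xstar)\<^sup>2 \<partial>P) = (\<integral>\<omega>. (rdist M xstar (x 1 i \<omega>))\<^sup>2 \<partial>P)" for i
      by (rule Bochner_Integration.integral_cong[OF refl]) (simp only: rdist_sym[OF x_in[OF t] starX])
    then show ?thesis unfolding sqdist_to_def using int by simp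
  qed
  have B': "B = (1 - rate) * (2 * C1 * (\<sigma>\<^sup>2 + \<delta>\<^sup>2) + \<delta>\<^sup>2 / rate)"
    by (simp add: B r inverse_eq_divide)
  show ?thesis
    unfolding dist
    by (rule weighted_gap_bound[OF T_pos step_size \<eta>0_pos x_init q xbar C\<xi>[folded r] B' gap])
qed

end
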